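(* Let $\mathcal O\subseteq\mathbb R^d$ be a smooth, bounded domain and let $f_{\min},g_{\min}>0$. Suppose that for $i\in\{1,2\}$ we have functions $$u_i\in H^2(\mathcal O),\quad f_i\in C^1(\mathcal O),\quad g_i\in L^2(\mathcal O)\quad\text{with}\quad \nabla\cdot(f_i\nabla u_i)=g_i\ \text{ on }\mathcal O.$$ Assume that the first triplet $(u_1,f_1,g_1)$ additionally satisfies $u_1\in C^2(\mathcal O)\cap C(\bar{\mathcal O})$, $g_1\in C(\mathcal O)$ and $$\inf_{x\in\mathcal O}f_1(x)\ge f_{\min},\qquad \inf_{x\in\mathcal O}g_1(x)\ge g_{\min},\qquad u_1|_{\partial\mathcal O}=0.$$ Then for every $B>0$ there exists a constant $C>0$, depending solely on $f_{\min},g_{\min},\mathcal O$ and $B$, such that whenever $\|f_1\|_{C^1}\vee\|u_1\|_{C^2}\le B$, it holds that $$\|f_1-f_2\|_{L^2(\mathcal O)}\le C\big(\|f_2\|_{C^1}\|u_1-u_2\|_{H^2(\mathcal O)}+\|g_1-g_2\|_{L^2(\mathcal O)}\big).$$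
   Context: For integer $k\ge1$, $C^k(\mathcal O)$ is the space of $k$-times continuously differentiable functions on $\mathcal O$ with finite norm $\|u\|_{C^k}=\max_{|\beta|\le k}\sup_{x\in\mathcal O}|\partial^\beta u(x)|$. $C(\mathcal O)$ and $C(\bar{\mathcal O})$ are spaces of continuous functions with the supremum norm. $H^2(\mathcal O)$ is the $L^2$-Sobolev space of order $2$. $a\vee b=\max(a,b)$. *)

theory Defs
  imports "HOL-Analysis.Analysis"
begin

section \<open>Multi-indices and classical partial derivatives\<close>

type_synonym 'n multi_index = "'n \<Rightarrow> nat"

definition mi_order :: "('n::finite) multi_index \<Rightarrow> nat" where
  "mi_order \<beta> = (\<Sum>i\<in>UNIV. \<beta> i)"

definition mi_unit :: "'n \<Rightarrow> 'n multi_index" where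
  "mi_unit i = (\<lambda>j. if j = i then 1 else 0)"

text \<open>Only meaningful at points of differentiability; every use below is on functions for which
  differentiability is required.\<close>

definition partial_deriv :: "'n::finite \<Rightarrow> (real^'n \<Rightarrow> real) \<Rightarrow> real^'n \<Rightarrow> real" where
  "partial_deriv i u x = frechet_derivative u (at x) (axis i 1)"

text \<open>The index type carries no order, so the order in which the partial derivatives are taken is
  chosen arbitrarily. For a function that is \<open>k\<close> times continuously differentiable on an open set
  the result does not depend on this choice when \<open>mi_order \<beta> \<le> k\<close> (symmetry of mixed partial
  derivatives).\<close>

definition mi_deriv :: "('n::finite) multi_index \<Rightarrow> (real^'n \<Rightarrow> real) \<Rightarrow> real^'n \<Rightarrow> real" where
  "mi_deriv \<beta> u = foldr partial_deriv (SOME is. \<forall>i. count_list is i = \<beta> i) u"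

fun cont_diff_on :: "nat \<Rightarrow> (real^'n::finite) set \<Rightarrow> (real^'n \<Rightarrow> real) \<Rightarrow> bool" where
  "cont_diff_on 0 S u \<longleftrightarrow> continuous_on S u"
| "cont_diff_on (Suc k) S u \<longleftrightarrow>
     (\<forall>x\<in>S. u differentiable (at x)) \<and> (\<forall>i. cont_diff_on k S (partial_deriv i u))"

definition smooth_fun_on :: "(real^'n::finite) set \<Rightarrow> (real^'n \<Rightarrow> real) \<Rightarrow> bool" where
  "smooth_fun_on S u \<longleftrightarrow> (\<forall>k. cont_diff_on k S u)"


section \<open>Smooth bounded domains\<close>

text \<open>The boundary is locally the graph of a smooth function \<open>\<gamma>\<close> of \<open>d - 1\<close> of the coordinates,
  with the domain on one side of it. The function \<open>\<gamma>\<close> is represented as a function on the whole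
  space that does not depend on the coordinate \<open>i\<close>; the sign \<open>s\<close> fixes the orientation of the
  \<open>i\<close>-th axis.\<close>

definition smooth_boundary :: "(real^'n::finite) set \<Rightarrow> bool" where
  "smooth_boundary S \<longleftrightarrow>
     (\<forall>p\<in>frontier S. \<exists>r>0. \<exists>i. \<exists>s\<in>{-1, 1}. \<exists>\<gamma>.
        smooth_fun_on UNIV \<gamma> \<and>
        (\<forall>x y. (\<forall>j. j \<noteq> i \<longrightarrow> x $ j = y $ j) \<longrightarrow> \<gamma> x = \<gamma> y) \<and>
        S \<inter> ball p r = {x \<in> ball p r. s * (x $ i) > \<gamma> x})"

definition smooth_bounded_domain :: "(real^'n::finite) set \<Rightarrow> bool" where
  "smooth_bounded_domain S \<longleftrightarrow>
     open S \<and> connected S \<and> S \<noteq> {} \<and> bounded S \<and> smooth_boundary S"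


section \<open>The spaces \<open>C\<^sup>k\<close>\<close>

definition Ck_space :: "nat \<Rightarrow> (real^'n::finite) set \<Rightarrow> (real^'n \<Rightarrow> real) set" where
  "Ck_space k S =
     {u. cont_diff_on k S u \<and> (\<forall>\<beta>. mi_order \<beta> \<le> k \<longrightarrow> bounded (mi_deriv \<beta> u ` S))}"

definition Ck_norm :: "nat \<Rightarrow> (real^'n::finite) set \<Rightarrow> (real^'n \<Rightarrow> real) \<Rightarrow> real" where
  "Ck_norm k S u = Max ((\<lambda>\<beta>. SUP x\<in>S. \<bar>mi_deriv \<beta> u x\<bar>) ` {\<beta>. mi_order \<beta> \<le> k})"


section \<open>The spaces \<open>L\<^sup>2\<close> and \<open>H\<^sup>k\<close>\<close>

text \<open>Elements of these spaces are represented by functions rather than by classes modulo null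
  sets.\<close>

definition L2_space :: "(real^'n::finite) set \<Rightarrow> (real^'n \<Rightarrow> real) set" where
  "L2_space S = {u \<in> borel_measurable (lebesgue_on S). integrable (lebesgue_on S) (\<lambda>x. (u x)\<^sup>2)}"

definition L2_norm :: "(real^'n::finite) set \<Rightarrow> (real^'n \<Rightarrow> real) \<Rightarrow> real" where
  "L2_norm S u = sqrt (LINT x|lebesgue_on S. (u x)\<^sup>2)"

definition test_fun :: "(real^'n::finite) set \<Rightarrow> (real^'n \<Rightarrow> real) \<Rightarrow> bool" where
  "test_fun S \<phi> \<longleftrightarrow>
     smooth_fun_on UNIV \<phi> \<and> compact (closure {x. \<phi> x \<noteq> 0}) \<and> closure {x. \<phi> x \<noteq> 0} \<subseteq> S"

definition locally_integrable :: "(real^'n::finite) set \<Rightarrow> (real^'n \<Rightarrow> real) \<Rightarrow> bool" where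
  "locally_integrable S u \<longleftrightarrow> (\<forall>K. compact K \<and> K \<subseteq> S \<longrightarrow> integrable (lebesgue_on K) u)"

definition has_weak_deriv ::
    "(real^'n::finite) set \<Rightarrow> 'n multi_index \<Rightarrow> (real^'n \<Rightarrow> real) \<Rightarrow> (real^'n \<Rightarrow> real) \<Rightarrow> bool" where
  "has_weak_deriv S \<beta> u v \<longleftrightarrow>
     locally_integrable S u \<and> locally_integrable S v \<and>
     (\<forall>\<phi>. test_fun S \<phi> \<longrightarrow>
        (LINT x|lebesgue_on S. u x * mi_deriv \<beta> \<phi> x) =
        (-1) ^ mi_order \<beta> * (LINT x|lebesgue_on S. v x * \<phi> x))"

text \<open>On an open set the weak derivative, if it exists, is unique up to null sets; an arbitrary
  representative is selected.\<close>

definition weak_deriv ::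
    "(real^'n::finite) set \<Rightarrow> 'n multi_index \<Rightarrow> (real^'n \<Rightarrow> real) \<Rightarrow> real^'n \<Rightarrow> real" where
  "weak_deriv S \<beta> u = (SOME v. has_weak_deriv S \<beta> u v)"

definition Hk_space :: "nat \<Rightarrow> (real^'n::finite) set \<Rightarrow> (real^'n \<Rightarrow> real) set" where
  "Hk_space k S =
     {u \<in> L2_space S. \<forall>\<beta>. mi_order \<beta> \<le> k \<longrightarrow> (\<exists>v\<in>L2_space S. has_weak_deriv S \<beta> u v)}"

definition Hk_norm :: "nat \<Rightarrow> (real^'n::finite) set \<Rightarrow> (real^'n \<Rightarrow> real) \<Rightarrow> real" where
  "Hk_norm k S u = sqrt (\<Sum>\<beta> | mi_order \<beta> \<le> k. (L2_norm S (weak_deriv S \<beta> u))\<^sup>2)"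


section \<open>The divergence-form equation\<close>

definition weak_gradient ::
    "(real^'n::finite) set \<Rightarrow> (real^'n \<Rightarrow> real) \<Rightarrow> real^'n \<Rightarrow> real^'n" where
  "weak_gradient S u x = (\<chi> i. weak_deriv S (mi_unit i) u x)"

definition has_weak_divergence ::
    "(real^'n::finite) set \<Rightarrow> (real^'n \<Rightarrow> real^'n) \<Rightarrow> (real^'n \<Rightarrow> real) \<Rightarrow> bool" where
  "has_weak_divergence S F g \<longleftrightarrow>
     (\<forall>i. locally_integrable S (\<lambda>x. F x $ i)) \<and> locally_integrable S g \<and>
     (\<forall>\<phi>. test_fun S \<phi> \<longrightarrow>
        (LINT x|lebesgue_on S. (\<Sum>i\<in>UNIV. F x $ i * partial_deriv i \<phi> x)) =
        - (LINT x|lebesgue_on S. g x * \<phi> x))"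

text \<open>The equation \<open>\<nabla> \<cdot> (f \<nabla>u) = g\<close> on \<open>S\<close>, in terms of weak derivatives.\<close>

definition divergence_eq ::
    "(real^'n::finite) set \<Rightarrow> (real^'n \<Rightarrow> real) \<Rightarrow> (real^'n \<Rightarrow> real) \<Rightarrow> (real^'n \<Rightarrow> real) \<Rightarrow> bool" where
  "divergence_eq S f u g \<longleftrightarrow> has_weak_divergence S (\<lambda>x. f x *\<^sub>R weak_gradient S u x) g"

end

theory Submission
  imports Defs
begin

text \<open>
  Let \<open>h = f\<^sub>1 - f\<^sub>2\<close> and \<open>u = u\<^sub>1\<close>. Subtracting the two equations gives
  \<open>\<nabla> \<cdot> (h \<nabla>u) = G\<close> with \<open>G = g\<^sub>1 - g\<^sub>2 - \<nabla> \<cdot> (f\<^sub>2 \<nabla>(u\<^sub>1 - u\<^sub>2))\<close> (\<open>difference_equation\<close>), and the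
  \<open>L\<^sup>2\<close> norm of \<open>G\<close> is bounded by a multiple of the right-hand side of the claim
  (\<open>source_L2_bound\<close>). It remains to bound \<open>h\<close> by \<open>G\<close> in \<open>L\<^sup>2\<close> (\<open>energy_estimate\<close>).

  For a weight \<open>W\<close> such that \<open>h\<^sup>2 W(u) \<nabla>u\<close> has compact support in the domain, the divergence of
  this field integrates to zero, which reads
  \<open>2 \<integral> h W(u) G = \<integral> h\<^sup>2 (W(u) \<Delta>u - W'(u) \<bar>\<nabla>u\<bar>\<^sup>2)\<close>. If \<open>W' \<le> - \<mu> W\<close>, the right-hand side is at
  least \<open>\<integral> h\<^sup>2 W(u) (\<Delta>u + \<mu> \<bar>\<nabla>u\<bar>\<^sup>2)\<close>. From \<open>f\<^sub>1 \<Delta>u + \<nabla>f\<^sub>1 \<cdot> \<nabla>u = g\<^sub>1 \<ge> gmin\<close> and Young's inequality,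
  \<open>\<Delta>u + \<mu> \<bar>\<nabla>u\<bar>\<^sup>2 \<ge> gmin / (2 B)\<close> for a suitable \<open>\<mu>\<close> (\<open>laplacian_lower_bound\<close>), so that a second use
  of Young's inequality gives the estimate weighted by \<open>W(u)\<close>. The maximum principle gives
  \<open>u < 0\<close> in the domain. Hence \<open>W\<close> may be taken as \<open>exp (- \<mu> t)\<close> times a nonincreasing cutoff that
  vanishes near \<open>t = 0\<close>; the derivative of the cutoff has the favourable sign, and the cutoff is
  removed by a limit. In this way neither boundary terms nor traces occur.

  The equations hold in the weak sense with smooth test functions. Mollification
  (\<open>test_fun_approximation\<close>) extends the weak identities to compactly supported \<open>C\<^sup>1\<close> test functions, which yields
  the product rule for \<open>\<nabla> \<cdot> (f\<^sub>2 \<nabla>(u\<^sub>1 - u\<^sub>2))\<close>, and gives the fundamental lemma of the calculus of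
  variations, by which weak derivatives and divergences are unique almost everywhere.
\<close>

section \<open>Multi-indices and norms\<close>

lemma finite_mi_order_le: "finite {\<beta> :: ('n::finite) multi_index. mi_order \<beta> \<le> k}"
proof (rule finite_subset)
  show "finite (PiE (UNIV :: 'n set) (\<lambda>_. {..k}))"
    by (intro finite_PiE) auto
  have "\<beta> i \<le> k" if "mi_order \<beta> \<le> k" for \<beta> :: "'n multi_index" and i
    using that member_le_sum[of i UNIV \<beta>] by (simp add: mi_order_def)
  then show "{\<beta> :: 'n multi_index. mi_order \<beta> \<le> k} \<subseteq> PiE UNIV (\<lambda>_. {..k})"
    by (auto simp: PiE_UNIV_domain)
qed

lemma count_list_single_iff:
  "(\<forall>j. count_list xs j = (if j = i then n else 0)) \<longleftrightarrow> xs = replicate n i"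
proof (induction xs arbitrary: n)
  case Nil
  then show ?case by (cases n) (auto intro: exI[of _ i])
next
  case (Cons a xs)
  show ?case
  proof (cases n)
    case 0
    then show ?thesis by (auto intro!: exI[of _ a])
  next
    case (Suc m)
    have "(\<forall>j. count_list (a # xs) j = (if j = i then n else 0)) \<longleftrightarrow>
        a = i \<and> (\<forall>j. count_list xs j = (if j = i then m else 0))"
      using Suc by (auto split: if_splits)
    then show ?thesis using Cons Suc by simp
  qed
qed

text \<open>The multi-index \<open>n e\<^sub>i\<close>.\<close>

definition mi_axis :: "nat \<Rightarrow> 'n \<Rightarrow> 'n multi_index" where
  "mi_axis n i = (\<lambda>j. if j = i then n else 0)"

lemma mi_unit_eq: "mi_unit i = mi_axis 1 i"
  by (simp add: mi_unit_def mi_axis_def fun_eq_iff)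

lemma mi_order_axis [simp]: "mi_order (mi_axis n i) = n"
  by (simp add: mi_order_def mi_axis_def)

lemma mi_deriv_axis: "mi_deriv (mi_axis n i) u = (partial_deriv i ^^ n) u"
proof -
  have "(SOME xs. \<forall>j. count_list xs j = mi_axis n i j) = replicate n i"
    unfolding mi_axis_def count_list_single_iff by simp
  then show ?thesis by (simp add: mi_deriv_def)
qed

lemma Ck_norm_bound:
  assumes "u \<in> Ck_space k S" "mi_order \<beta> \<le> k" "x \<in> S"
  shows "\<bar>mi_deriv \<beta> u x\<bar> \<le> Ck_norm k S u"
proof -
  have "bounded (mi_deriv \<beta> u ` S)"
    using assms by (simp add: Ck_space_def)
  then have "bdd_above ((\<lambda>x. \<bar>mi_deriv \<beta> u x\<bar>) ` S)"
    by (auto simp: bounded_iff bdd_above_def)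
  then have "\<bar>mi_deriv \<beta> u x\<bar> \<le> (SUP x\<in>S. \<bar>mi_deriv \<beta> u x\<bar>)"
    using assms by (intro cSUP_upper) auto
  also have "\<dots> \<le> Ck_norm k S u"
    unfolding Ck_norm_def using assms finite_mi_order_le by (intro Max_ge) auto
  finally show ?thesis .
qed

lemma Ck_norm_axis_bound:
  assumes "u \<in> Ck_space k S" "n \<le> k" "x \<in> S"
  shows "\<bar>(partial_deriv i ^^ n) u x\<bar> \<le> Ck_norm k S u"
  using Ck_norm_bound[OF assms(1) _ assms(3), of "mi_axis n i"] assms(2)
  by (simp add: mi_deriv_axis)

lemma L2_norm_weak_deriv_le:
  assumes "mi_order \<beta> \<le> k"
  shows "(L2_norm S (weak_deriv S \<beta> u))\<^sup>2 \<le> (Hk_norm k S u)\<^sup>2"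
proof -
  have "(Hk_norm k S u)\<^sup>2 = (\<Sum>\<beta> | mi_order \<beta> \<le> k. (L2_norm S (weak_deriv S \<beta> u))\<^sup>2)"
    unfolding Hk_norm_def by (simp add: sum_nonneg)
  moreover have "(L2_norm S (weak_deriv S \<beta> u))\<^sup>2
      \<le> (\<Sum>\<beta> | mi_order \<beta> \<le> k. (L2_norm S (weak_deriv S \<beta> u))\<^sup>2)"
    using assms finite_mi_order_le
    by (intro member_le_sum[where f = "\<lambda>\<beta>. (L2_norm S (weak_deriv S \<beta> u))\<^sup>2"]) auto
  ultimately show ?thesis by simp
qed

section \<open>Calculus of partial derivatives\<close>

lemma partial_deriv_eqI: "(f has_derivative D) (at x) \<Longrightarrow> partial_deriv i f x = D (axis i 1)"
  unfolding partial_deriv_def by (metis frechet_derivative_at)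

lemma has_derivative_partial_deriv:
  assumes "f differentiable (at x)"
  shows "(f has_derivative (\<lambda>v. \<Sum>i\<in>UNIV. v $ i * partial_deriv i f x)) (at x)"
proof -
  have D: "(f has_derivative frechet_derivative f (at x)) (at x)"
    using assms frechet_derivative_works by blast
  have "frechet_derivative f (at x) = (\<lambda>v. \<Sum>i\<in>UNIV. v $ i * partial_deriv i f x)"
  proof
    fix v
    have "frechet_derivative f (at x) v = frechet_derivative f (at x) (\<Sum>i\<in>UNIV. v $ i *\<^sub>R axis i 1)"
      using basis_expansion[of v] by (simp add: scalar_mult_eq_scaleR)
    also have "\<dots> = (\<Sum>i\<in>UNIV. v $ i * partial_deriv i f x)"
      using has_derivative_bounded_linear[OF D, THEN bounded_linear.linear]
      by (simp add: linear_sum linear_cmul partial_deriv_def)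
    finally show "frechet_derivative f (at x) v = (\<Sum>i\<in>UNIV. v $ i * partial_deriv i f x)" .
  qed
  with D show ?thesis by simp
qed

lemma partial_deriv_cong_open:
  assumes "f differentiable (at x)" "open S" "x \<in> S" "\<And>y. y \<in> S \<Longrightarrow> f y = g y"
  shows "partial_deriv i f x = partial_deriv i g x"
  unfolding partial_deriv_def using frechet_derivative_transform_within_open[OF assms] by simp

lemma differentiable_cong_open:
  assumes "f differentiable (at x)" "open S" "x \<in> S" "\<And>y. y \<in> S \<Longrightarrow> f y = g y"
  shows "g differentiable (at x)"
  using assms has_derivative_transform_within_open unfolding differentiable_def by metis

lemma partial_deriv_const [simp]: "partial_deriv i (\<lambda>x. c) x = 0"
  by (simp add: partial_deriv_def)

lemma partial_deriv_mult:
  assumes "f differentiable (at x)" "g differentiable (at x)"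
  shows "partial_deriv i (\<lambda>x. f x * g x) x = partial_deriv i f x * g x + f x * partial_deriv i g x"
  using partial_deriv_eqI[OF has_derivative_mult[OF frechet_derivative_works[THEN iffD1, OF assms(1)]
        frechet_derivative_works[THEN iffD1, OF assms(2)]]]
  by (simp add: partial_deriv_def)

lemma partial_deriv_add:
  assumes "f differentiable (at x)" "g differentiable (at x)"
  shows "partial_deriv i (\<lambda>x. f x + g x) x = partial_deriv i f x + partial_deriv i g x"
  using partial_deriv_eqI[OF has_derivative_add[OF frechet_derivative_works[THEN iffD1, OF assms(1)]
        frechet_derivative_works[THEN iffD1, OF assms(2)]]]
  by (simp add: partial_deriv_def)

lemma partial_deriv_diff:
  assumes "f differentiable (at x)" "g differentiable (at x)"
  shows "partial_deriv i (\<lambda>x. f x - g x) x = partial_deriv i f x - partial_deriv i g x"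
  using partial_deriv_eqI[OF has_derivative_diff[OF frechet_derivative_works[THEN iffD1, OF assms(1)]
        frechet_derivative_works[THEN iffD1, OF assms(2)]]]
  by (simp add: partial_deriv_def)

lemma has_derivative_real_compose:
  assumes "f differentiable (at x)" "(W has_real_derivative W') (at (f x))"
  shows "((\<lambda>x. W (f x)) has_derivative (\<lambda>v. W' * frechet_derivative f (at x) v)) (at x)"
  using has_derivative_compose[OF frechet_derivative_works[THEN iffD1, OF assms(1)]
      has_field_derivative_imp_has_derivative[OF assms(2)]]
  by simp

lemma partial_deriv_compose:
  assumes "f differentiable (at x)" "(W has_real_derivative W') (at (f x))"
  shows "partial_deriv i (\<lambda>x. W (f x)) x = W' * partial_deriv i f x"
  using partial_deriv_eqI[OF has_derivative_real_compose[OF assms]] by (simp add: partial_deriv_def)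

lemma has_real_derivative_along_axis:
  assumes "u differentiable (at (x + t *\<^sub>R axis i 1))"
  shows "((\<lambda>t. u (x + t *\<^sub>R axis i 1)) has_real_derivative
     partial_deriv i u (x + t *\<^sub>R axis i 1)) (at t)"
proof -
  let ?D = "frechet_derivative u (at (x + t *\<^sub>R axis i 1))"
  have D: "(u has_derivative ?D) (at (x + t *\<^sub>R axis i 1))"
    using assms frechet_derivative_works by blast
  have "((\<lambda>t. x + t *\<^sub>R axis i (1::real)) has_derivative (\<lambda>s. s *\<^sub>R axis i 1)) (at t)"
    by (auto intro!: derivative_eq_intros)
  from has_derivative_compose[OF this D]
  have "((\<lambda>t. u (x + t *\<^sub>R axis i 1)) has_derivative (\<lambda>s. ?D (s *\<^sub>R axis i 1))) (at t)" .
  moreover have "?D (s *\<^sub>R axis i 1) = partial_deriv i u (x + t *\<^sub>R axis i 1) * s" for s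
    using has_derivative_bounded_linear[OF D, THEN bounded_linear.linear]
    by (simp add: linear_cmul partial_deriv_def)
  ultimately show ?thesis by (simp add: has_field_derivative_def)
qed

lemma cont_diff_on_1_iff:
  "cont_diff_on 1 S u \<longleftrightarrow>
     (\<forall>x\<in>S. u differentiable (at x)) \<and> (\<forall>i. continuous_on S (partial_deriv i u))"
  by simp

lemma cont_diff_on_Suc:
  "cont_diff_on (Suc k) S u \<longleftrightarrow>
     (\<forall>x\<in>S. u differentiable (at x)) \<and> (\<forall>i. cont_diff_on k S (partial_deriv i u))"
  by simp

lemma continuous_on_if_differentiable:
  "(\<And>x. x \<in> S \<Longrightarrow> u differentiable (at x)) \<Longrightarrow> continuous_on S u"
  by (meson continuous_at_imp_continuous_on differentiable_imp_continuous_within)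

lemma cont_diff_on_1_imp:
  assumes "cont_diff_on 1 S u"
  shows "continuous_on S u" and "x \<in> S \<Longrightarrow> u differentiable (at x)"
    and "continuous_on S (partial_deriv i u)"
  using assms continuous_on_if_differentiable[of S u] unfolding cont_diff_on_1_iff by blast+

lemma cont_diff_on_2_imp:
  assumes "cont_diff_on 2 S u"
  shows "cont_diff_on 1 S u" and "cont_diff_on 1 S (partial_deriv i u)"
  using assms continuous_on_if_differentiable[of S]
  by (auto simp: numeral_2_eq_2 cont_diff_on_1_iff)

lemma cont_diff_on_1_const: "cont_diff_on 1 S (\<lambda>x. c)"
  by (simp add: partial_deriv_def[abs_def])

lemma cont_diff_on_1_mult:
  assumes "cont_diff_on 1 S f" "cont_diff_on 1 S g"
  shows "cont_diff_on 1 S (\<lambda>x. f x * g x)"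
proof -
  note D = cont_diff_on_1_imp[OF assms(1)] cont_diff_on_1_imp[OF assms(2)]
  have "continuous_on S (partial_deriv i (\<lambda>x. f x * g x))" for i
  proof (rule continuous_on_eq)
    show "continuous_on S (\<lambda>x. partial_deriv i f x * g x + f x * partial_deriv i g x)"
      using D by (intro continuous_intros)
    show "\<And>x. x \<in> S \<Longrightarrow> partial_deriv i f x * g x + f x * partial_deriv i g x
        = partial_deriv i (\<lambda>x. f x * g x) x"
      using D by (simp add: partial_deriv_mult)
  qed
  with D show ?thesis unfolding cont_diff_on_1_iff by (auto intro: derivative_intros)
qed

lemma cont_diff_on_1_diff:
  assumes "cont_diff_on 1 S f" "cont_diff_on 1 S g"
  shows "cont_diff_on 1 S (\<lambda>x. f x - g x)"
proof -
  note D = cont_diff_on_1_imp[OF assms(1)] cont_diff_on_1_imp[OF assms(2)]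
  have "continuous_on S (partial_deriv i (\<lambda>x. f x - g x))" for i
  proof (rule continuous_on_eq)
    show "continuous_on S (\<lambda>x. partial_deriv i f x - partial_deriv i g x)"
      using D by (intro continuous_intros)
    show "\<And>x. x \<in> S \<Longrightarrow> partial_deriv i f x - partial_deriv i g x
        = partial_deriv i (\<lambda>x. f x - g x) x"
      using D by (simp add: partial_deriv_diff)
  qed
  with D show ?thesis unfolding cont_diff_on_1_iff by (auto intro: derivative_intros)
qed

lemma cont_diff_on_1_compose:
  assumes f: "cont_diff_on 1 S f"
    and W: "\<And>t. (W has_real_derivative W' t) (at t)" "continuous_on UNIV W'"
  shows "cont_diff_on 1 S (\<lambda>x. W (f x))"
proof -
  note D = cont_diff_on_1_imp[OF f]
  have "continuous_on S (partial_deriv i (\<lambda>x. W (f x)))" for i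
  proof (rule continuous_on_eq)
    show "continuous_on S (\<lambda>x. W' (f x) * partial_deriv i f x)"
      using D by (intro continuous_intros continuous_on_compose2[OF W(2)]) auto
    show "\<And>x. x \<in> S \<Longrightarrow> W' (f x) * partial_deriv i f x = partial_deriv i (\<lambda>x. W (f x)) x"
      by (simp add: partial_deriv_compose[OF D(2) W(1)])
  qed
  moreover have "(\<lambda>x. W (f x)) differentiable (at x)" if "x \<in> S" for x
    using has_derivative_real_compose[OF D(2)[OF that] W(1)] by (auto simp: differentiable_def)
  ultimately show ?thesis unfolding cont_diff_on_1_iff by auto
qed

section \<open>Compactly supported functions and integration by parts\<close>

text \<open>Vanishing outside some compact subset of \<open>S\<close>. A witnessing compact set is easier to handle than
  the closure of the set where \<open>\<psi>\<close> is nonzero.\<close>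

definition compact_support_in :: "(real^'n::finite) set \<Rightarrow> (real^'n \<Rightarrow> real) \<Rightarrow> bool" where
  "compact_support_in S \<psi> \<longleftrightarrow> (\<exists>K. compact K \<and> K \<subseteq> S \<and> (\<forall>x. x \<notin> K \<longrightarrow> \<psi> x = 0))"

text \<open>Compactly supported test functions of class \<open>C\<^sup>1\<close>, defined on the whole space.\<close>

definition C1_test_fun :: "(real^'n::finite) set \<Rightarrow> (real^'n \<Rightarrow> real) \<Rightarrow> bool" where
  "C1_test_fun S \<psi> \<longleftrightarrow> cont_diff_on 1 UNIV \<psi> \<and> compact_support_in S \<psi>"

lemma test_fun_iff: "test_fun S \<phi> \<longleftrightarrow> smooth_fun_on UNIV \<phi> \<and> compact_support_in S \<phi>"
proof -
  have "compact (closure {x. \<phi> x \<noteq> 0}) \<and> closure {x. \<phi> x \<noteq> 0} \<subseteq> S \<longleftrightarrow> compact_support_in S \<phi>"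
  proof
    assume *: "compact (closure {x. \<phi> x \<noteq> 0}) \<and> closure {x. \<phi> x \<noteq> 0} \<subseteq> S"
    have "\<phi> x = 0" if "x \<notin> closure {x. \<phi> x \<noteq> 0}" for x
      using that closure_subset[of "{x. \<phi> x \<noteq> 0}"] by auto
    with * show "compact_support_in S \<phi>" unfolding compact_support_in_def by blast
  next
    assume "compact_support_in S \<phi>"
    then obtain K where K: "compact K" "K \<subseteq> S" "\<And>x. x \<notin> K \<Longrightarrow> \<phi> x = 0"
      unfolding compact_support_in_def by blast
    have "closure {x. \<phi> x \<noteq> 0} \<subseteq> K"
      using K compact_imp_closed by (intro closure_minimal) auto
    then show "compact (closure {x. \<phi> x \<noteq> 0}) \<and> closure {x. \<phi> x \<noteq> 0} \<subseteq> S"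
      using K bounded_subset[OF compact_imp_bounded[OF K(1)]] by (auto simp: compact_eq_bounded_closed)
  qed
  then show ?thesis unfolding test_fun_def by blast
qed

lemma smooth_fun_imp_C1: "smooth_fun_on S \<phi> \<Longrightarrow> cont_diff_on 1 S \<phi>"
  unfolding smooth_fun_on_def by blast

lemma smooth_fun_partial_deriv: "smooth_fun_on S \<phi> \<Longrightarrow> smooth_fun_on S (partial_deriv i \<phi>)"
  unfolding smooth_fun_on_def by (metis cont_diff_on_Suc)

lemma smooth_fun_continuous: "smooth_fun_on S \<phi> \<Longrightarrow> continuous_on S \<phi>"
  unfolding smooth_fun_on_def by (metis cont_diff_on.simps(1))

lemma test_fun_imp_C1: "test_fun S \<phi> \<Longrightarrow> C1_test_fun S \<phi>"
  by (simp only: test_fun_iff C1_test_fun_def smooth_fun_imp_C1 simp_thms)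

lemma partial_deriv_zero_off:
  assumes "closed K" "\<And>x. x \<notin> K \<Longrightarrow> \<psi> x = 0" "x \<notin> K"
  shows "partial_deriv i \<psi> x = 0"
proof -
  have "partial_deriv i (\<lambda>x. 0) x = partial_deriv i \<psi> x"
    using assms by (intro partial_deriv_cong_open[where S = "- K"]) auto
  then show ?thesis by simp
qed

lemma compact_support_partial_deriv:
  assumes "compact_support_in S \<psi>"
  shows "compact_support_in S (partial_deriv i \<psi>)"
proof -
  obtain K where "compact K" "K \<subseteq> S" "\<And>x. x \<notin> K \<Longrightarrow> \<psi> x = 0"
    using assms unfolding compact_support_in_def by blast
  then show ?thesis
    unfolding compact_support_in_def using partial_deriv_zero_off[OF compact_imp_closed, of K \<psi>]
    by (intro exI[of _ K]) auto
qed

lemma test_fun_partial_deriv: "test_fun S \<phi> \<Longrightarrow> test_fun S (partial_deriv i \<phi>)"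
  by (simp add: test_fun_iff compact_support_partial_deriv smooth_fun_partial_deriv)

text \<open>A \<open>C\<^sup>1\<close> function on \<open>S\<close> that vanishes off a compact subset of \<open>S\<close> remains \<open>C\<^sup>1\<close> when its values
  outside \<open>S\<close> are replaced by zero.\<close>

lemma zero_extension:
  assumes S: "open S" and F: "cont_diff_on 1 S F"
    and K: "compact K" "K \<subseteq> S" "\<And>x. x \<in> S \<Longrightarrow> x \<notin> K \<Longrightarrow> F x = 0"
  defines "\<Psi> \<equiv> \<lambda>x. if x \<in> S then F x else 0"
  shows "C1_test_fun S \<Psi>" and "x \<in> S \<Longrightarrow> partial_deriv i \<Psi> x = partial_deriv i F x"
proof -
  note D = cont_diff_on_1_imp[OF F]
  have off: "\<Psi> x = 0" if "x \<notin> K" for x using that K unfolding \<Psi>_def by auto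
  have K_open: "open (- K)" using K compact_imp_closed by auto
  have un: "UNIV = S \<union> - K" using K by auto
  have pS: "partial_deriv i \<Psi> x = partial_deriv i F x" if "x \<in> S" for x i
    using D(2)[OF that] S that
    by (intro partial_deriv_cong_open[of F, symmetric]) (auto simp: \<Psi>_def)
  have "\<Psi> differentiable (at x)" for x
  proof (cases "x \<in> S")
    case True
    show ?thesis by (rule differentiable_cong_open[OF D(2)[OF True] S True]) (simp add: \<Psi>_def)
  next
    case False
    then have "x \<in> - K" using K by auto
    show ?thesis
      by (rule differentiable_cong_open[of "\<lambda>x. 0", OF _ K_open \<open>x \<in> - K\<close>]) (use off in auto)
  qed
  moreover have "continuous_on UNIV (partial_deriv i \<Psi>)" for i
  proof -
    have "continuous_on S (partial_deriv i \<Psi>)"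
      by (rule continuous_on_eq[OF D(3)]) (simp add: pS)
    moreover have "continuous_on (- K) (partial_deriv i \<Psi>)"
      using partial_deriv_zero_off[OF compact_imp_closed[OF K(1)] off]
      by (intro continuous_on_eq[OF continuous_on_const[of _ 0]]) auto
    ultimately show ?thesis unfolding un using S K_open by (intro continuous_on_open_Un)
  qed
  moreover have "compact_support_in S \<Psi>"
    unfolding compact_support_in_def using K(1,2) off by (intro exI[of _ K]) simp
  ultimately show "C1_test_fun S \<Psi>" unfolding C1_test_fun_def cont_diff_on_1_iff by simp
  show "x \<in> S \<Longrightarrow> partial_deriv i \<Psi> x = partial_deriv i F x" by (rule pS)
qed

lemma integrable_compact_support:
  fixes \<psi> :: "real^'n::finite \<Rightarrow> real"
  assumes "continuous_on UNIV \<psi>" "compact_support_in S \<psi>"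
  shows "integrable lborel \<psi>"
proof -
  obtain K where K: "compact K" "\<And>x. x \<notin> K \<Longrightarrow> \<psi> x = 0"
    using assms unfolding compact_support_in_def by blast
  have "integrable lborel (\<lambda>x. indicator K x *\<^sub>R \<psi> x)"
    using K continuous_on_subset[OF assms(1)] by (intro borel_integrable_compact) auto
  moreover have "(\<lambda>x. indicator K x *\<^sub>R \<psi> x) = \<psi>"
    using K by (auto simp: fun_eq_iff indicator_def)
  ultimately show ?thesis by simp
qed

lemma bounded_compact_support:
  fixes \<psi> :: "real^'n::finite \<Rightarrow> real"
  assumes "continuous_on UNIV \<psi>" "compact_support_in S \<psi>"
  obtains M where "M > 0" "\<And>x. \<bar>\<psi> x\<bar> \<le> M"
proof -
  obtain K where K: "compact K" "\<And>x. x \<notin> K \<Longrightarrow> \<psi> x = 0"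
    using assms unfolding compact_support_in_def by blast
  have "bounded (\<psi> ` K)"
    using K continuous_on_subset[OF assms(1)] by (intro compact_imp_bounded compact_continuous_image) auto
  then obtain M where M: "M > 0" "\<And>x. x \<in> K \<Longrightarrow> \<bar>\<psi> x\<bar> \<le> M"
    unfolding bounded_pos by auto
  have "\<bar>\<psi> x\<bar> \<le> M" for x using M K(2)[of x] by (cases "x \<in> K") auto
  with M show ?thesis using that by blast
qed

lemma lborel_integral_translate:
  fixes f :: "real^'n::finite \<Rightarrow> real"
  assumes "f \<in> borel_measurable borel"
  shows "(\<integral>x. f (c + x) \<partial>lborel) = integral\<^sup>L lborel f"
proof -
  have "integral\<^sup>L lborel f = integral\<^sup>L (distr lborel borel ((+) c)) f"
    by (simp add: lborel_distr_plus)
  also have "\<dots> = (\<integral>x. f (c + x) \<partial>lborel)"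
    using assms by (intro integral_distr) auto
  finally show ?thesis by simp
qed

lemma lborel_integrable_translate:
  fixes f :: "real^'n::finite \<Rightarrow> real"
  assumes "integrable lborel f"
  shows "integrable lborel (\<lambda>x. f (c + x))"
proof -
  have "integrable (distr lborel borel ((+) c)) f"
    using assms by (simp add: lborel_distr_plus)
  then show ?thesis
    by (rule integrable_distr[rotated]) auto
qed

text \<open>The difference quotients of \<open>\<psi>\<close> along an axis have integral zero because Lebesgue measure is
  invariant under translations.\<close>

lemma integral_partial_deriv_eq_0:
  fixes \<psi> :: "real^'n::finite \<Rightarrow> real"
  assumes "C1_test_fun S \<psi>"
  shows "integral\<^sup>L lborel (partial_deriv i \<psi>) = 0"
proof -
  define e where "e = (axis i 1 :: real^'n)"
  define Q where "Q n x = real (Suc n) * (\<psi> (inverse (real (Suc n)) *\<^sub>R e + x) - \<psi> x)" for n x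
  have C1: "cont_diff_on 1 UNIV \<psi>" and cs: "compact_support_in S \<psi>"
    using assms unfolding C1_test_fun_def by auto
  note D = cont_diff_on_1_imp[OF C1]
  have [measurable]: "\<psi> \<in> borel_measurable borel" "partial_deriv i \<psi> \<in> borel_measurable borel"
    using D borel_measurable_continuous_onI by blast+
  obtain M where M: "M > 0" "\<And>x. \<bar>partial_deriv i \<psi> x\<bar> \<le> M"
    using bounded_compact_support[OF D(3) compact_support_partial_deriv[OF cs]] by blast
  obtain K where K: "compact K" "\<And>x. x \<notin> K \<Longrightarrow> \<psi> x = 0"
    using cs unfolding compact_support_in_def by blast
  obtain R where R: "\<And>x. x \<in> K \<Longrightarrow> norm x \<le> R"
    using compact_imp_bounded[OF K(1)] unfolding bounded_iff by blast
  have int: "integrable lborel \<psi>" using integrable_compact_support[OF D(1) cs] .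
  have Q0: "integral\<^sup>L lborel (Q n) = 0" for n
  proof -
    have "integral\<^sup>L lborel (Q n) = real (Suc n) *
       ((\<integral>x. \<psi> (inverse (real (Suc n)) *\<^sub>R e + x) \<partial>lborel) - integral\<^sup>L lborel \<psi>)"
      unfolding Q_def using int lborel_integrable_translate[OF int]
      by (simp only: integral_mult_right_zero Bochner_Integration.integral_diff)
    then show ?thesis by (simp add: lborel_integral_translate)
  qed
  have lim: "(\<lambda>n. Q n x) \<longlonglongrightarrow> partial_deriv i \<psi> x" for x
  proof -
    have "((\<lambda>t. \<psi> (x + t *\<^sub>R axis i 1)) has_real_derivative partial_deriv i \<psi> x) (at 0)"
      using has_real_derivative_along_axis[of \<psi> x 0 i] D(2) by simp
    then have "((\<lambda>h. (\<psi> (x + h *\<^sub>R e) - \<psi> x) / h) \<longlongrightarrow> partial_deriv i \<psi> x) (at 0)"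
      by (simp add: DERIV_def e_def)
    moreover have "filterlim (\<lambda>n. inverse (real (Suc n))) (at 0) sequentially"
      unfolding filterlim_at using LIMSEQ_inverse_real_of_nat by simp
    ultimately have "(\<lambda>n. (\<psi> (x + inverse (real (Suc n)) *\<^sub>R e) - \<psi> x) / inverse (real (Suc n)))
        \<longlonglongrightarrow> partial_deriv i \<psi> x"
      by (rule filterlim_compose)
    then show ?thesis by (simp add: Q_def divide_inverse mult.commute add.commute)
  qed
  have bound: "norm (Q n x) \<le> M * indicator (cball 0 (R + 1)) x" for n x
  proof (cases "x \<in> cball 0 (R + 1)")
    case True
    let ?t = "inverse (real (Suc n))"
    have t: "?t > 0" by simp
    obtain z where "\<psi> (x + ?t *\<^sub>R axis i 1) - \<psi> (x + 0 *\<^sub>R axis i 1)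
        = (?t - 0) * partial_deriv i \<psi> (x + z *\<^sub>R axis i 1)"
      using MVT2[OF t, of "\<lambda>t. \<psi> (x + t *\<^sub>R axis i 1)"
          "\<lambda>t. partial_deriv i \<psi> (x + t *\<^sub>R axis i 1)"] has_real_derivative_along_axis D(2) by blast
    then have "Q n x = partial_deriv i \<psi> (x + z *\<^sub>R axis i 1)"
      by (simp add: Q_def e_def add.commute del: of_nat_Suc)
    then show ?thesis using True M by simp
  next
    case False
    have "norm (inverse (real (Suc n)) *\<^sub>R e) \<le> 1"
      by (simp add: e_def divide_simps)
    then have "norm (inverse (real (Suc n)) *\<^sub>R e + x) > R" "norm x > R"
      using False norm_triangle_ineq4[of "inverse (real (Suc n)) *\<^sub>R e + x" "inverse (real (Suc n)) *\<^sub>R e"]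
      by (auto simp del: norm_scaleR)
    then have "inverse (real (Suc n)) *\<^sub>R e + x \<notin> K" "x \<notin> K" using R by fastforce+
    then show ?thesis using K False by (simp add: Q_def)
  qed
  have "(\<lambda>n. integral\<^sup>L lborel (Q n)) \<longlonglongrightarrow> integral\<^sup>L lborel (partial_deriv i \<psi>)"
  proof (rule integral_dominated_convergence)
    show "integrable lborel (\<lambda>x :: real^'n. M * indicator (cball 0 (R + 1)) x)"
      by (intro integrable_mult_right integrable_real_indicator) (use emeasure_lborel_cball_finite[of "0 :: real^'n" "R + 1"] in auto)
    show "Q n \<in> borel_measurable lborel" for n unfolding Q_def by measurable
  qed (use lim bound in \<open>auto simp del: of_nat_Suc\<close>)
  then show ?thesis using Q0 by (simp add: LIMSEQ_const_iff)
qed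

section \<open>Smooth bump functions\<close>

text \<open>The derivatives of \<open>exp (- 1 / t)\<close>, extended by zero to \<open>t \<le> 0\<close>, are linear combinations of
  the functions \<open>flat k\<close>.\<close>

definition flat :: "nat \<Rightarrow> real \<Rightarrow> real" where
  "flat k t = (if t > 0 then exp (- 1 / t) / t ^ k else 0)"

lemma flat_over_id_tendsto_0: "((\<lambda>t. flat k t / t) \<longlongrightarrow> 0) (at 0)"
proof -
  have "((\<lambda>t. inverse t ^ Suc k / exp (inverse t)) \<longlongrightarrow> (0::real)) (at_right 0)"
    by (rule filterlim_compose[OF tendsto_power_div_exp_0 filterlim_inverse_at_top_right])
  moreover have "\<forall>\<^sub>F t in at_right 0. inverse t ^ Suc k / exp (inverse t) = flat k t / t"
    unfolding eventually_at_right_field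
    by (intro exI[of _ 1]) (simp add: flat_def exp_minus field_simps)
  ultimately have "((\<lambda>t. flat k t / t) \<longlongrightarrow> 0) (at_right 0)"
    by (rule Lim_transform_eventually)
  moreover have "((\<lambda>t. flat k t / t) \<longlongrightarrow> 0) (at_left 0)"
    by (rule tendsto_eventually) (auto simp: eventually_at_left_field flat_def intro!: exI[of _ "-1"])
  ultimately show ?thesis by (simp add: filterlim_split_at)
qed

lemma flat_has_derivative:
  "(flat k has_real_derivative flat (k + 2) t - real k * flat (k + 1) t) (at t)"
proof (cases t "0 :: real" rule: linorder_cases)
  case less
  have "((\<lambda>t. 0) has_real_derivative 0) (at t)" by simp
  then have "(flat k has_real_derivative 0) (at t)"
    by (rule has_field_derivative_transform_within_open[where S = "{..<0}"]) (use less in \<open>auto simp: flat_def\<close>)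
  then show ?thesis using less by (simp add: flat_def)
next
  case equal
  have "((\<lambda>h. (flat k (0 + h) - flat k 0) / h) \<longlongrightarrow> 0) (at 0)"
    using flat_over_id_tendsto_0[of k] by (simp add: flat_def[of k 0])
  then show ?thesis using equal by (simp add: DERIV_def flat_def[of _ 0])
next
  case greater
  have "((\<lambda>t. exp (- 1 / t) / t ^ k) has_real_derivative
     ((exp (- 1 / t) * (1 / t\<^sup>2)) * t ^ k - exp (- 1 / t) * (real k * t ^ (k - 1))) / (t ^ k * t ^ k)) (at t)"
    by (rule derivative_eq_intros refl)+ (use greater in \<open>auto simp: power2_eq_square\<close>)
  moreover have "((exp (- 1 / t) * (1 / t\<^sup>2)) * t ^ k - exp (- 1 / t) * (real k * t ^ (k - 1))) / (t ^ k * t ^ k)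
      = exp (- 1 / t) / t ^ (k + 2) - real k * (exp (- 1 / t) / t ^ (k + 1))"
    using greater by (cases k) (simp_all add: field_simps power2_eq_square)
  ultimately have "((\<lambda>t. exp (- 1 / t) / t ^ k) has_real_derivative
      flat (k + 2) t - real k * flat (k + 1) t) (at t)"
    using greater by (simp add: flat_def)
  then show ?thesis
    by (rule has_field_derivative_transform_within_open[where S = "{0<..}"])
       (use greater in \<open>auto simp: flat_def\<close>)
qed

text \<open>The algebra generated by the coordinates and the functions \<open>flat k (r\<^sup>2 - \<bar>x\<bar>\<^sup>2)\<close> is closed
  under partial derivatives, so all of its elements are smooth.\<close>

inductive bump_algebra :: "real \<Rightarrow> (real^'n::finite \<Rightarrow> real) \<Rightarrow> bool" for r :: real where
  const: "bump_algebra r (\<lambda>x. c)"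
| coord: "bump_algebra r (\<lambda>x. x $ i)"
| flat: "bump_algebra r (\<lambda>x. flat k (r\<^sup>2 - x \<bullet> x))"
| add: "bump_algebra r f \<Longrightarrow> bump_algebra r g \<Longrightarrow> bump_algebra r (\<lambda>x. f x + g x)"
| mult: "bump_algebra r f \<Longrightarrow> bump_algebra r g \<Longrightarrow> bump_algebra r (\<lambda>x. f x * g x)"

lemma bump_algebra_partial_deriv:
  fixes f :: "real^'n::finite \<Rightarrow> real"
  assumes "bump_algebra r f"
  shows "(\<forall>x. f differentiable (at x)) \<and> (\<forall>i. bump_algebra r (partial_deriv i f))"
  using assms
proof induction
  case (const c)
  have "partial_deriv i (\<lambda>x. c) = (\<lambda>x. 0)" for i by (simp add: fun_eq_iff)
  then show ?case by (simp add: bump_algebra.const)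
next
  case (coord j)
  have D: "((\<lambda>x. x $ j) has_derivative (\<lambda>v. v $ j)) (at x)" for x :: "real^'n"
    by (rule bounded_linear_imp_has_derivative) (rule bounded_linear_vec_nth)
  have "partial_deriv i (\<lambda>x. x $ j) = (\<lambda>x. axis i 1 $ j)" for i :: 'n
    using partial_deriv_eqI[OF D] by (simp add: fun_eq_iff)
  moreover have "(\<lambda>x. x $ j) differentiable (at x)" for x :: "real^'n"
    using D unfolding differentiable_def by blast
  ultimately show ?case by (simp add: bump_algebra.const)
next
  case (flat k)
  have D: "((\<lambda>x. r\<^sup>2 - x \<bullet> x) has_derivative (\<lambda>v. - (x \<bullet> v + v \<bullet> x))) (at x)" for x :: "real^'n"
    by (auto intro!: derivative_eq_intros)
  have diff: "(\<lambda>x. r\<^sup>2 - x \<bullet> x) differentiable (at x)" for x :: "real^'n"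
    using D unfolding differentiable_def by blast
  have P: "partial_deriv i (\<lambda>x. r\<^sup>2 - x \<bullet> x) x = - 2 * x $ i" for i and x :: "real^'n"
    using partial_deriv_eqI[OF D] by (simp add: inner_axis inner_axis')
  have "partial_deriv i (\<lambda>x :: real^'n. flat k (r\<^sup>2 - x \<bullet> x)) =
      (\<lambda>x. (flat (k + 2) (r\<^sup>2 - x \<bullet> x) + (- real k) * flat (k + 1) (r\<^sup>2 - x \<bullet> x)) * (- 2 * x $ i))" for i
    using partial_deriv_compose[OF diff flat_has_derivative, of i k] P by (simp add: fun_eq_iff)
  moreover have "bump_algebra r (\<lambda>x :: real^'n. (flat (k + 2) (r\<^sup>2 - x \<bullet> x) +
      (- real k) * flat (k + 1) (r\<^sup>2 - x \<bullet> x)) * (- 2 * x $ i))" for i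
    by (intro bump_algebra.intros)
  moreover have "(\<lambda>x. flat k (r\<^sup>2 - x \<bullet> x)) differentiable (at x)" for x :: "real^'n"
    using has_derivative_real_compose[OF diff flat_has_derivative] by (rule differentiableI)
  ultimately show ?case by simp
next
  case (add f g)
  then have "partial_deriv i (\<lambda>x. f x + g x) = (\<lambda>x. partial_deriv i f x + partial_deriv i g x)" for i
    by (simp add: fun_eq_iff partial_deriv_add)
  with add show ?case by (simp add: bump_algebra.add)
next
  case (mult f g)
  then have "partial_deriv i (\<lambda>x. f x * g x) =
      (\<lambda>x. partial_deriv i f x * g x + f x * partial_deriv i g x)" for i
    by (simp add: fun_eq_iff partial_deriv_mult)
  with mult show ?case by (simp add: bump_algebra.add bump_algebra.mult)
qed

lemma smooth_fun_on_if_closed_class: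
  assumes A: "\<And>f. f \<in> A \<Longrightarrow> (\<forall>x. f differentiable (at x)) \<and> (\<forall>i. partial_deriv i f \<in> A)"
    and "f \<in> A"
  shows "smooth_fun_on UNIV f"
proof -
  have "cont_diff_on k UNIV f" if "f \<in> A" for k f
    using that
  proof (induction k arbitrary: f)
    case 0
    then show ?case using A continuous_on_if_differentiable[of UNIV f] by simp
  next
    case (Suc k)
    then show ?case using A by simp
  qed
  with assms(2) show ?thesis unfolding smooth_fun_on_def by blast
qed

lemma bump_algebra_smooth: "bump_algebra r f \<Longrightarrow> smooth_fun_on UNIV f"
  using bump_algebra_partial_deriv
  by (intro smooth_fun_on_if_closed_class[where A = "{f. bump_algebra r f}"]) auto

lemma mollifier_exists:
  assumes r: "r > 0"
  obtains \<rho> :: "real^'n::finite \<Rightarrow> real" where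
    "smooth_fun_on UNIV \<rho>" "\<And>x. \<rho> x \<ge> 0" "\<And>x. norm x \<ge> r \<Longrightarrow> \<rho> x = 0"
    "\<And>x. \<rho> (- x) = \<rho> x" "integrable lborel \<rho>" "integral\<^sup>L lborel \<rho> = 1"
proof -
  define b where "b x = flat 0 (r\<^sup>2 - x \<bullet> x)" for x :: "real^'n"
  have b: "bump_algebra r b" unfolding b_def[abs_def] by (rule bump_algebra.flat)
  have cont: "continuous_on UNIV b" using smooth_fun_continuous[OF bump_algebra_smooth[OF b]] .
  have nonneg: "b x \<ge> 0" for x by (simp add: b_def flat_def)
  have off: "b x = 0" if "norm x \<ge> r" for x
  proof -
    have "r\<^sup>2 \<le> x \<bullet> x" using that r power_mono[of r "norm x" 2] by (simp add: power2_norm_eq_inner)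
    then show ?thesis by (simp add: b_def flat_def)
  qed
  have sym: "b (- x) = b x" for x by (simp add: b_def)
  have "compact_support_in UNIV b"
    unfolding compact_support_in_def using off by (intro exI[of _ "cball 0 r"]) auto
  then have int: "integrable lborel b" by (rule integrable_compact_support[OF cont])
  define c where "c = integral\<^sup>L lborel b"
  have "c \<noteq> 0"
  proof
    assume "c = 0"
    then have "AE x in lborel. b x = 0"
      using integral_nonneg_eq_0_iff_AE[OF int] nonneg by (simp add: c_def)
    then have "AE x in lebesgue. x \<in> {x. b x = 0}"
      by (auto intro: AE_completion)
    moreover have "closed {x. b x = 0}"
      using cont by (intro closed_Collect_eq) auto
    ultimately have "(0::real^'n) \<in> {x. b x = 0}" by (rule mem_closed_if_AE_lebesgue[rotated])
    then show False using r by (simp add: b_def flat_def)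
  qed
  moreover have "c \<ge> 0" unfolding c_def using nonneg by simp
  ultimately have c: "c > 0" by simp
  show ?thesis
  proof (rule that[of "\<lambda>x. inverse c * b x"])
    show "smooth_fun_on UNIV (\<lambda>x. inverse c * b x)"
      by (rule bump_algebra_smooth[where r = r]) (intro bump_algebra.mult bump_algebra.const b)
  qed (use c nonneg off int sym in \<open>auto simp: c_def\<close>)
qed

section \<open>Mollification\<close>

text \<open>The convolution \<open>\<psi> * \<rho>\<close>. It is used for continuous \<open>\<psi>\<close> with compact support and continuous \<open>\<rho>\<close>,
  where the integral exists at every point.\<close>

definition conv :: "(real^'n::finite \<Rightarrow> real) \<Rightarrow> (real^'n \<Rightarrow> real) \<Rightarrow> real^'n \<Rightarrow> real" where
  "conv \<psi> \<rho> x = (\<integral>y. \<psi> y * \<rho> (x - y) \<partial>lborel)"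

lemma compact_support_in_mult:
  "compact_support_in S \<psi> \<Longrightarrow> compact_support_in S (\<lambda>x. \<psi> x * g x)"
  unfolding compact_support_in_def by (metis mult_zero_left)

lemma continuous_on_reflect:
  fixes \<rho> :: "real^'n::finite \<Rightarrow> real"
  assumes "continuous_on UNIV \<rho>"
  shows "continuous_on A (\<lambda>y. \<rho> (x - y))"
  by (intro continuous_on_compose2[OF assms] continuous_intros) auto

lemma conv_integrable:
  assumes "continuous_on UNIV \<psi>" "compact_support_in S \<psi>" "continuous_on UNIV \<rho>"
  shows "integrable lborel (\<lambda>y. \<psi> y * \<rho> (x - y))"
  by (rule integrable_compact_support[OF continuous_on_mult[OF assms(1) continuous_on_reflect[OF assms(3)]]
        compact_support_in_mult[OF assms(2)]])

lemma lborel_integral_eq_cbox: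
  fixes g :: "real^'n::finite \<Rightarrow> real"
  assumes "integrable lborel g" "\<And>x. x \<notin> cbox a b \<Longrightarrow> g x = 0"
  shows "integral\<^sup>L lborel g = integral (cbox a b) g"
proof -
  have "integral\<^sup>L lborel g = integral UNIV g"
    using assms(1) by (simp add: integral_lborel)
  also have "\<dots> = integral UNIV (\<lambda>x. if x \<in> cbox a b then g x else 0)"
    using assms(2) by (intro arg_cong[where f = "integral UNIV"]) auto
  also have "\<dots> = integral (cbox a b) g"
    by (rule integral_restrict_UNIV)
  finally show ?thesis .
qed

text \<open>Differentiation under the integral sign, over a box that contains the support of \<open>\<psi>\<close>.\<close>

lemma conv_partial_deriv:
  fixes \<psi> \<rho> :: "real^'n::finite \<Rightarrow> real"
  assumes \<psi>: "continuous_on UNIV \<psi>" "compact_support_in S \<psi>" and \<rho>: "cont_diff_on 1 UNIV \<rho>"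
  shows "conv \<psi> \<rho> differentiable (at x)" and "partial_deriv i (conv \<psi> \<rho>) = conv \<psi> (partial_deriv i \<rho>)"
proof -
  note D = cont_diff_on_1_imp[OF \<rho>]
  obtain K where K: "compact K" "\<And>x. x \<notin> K \<Longrightarrow> \<psi> x = 0"
    using \<psi> unfolding compact_support_in_def by blast
  obtain a where a: "K \<subseteq> cbox (- a) a"
    using bounded_subset_cbox_symmetric[OF compact_imp_bounded[OF K(1)]] by blast
  have conv_eq: "conv \<psi> g x = integral (cbox (- a) a) (\<lambda>y. \<psi> y * g (x - y))"
    if "continuous_on UNIV g" for g x
    unfolding conv_def using conv_integrable[OF \<psi> that] K(2) a
    by (intro lborel_integral_eq_cbox) auto
  define F' where "F' x y = (\<Sum>j\<in>UNIV. (\<psi> y * partial_deriv j \<rho> (x - y)) *\<^sub>R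
      blinfun_inner_right (axis j (1::real)))" for x y :: "real^'n"
  have F'_apply: "blinfun_apply (F' x y) v = \<psi> y * (\<Sum>j\<in>UNIV. v $ j * partial_deriv j \<rho> (x - y))"
    for x y and v :: "real^'n"
    unfolding F'_def
    by (simp add: blinfun.sum_left blinfun.scaleR_left blinfun_inner_right.rep_eq inner_axis'
        sum_distrib_left mult_ac)
  have cont_F': "continuous_on X (\<lambda>(x, y). F' x y)" for X
    unfolding F'_def split_beta
    by (intro continuous_intros continuous_on_compose2[OF \<psi>(1)] continuous_on_compose2[OF D(3)]) auto
  have der: "((\<lambda>x. integral (cbox (- a) a) (\<lambda>y. \<psi> y * \<rho> (x - y))) has_derivative
      blinfun_apply (integral (cbox (- a) a) (F' x))) (at x)" for x
  proof (rule leibniz_rule[where U = UNIV])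
    fix x y :: "real^'n"
    have "((\<lambda>x. \<rho> (x - y)) has_derivative (\<lambda>v. \<Sum>j\<in>UNIV. v $ j * partial_deriv j \<rho> (x - y))) (at x)"
    proof (rule has_derivative_compose[of "\<lambda>x. x - y" "\<lambda>v. v" _ _ \<rho>])
      show "((\<lambda>x. x - y) has_derivative (\<lambda>v. v)) (at x)" by (auto intro!: derivative_eq_intros)
    qed (rule has_derivative_partial_deriv[OF D(2)[OF UNIV_I]])
    then show "((\<lambda>x. \<psi> y * \<rho> (x - y)) has_derivative blinfun_apply (F' x y)) (at x)"
      unfolding F'_apply[abs_def] by (rule has_derivative_mult_right)
  next
    fix x :: "real^'n"
    show "(\<lambda>y. \<psi> y * \<rho> (x - y)) integrable_on cbox (- a) a"
      using continuous_on_subset[OF \<psi>(1)] continuous_on_reflect[OF D(1)]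
      by (intro integrable_continuous continuous_on_mult) auto
  qed (use cont_F' in auto)
  have conv_fun: "conv \<psi> \<rho> = (\<lambda>x. integral (cbox (- a) a) (\<lambda>y. \<psi> y * \<rho> (x - y)))"
    using conv_eq[OF D(1)] by (simp add: fun_eq_iff)
  show "conv \<psi> \<rho> differentiable (at x)"
    unfolding conv_fun using der by (rule differentiableI)
  show "partial_deriv i (conv \<psi> \<rho>) = conv \<psi> (partial_deriv i \<rho>)"
  proof
    fix x
    have "F' x integrable_on cbox (- a) a"
      unfolding F'_def
      by (intro integrable_continuous continuous_intros continuous_on_compose2[OF \<psi>(1)]
          continuous_on_compose2[OF D(3)]) auto
    then have "partial_deriv i (conv \<psi> \<rho>) x
        = integral (cbox (- a) a) (\<lambda>y. blinfun_apply (F' x y) (axis i 1))"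
      unfolding conv_fun partial_deriv_eqI[OF der] by (rule blinfun_apply_integral)
    also have "\<dots> = conv \<psi> (partial_deriv i \<rho>) x"
      unfolding conv_eq[OF D(3)] F'_apply by (simp add: axis_def if_distrib[of "\<lambda>c. c * _"] cong: if_cong)
    finally show "partial_deriv i (conv \<psi> \<rho>) x = conv \<psi> (partial_deriv i \<rho>) x" .
  qed
qed

lemma conv_smooth:
  assumes \<psi>: "continuous_on UNIV \<psi>" "compact_support_in S \<psi>" and \<rho>: "smooth_fun_on UNIV \<rho>"
  shows "smooth_fun_on UNIV (conv \<psi> \<rho>)"
proof (rule smooth_fun_on_if_closed_class)
  show "conv \<psi> \<rho> \<in> {conv \<psi> \<rho> |\<rho>. smooth_fun_on UNIV \<rho>}" using \<rho> by blast
next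
  fix f assume "f \<in> {conv \<psi> \<rho> |\<rho>. smooth_fun_on UNIV \<rho>}"
  then obtain \<rho> where f: "f = conv \<psi> \<rho>" "smooth_fun_on UNIV \<rho>" by blast
  have "partial_deriv i f \<in> {conv \<psi> \<rho> |\<rho>. smooth_fun_on UNIV \<rho>}" for i
    using conv_partial_deriv(2)[OF \<psi> smooth_fun_imp_C1[OF f(2)], of i]
      smooth_fun_partial_deriv[OF f(2), of i] f(1) by auto
  then show "(\<forall>x. f differentiable (at x)) \<and> (\<forall>i. partial_deriv i f \<in> {conv \<psi> \<rho> |\<rho>. smooth_fun_on UNIV \<rho>})"
    using conv_partial_deriv(1)[OF \<psi> smooth_fun_imp_C1[OF f(2)]] f(1) by blast
qed

lemma partial_deriv_reflect:
  assumes "\<rho> differentiable (at (x - y))"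
  shows "(\<lambda>y. \<rho> (x - y)) differentiable (at y)"
    and "partial_deriv i (\<lambda>y. \<rho> (x - y)) y = - partial_deriv i \<rho> (x - y)"
proof -
  have "((\<lambda>y. \<rho> (x - y)) has_derivative (\<lambda>v. \<Sum>j\<in>UNIV. (- v) $ j * partial_deriv j \<rho> (x - y))) (at y)"
  proof (rule has_derivative_compose[of "\<lambda>y. x - y" "\<lambda>v. - v" _ _ \<rho>])
    show "((\<lambda>y. x - y) has_derivative (\<lambda>v. - v)) (at y)" by (auto intro!: derivative_eq_intros)
  qed (rule has_derivative_partial_deriv[OF assms])
  note D = this
  from D show "(\<lambda>y. \<rho> (x - y)) differentiable (at y)" by (rule differentiableI)
  show "partial_deriv i (\<lambda>y. \<rho> (x - y)) y = - partial_deriv i \<rho> (x - y)"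
    unfolding partial_deriv_eqI[OF D]
    by (simp add: axis_def if_distrib[of "\<lambda>c. c * _"] if_distrib[of uminus] sum_negf cong: if_cong)
qed

text \<open>A derivative of a convolution may be moved from one factor to the other.\<close>

lemma conv_partial_deriv_swap:
  assumes \<psi>: "C1_test_fun S \<psi>" and \<rho>: "cont_diff_on 1 UNIV \<rho>"
  shows "conv \<psi> (partial_deriv i \<rho>) = conv (partial_deriv i \<psi>) \<rho>"
proof
  fix x
  have C1: "cont_diff_on 1 UNIV \<psi>" and cs: "compact_support_in S \<psi>"
    using \<psi> unfolding C1_test_fun_def by auto
  note D\<psi> = cont_diff_on_1_imp[OF C1] and D\<rho> = cont_diff_on_1_imp[OF \<rho>]
  let ?r = "\<lambda>y. \<rho> (x - y)"
  note R = partial_deriv_reflect[OF D\<rho>(2)[OF UNIV_I]]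
  have "continuous_on UNIV (partial_deriv j ?r)" for j
    unfolding R(2)[abs_def] using continuous_on_reflect[OF D\<rho>(3)] by (rule continuous_on_minus)
  then have "cont_diff_on 1 UNIV ?r"
    unfolding cont_diff_on_1_iff using R(1) by simp
  then have "C1_test_fun S (\<lambda>y. \<psi> y * ?r y)"
    unfolding C1_test_fun_def
    using cont_diff_on_1_mult[OF C1] compact_support_in_mult[OF cs] by simp
  from integral_partial_deriv_eq_0[OF this]
  have "0 = (\<integral>y. partial_deriv i (\<lambda>y. \<psi> y * ?r y) y \<partial>lborel)"
    by simp
  also have "\<dots> = (\<integral>y. partial_deriv i \<psi> y * \<rho> (x - y) - \<psi> y * partial_deriv i \<rho> (x - y) \<partial>lborel)"
    using D\<psi>(2) R by (simp add: partial_deriv_mult)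
  also have "\<dots> = conv (partial_deriv i \<psi>) \<rho> x - conv \<psi> (partial_deriv i \<rho>) x"
    unfolding conv_def using D\<psi> D\<rho> cs
    by (intro Bochner_Integration.integral_diff conv_integrable[of _ S] compact_support_partial_deriv)
  finally show "conv \<psi> (partial_deriv i \<rho>) x = conv (partial_deriv i \<psi>) \<rho> x" by simp
qed

text \<open>For a mollifier \<open>\<rho>\<close> supported in the ball of radius \<open>r\<close>, the value of \<open>\<psi> * \<rho>\<close> at \<open>x\<close> is a weighted
  average of values of \<open>\<psi>\<close> at distance less than \<open>r\<close> from \<open>x\<close>. With \<open>c = \<psi> x\<close> this gives convergence,
  with \<open>c = 0\<close> a uniform bound.\<close>

lemma conv_near:
  fixes \<psi> \<rho> :: "real^'n::finite \<Rightarrow> real"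
  assumes \<psi>: "continuous_on UNIV \<psi>" "compact_support_in S \<psi>"
    and \<rho>: "smooth_fun_on UNIV \<rho>" "\<And>x. \<rho> x \<ge> 0" "\<And>x. norm x \<ge> r \<Longrightarrow> \<rho> x = 0"
    "\<And>x. \<rho> (- x) = \<rho> x" "integrable lborel \<rho>" "integral\<^sup>L lborel \<rho> = 1"
    and near: "\<And>y. dist y x < r \<Longrightarrow> \<bar>\<psi> y - c\<bar> \<le> e"
  shows "\<bar>conv \<psi> \<rho> x - c\<bar> \<le> e"
proof -
  note cont = smooth_fun_continuous[OF \<rho>(1)]
  have r_eq: "(\<lambda>y. \<rho> (x - y)) = (\<lambda>y. \<rho> (- x + y))"
    using \<rho>(4) by (metis add.commute minus_diff_eq uminus_add_conv_diff)
  have int: "integrable lborel (\<lambda>y. \<rho> (x - y))"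
    unfolding r_eq by (rule lborel_integrable_translate[OF \<rho>(5)])
  have one: "(\<integral>y. \<rho> (x - y) \<partial>lborel) = 1"
    unfolding r_eq using \<rho>(6) cont
    by (subst lborel_integral_translate) (auto intro: borel_measurable_continuous_onI)
  note ci = conv_integrable[OF \<psi> cont]
  have "conv \<psi> \<rho> x - c = (\<integral>y. \<psi> y * \<rho> (x - y) \<partial>lborel) - (\<integral>y. c * \<rho> (x - y) \<partial>lborel)"
    using one by (simp add: conv_def)
  also have "\<dots> = (\<integral>y. \<psi> y * \<rho> (x - y) - c * \<rho> (x - y) \<partial>lborel)"
    using int ci by simp
  finally have "\<bar>conv \<psi> \<rho> x - c\<bar> \<le> (\<integral>y. \<bar>\<psi> y * \<rho> (x - y) - c * \<rho> (x - y)\<bar> \<partial>lborel)"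
    using integral_abs_bound by metis
  also have "\<dots> \<le> (\<integral>y. e * \<rho> (x - y) \<partial>lborel)"
  proof (rule integral_mono)
    fix y
    show "\<bar>\<psi> y * \<rho> (x - y) - c * \<rho> (x - y)\<bar> \<le> e * \<rho> (x - y)"
    proof (cases "dist y x < r")
      case True
      have "\<bar>\<psi> y * \<rho> (x - y) - c * \<rho> (x - y)\<bar> = \<bar>\<psi> y - c\<bar> * \<rho> (x - y)"
        using \<rho>(2) by (simp add: abs_mult flip: left_diff_distrib)
      then show ?thesis using near[OF True] \<rho>(2) by (simp add: mult_right_mono)
    next
      case False
      then have "\<rho> (x - y) = 0" using \<rho>(3) by (simp add: dist_norm norm_minus_commute)
      then show ?thesis by simp
    qed
  qed (use int ci in auto)
  also have "\<dots> = e" using one by simp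
  finally show ?thesis .
qed

text \<open>A compactly supported continuous function is a bounded pointwise limit of test functions
  with supports in a common compact set. For a \<open>C\<^sup>1\<close> function the partial derivatives converge in
  the same way.\<close>

lemma test_fun_approximation:
  fixes \<psi> :: "real^'n::finite \<Rightarrow> real"
  assumes S: "open S" and \<psi>: "continuous_on UNIV \<psi>" "compact_support_in S \<psi>"
  obtains \<phi> K M where "compact K" "K \<subseteq> S" "\<And>n. test_fun S (\<phi> n)"
    "\<And>n x. x \<notin> K \<Longrightarrow> \<phi> n x = 0" "\<And>x. x \<notin> K \<Longrightarrow> \<psi> x = 0"
    "\<And>n x. \<bar>\<phi> n x\<bar> \<le> M" "\<And>x. \<bar>\<psi> x\<bar> \<le> M" "\<And>x. (\<lambda>n. \<phi> n x) \<longlonglongrightarrow> \<psi> x"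
    "cont_diff_on 1 UNIV \<psi> \<Longrightarrow> \<forall>i. (\<forall>n x. \<bar>partial_deriv i (\<phi> n) x\<bar> \<le> M) \<and>
       (\<forall>x. \<bar>partial_deriv i \<psi> x\<bar> \<le> M) \<and>
       (\<forall>x. (\<lambda>n. partial_deriv i (\<phi> n) x) \<longlonglongrightarrow> partial_deriv i \<psi> x)"
proof -
  obtain K0 where K0: "compact K0" "K0 \<subseteq> S" "\<And>x. x \<notin> K0 \<Longrightarrow> \<psi> x = 0"
    using \<psi> unfolding compact_support_in_def by blast
  have "closed (- S)" "K0 \<inter> - S = {}" using S K0(2) by auto
  from separate_compact_closed[OF K0(1) this]
  obtain d where d: "d > 0" "\<And>x y. x \<in> K0 \<Longrightarrow> y \<in> - S \<Longrightarrow> d \<le> dist x y"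
    by blast
  define r where "r n = d / 2 / real (Suc n)" for n
  have r: "r n > 0" "r n \<le> d / 2" for n
    using d(1) by (auto simp: r_def divide_simps)
  have r0: "r \<longlonglongrightarrow> 0"
    unfolding r_def using LIMSEQ_Suc[OF lim_const_over_n[of "d / 2"]] by simp
  define K where "K = {x + y |x y. x \<in> K0 \<and> y \<in> cball 0 (d / 2)}"
  have K: "compact K" unfolding K_def using K0 by (intro compact_sums) auto
  have KS: "K \<subseteq> S"
  proof
    fix z assume "z \<in> K"
    then obtain x y where z: "z = x + y" "x \<in> K0" "norm y \<le> d / 2" unfolding K_def by auto
    then have "dist x z < d" using d(1) by (simp add: dist_norm)
    then show "z \<in> S" using d(2)[of x z] z by force
  qed
  have K0K: "x \<in> K" if "x \<in> K0" for x
  proof -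
    have "x = x + 0" "(0 :: real^'n) \<in> cball 0 (d / 2)" using d(1) by auto
    then show ?thesis unfolding K_def using that by blast
  qed
  have "\<exists>\<rho> :: real^'n \<Rightarrow> real. smooth_fun_on UNIV \<rho> \<and> (\<forall>x. \<rho> x \<ge> 0) \<and>
      (\<forall>x. norm x \<ge> r n \<longrightarrow> \<rho> x = 0) \<and> (\<forall>x. \<rho> (- x) = \<rho> x) \<and>
      integrable lborel \<rho> \<and> integral\<^sup>L lborel \<rho> = 1" for n
    by (rule mollifier_exists[OF r(1)[of n]]) blast
  then obtain \<rho> :: "nat \<Rightarrow> real^'n \<Rightarrow> real" where \<rho>: "\<And>n. smooth_fun_on UNIV (\<rho> n)"
    "\<And>n x. \<rho> n x \<ge> 0" "\<And>n x. norm x \<ge> r n \<Longrightarrow> \<rho> n x = 0" "\<And>n x. \<rho> n (- x) = \<rho> n x"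
    "\<And>n. integrable lborel (\<rho> n)" "\<And>n. integral\<^sup>L lborel (\<rho> n) = 1"
    by metis
  define \<phi> where "\<phi> n = conv \<psi> (\<rho> n)" for n
  have near: "\<bar>conv \<eta> (\<rho> n) x - c\<bar> \<le> e"
    if "continuous_on UNIV \<eta>" "compact_support_in S \<eta>" "\<And>y. dist y x < r n \<Longrightarrow> \<bar>\<eta> y - c\<bar> \<le> e"
    for \<eta> n x c e
    using that \<rho>[of n] by (intro conv_near[where r = "r n"]) auto
  have bound: "\<bar>conv \<eta> (\<rho> n) x\<bar> \<le> M"
    if "continuous_on UNIV \<eta>" "compact_support_in S \<eta>" "\<And>y. \<bar>\<eta> y\<bar> \<le> M" for \<eta> n x M
    using near[OF that(1,2), of x n 0 M] that(3) by simp
  have lim: "(\<lambda>n. conv \<eta> (\<rho> n) x) \<longlonglongrightarrow> \<eta> x"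
    if \<eta>: "continuous_on UNIV \<eta>" "compact_support_in S \<eta>" for \<eta> x
  proof (rule LIMSEQ_I)
    fix e :: real assume e: "e > 0"
    have "isCont \<eta> x" using \<eta>(1) continuous_on_eq_continuous_at open_UNIV by blast
    then obtain s where s: "s > 0" "\<And>y. dist y x < s \<Longrightarrow> dist (\<eta> y) (\<eta> x) < e / 2"
      using e unfolding continuous_at_eps_delta by (metis half_gt_zero)
    from r0 s(1) obtain N where N: "\<And>n. n \<ge> N \<Longrightarrow> \<bar>r n\<bar> < s"
      unfolding LIMSEQ_iff by auto
    have "norm (conv \<eta> (\<rho> n) x - \<eta> x) < e" if "n \<ge> N" for n
    proof -
      have "\<bar>\<eta> y - \<eta> x\<bar> \<le> e / 2" if "dist y x < r n" for y
      proof -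
        have "dist y x < s" using N[OF \<open>n \<ge> N\<close>] that by linarith
        from s(2)[OF this] show ?thesis by (simp add: dist_real_def)
      qed
      then have "\<bar>conv \<eta> (\<rho> n) x - \<eta> x\<bar> \<le> e / 2" by (rule near[OF \<eta>])
      then show ?thesis using e by simp
    qed
    then show "\<exists>N. \<forall>n\<ge>N. norm (conv \<eta> (\<rho> n) x - \<eta> x) < e" by blast
  qed
  have off: "\<phi> n x = 0" if "x \<notin> K" for n x
  proof -
    have "\<psi> y * \<rho> n (x - y) = 0" for y
    proof (cases "y \<in> K0")
      case True
      have "norm (x - y) > d / 2"
      proof (rule ccontr)
        assume "\<not> norm (x - y) > d / 2"
        then have "x = y + (x - y)" "x - y \<in> cball 0 (d / 2)" by auto
        then have "x \<in> K" unfolding K_def using True by blast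
        with that show False by simp
      qed
      then show ?thesis using \<rho>(3)[of n "x - y"] r(2)[of n] by simp
    qed (use K0 in simp)
    then show ?thesis unfolding \<phi>_def conv_def by (simp only: Bochner_Integration.integral_zero)
  qed
  have \<psi>_off: "\<psi> x = 0" if "x \<notin> K" for x using that K0(3) K0K by blast
  have test: "test_fun S (\<phi> n)" for n
    unfolding test_fun_iff compact_support_in_def
    using K KS off conv_smooth[OF \<psi> \<rho>(1)[of n]] by (auto simp: \<phi>_def)
  obtain M0 where M0: "\<And>x. \<bar>\<psi> x\<bar> \<le> M0" using bounded_compact_support[OF \<psi>] by blast
  show ?thesis
  proof (cases "cont_diff_on 1 UNIV \<psi>")
    case False
    show ?thesis
      by (rule that[of K \<phi> M0])
        (use False K KS test off \<psi>_off M0 bound[OF \<psi> M0] lim[OF \<psi>] in \<open>auto simp: \<phi>_def simp del: One_nat_def\<close>)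
  next
    case True
    then have C1: "C1_test_fun S \<psi>" unfolding C1_test_fun_def using \<psi> by blast
    have p\<phi>: "partial_deriv i (\<phi> n) = conv (partial_deriv i \<psi>) (\<rho> n)" for i n
      unfolding \<phi>_def conv_partial_deriv(2)[OF \<psi> smooth_fun_imp_C1[OF \<rho>(1)]]
      by (rule conv_partial_deriv_swap[OF C1 smooth_fun_imp_C1[OF \<rho>(1)]])
    have p\<psi>: "continuous_on UNIV (partial_deriv i \<psi>)" "compact_support_in S (partial_deriv i \<psi>)" for i
      using cont_diff_on_1_imp(3)[OF True] compact_support_partial_deriv[OF \<psi>(2)] by auto
    have "\<forall>i. \<exists>M. \<forall>x. \<bar>partial_deriv i \<psi> x\<bar> \<le> M"
      using bounded_compact_support[OF p\<psi>] by metis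
    then obtain m where m: "\<And>i x. \<bar>partial_deriv i \<psi> x\<bar> \<le> m i" by metis
    define M where "M = max M0 (Max (range m))"
    have mM: "m i \<le> M" for i unfolding M_def by (simp add: le_max_iff_disj)
    have M: "\<bar>\<psi> x\<bar> \<le> M" "\<bar>partial_deriv i \<psi> x\<bar> \<le> M" for i x
      using M0[of x] m[of i x] mM[of i] by (auto simp: M_def)
    show ?thesis
    proof (rule that[of K \<phi> M])
      show "\<forall>i. (\<forall>n x. \<bar>partial_deriv i (\<phi> n) x\<bar> \<le> M) \<and> (\<forall>x. \<bar>partial_deriv i \<psi> x\<bar> \<le> M) \<and>
         (\<forall>x. (\<lambda>n. partial_deriv i (\<phi> n) x) \<longlonglongrightarrow> partial_deriv i \<psi> x)"
        unfolding p\<phi> using bound[OF p\<psi> M(2)] M(2) lim[OF p\<psi>] by blast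
    qed (use K KS test off \<psi>_off M(1) bound[OF \<psi> M(1)] lim[OF \<psi>] in \<open>auto simp: \<phi>_def\<close>)
  qed
qed

section \<open>Locally integrable functions\<close>

lemma
  fixes g :: "real^'n::finite \<Rightarrow> real"
  assumes "S \<in> sets lebesgue" "\<And>x. x \<notin> S \<Longrightarrow> g x = 0"
  shows integral_lebesgue_on_zero_off: "integral\<^sup>L (lebesgue_on S) g = integral\<^sup>L lebesgue g"
    and integrable_lebesgue_on_zero_off: "integrable (lebesgue_on S) g \<longleftrightarrow> integrable lebesgue g"
proof -
  have "(\<lambda>x. indicator S x *\<^sub>R g x) = g"
    using assms(2) by (auto simp: indicator_def fun_eq_iff)
  then show "integral\<^sup>L (lebesgue_on S) g = integral\<^sup>L lebesgue g"
    "integrable (lebesgue_on S) g \<longleftrightarrow> integrable lebesgue g"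
    using assms(1) by (simp_all add: integral_restrict_space integrable_restrict_space)
qed

lemma integrable_lebesgue_on_support:
  fixes g :: "real^'n::finite \<Rightarrow> real"
  assumes "S \<in> sets lebesgue" "K \<in> sets lebesgue" "K \<subseteq> S" "\<And>x. x \<in> S \<Longrightarrow> x \<notin> K \<Longrightarrow> g x = 0"
    and "integrable (lebesgue_on K) g"
  shows "integrable (lebesgue_on S) g"
proof -
  have "(\<lambda>x. indicator S x *\<^sub>R g x) = (\<lambda>x. indicator K x *\<^sub>R g x)"
    using assms(3,4) by (auto simp: indicator_def fun_eq_iff)
  then show ?thesis
    using assms(1,2,5) by (simp add: integrable_restrict_space)
qed

lemma sets_lebesgue_compact: "compact (K :: (real^'n::finite) set) \<Longrightarrow> K \<in> sets lebesgue"
  by (intro sets_completionI_sets) (simp add: borel_compact)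

lemma sets_lebesgue_open: "open (S :: (real^'n::finite) set) \<Longrightarrow> S \<in> sets lebesgue"
  by (intro sets_completionI_sets) simp

lemma integrable_mult_continuous_compact:
  fixes v f :: "real^'n::finite \<Rightarrow> real"
  assumes v: "integrable (lebesgue_on K) v" and K: "compact K" and f: "continuous_on K f"
  shows "integrable (lebesgue_on K) (\<lambda>x. v x * f x)"
proof -
  obtain M where M: "\<And>x. x \<in> K \<Longrightarrow> \<bar>f x\<bar> \<le> M"
    using compact_imp_bounded[OF compact_continuous_image[OF f K]] unfolding bounded_iff by auto
  have [measurable]: "f \<in> borel_measurable (lebesgue_on K)"
    using f K by (intro continuous_imp_measurable_on_sets_lebesgue sets_lebesgue_compact)
  have [measurable]: "v \<in> borel_measurable (lebesgue_on K)" using v by auto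
  show ?thesis
  proof (rule Bochner_Integration.integrable_bound)
    show "integrable (lebesgue_on K) (\<lambda>x. M * v x)" using v by simp
    have "norm (v x * f x) \<le> norm (M * v x)" if "x \<in> K" for x
    proof -
      have "\<bar>v x\<bar> * \<bar>f x\<bar> \<le> \<bar>v x\<bar> * \<bar>M\<bar>" using M[OF that] by (intro mult_left_mono) auto
      then show ?thesis by (simp add: abs_mult mult.commute)
    qed
    then show "AE x in lebesgue_on K. norm (v x * f x) \<le> norm (M * v x)"
      by (intro AE_I2) simp
  qed measurable
qed

lemma locally_integrable_mult_continuous:
  assumes "locally_integrable S v" "continuous_on S f"
  shows "locally_integrable S (\<lambda>x. v x * f x)"
  using assms unfolding locally_integrable_def
  by (auto intro: integrable_mult_continuous_compact continuous_on_subset)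

lemma locally_integrable_continuous:
  assumes "continuous_on S f"
  shows "locally_integrable S f"
proof -
  have "integrable lebesgue (\<lambda>x. indicator K x *\<^sub>R f x)" if "compact K" "K \<subseteq> S" for K
  proof -
    have int: "integrable lborel (\<lambda>x. indicator K x *\<^sub>R f x)"
      using that continuous_on_subset[OF assms] by (intro borel_integrable_compact) auto
    then show ?thesis using integrable_completion[of "\<lambda>x. indicator K x *\<^sub>R f x" lborel] by auto
  qed
  then show ?thesis
    unfolding locally_integrable_def by (simp add: integrable_restrict_space sets_lebesgue_compact)
qed

lemma locally_integrable_diff:
  "locally_integrable S v \<Longrightarrow> locally_integrable S w \<Longrightarrow> locally_integrable S (\<lambda>x. v x - w x)"
  unfolding locally_integrable_def by auto

lemma locally_integrable_add:
  "locally_integrable S v \<Longrightarrow> locally_integrable S w \<Longrightarrow> locally_integrable S (\<lambda>x. v x + w x)"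
  unfolding locally_integrable_def by auto

lemma locally_integrable_sum:
  "(\<And>i. i \<in> I \<Longrightarrow> locally_integrable S (v i)) \<Longrightarrow> locally_integrable S (\<lambda>x. \<Sum>i\<in>I. v i x)"
  unfolding locally_integrable_def by auto

lemma integrable_mult_compact_support:
  fixes v \<psi> :: "real^'n::finite \<Rightarrow> real"
  assumes "open S" "locally_integrable S v" "continuous_on UNIV \<psi>" "compact_support_in S \<psi>"
  shows "integrable (lebesgue_on S) (\<lambda>x. v x * \<psi> x)"
proof -
  obtain K where K: "compact K" "K \<subseteq> S" "\<And>x. x \<notin> K \<Longrightarrow> \<psi> x = 0"
    using assms unfolding compact_support_in_def by blast
  have "integrable (lebesgue_on K) v" using assms(2) K unfolding locally_integrable_def by blast
  from integrable_mult_continuous_compact[OF this K(1) continuous_on_subset[OF assms(3)]]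
  show ?thesis
    using K assms(1) by (intro integrable_lebesgue_on_support[of S K]) (auto simp: sets_lebesgue_compact sets_lebesgue_open)
qed

lemma AE_lebesgue_on_I:
  assumes "S \<in> sets lebesgue" "AE x in lebesgue. x \<in> S \<longrightarrow> P x"
  shows "AE x in lebesgue_on S. P x"
  using assms by (simp add: AE_restrict_space_iff)

lemma AE_lebesgue_on_not_negligible:
  assumes "S \<in> sets lebesgue" "negligible N"
  shows "AE x in lebesgue_on S. x \<notin> N"
proof -
  have "AE x in lebesgue. x \<notin> N"
    using assms(2) by (intro AE_not_in) (simp add: negligible_iff_null_sets)
  then show ?thesis using assms(1) by (intro AE_lebesgue_on_I) (auto elim: eventually_mono)
qed

section \<open>The fundamental lemma of the calculus of variations\<close>

lemma integral_mult_tendsto: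
  fixes v \<psi> :: "real^'n::finite \<Rightarrow> real" and \<phi> :: "nat \<Rightarrow> real^'n \<Rightarrow> real"
  assumes S: "open S" and v: "locally_integrable S v" and K: "compact K" "K \<subseteq> S"
    and \<phi>: "\<And>n. continuous_on UNIV (\<phi> n)" "\<And>n x. x \<notin> K \<Longrightarrow> \<phi> n x = 0" "\<And>n x. \<bar>\<phi> n x\<bar> \<le> M"
      "\<And>x. (\<lambda>n. \<phi> n x) \<longlonglongrightarrow> \<psi> x"
    and \<psi>: "continuous_on UNIV \<psi>" "compact_support_in S \<psi>"
  shows "(\<lambda>n. LINT x|lebesgue_on S. v x * \<phi> n x) \<longlonglongrightarrow> (LINT x|lebesgue_on S. v x * \<psi> x)"
proof (rule integral_dominated_convergence)
  have "compact_support_in S (\<phi> n)" for n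
    using K \<phi>(2) unfolding compact_support_in_def by blast
  then show "(\<lambda>x. v x * \<phi> n x) \<in> borel_measurable (lebesgue_on S)" for n
    using integrable_mult_compact_support[OF S v \<phi>(1)] by auto
  have "integrable (lebesgue_on K) v" using v K unfolding locally_integrable_def by blast
  then have "integrable (lebesgue_on K) (\<lambda>x. \<bar>v x\<bar> * M * indicator K x)"
    by (rule_tac Bochner_Integration.integrable_cong[THEN iffD1, OF refl, of _ "\<lambda>x. \<bar>v x\<bar> * M"]) auto
  then show "integrable (lebesgue_on S) (\<lambda>x. \<bar>v x\<bar> * M * indicator K x)"
    using K S by (intro integrable_lebesgue_on_support[of S K]) (auto simp: sets_lebesgue_compact sets_lebesgue_open)
  show "AE x in lebesgue_on S. norm (v x * \<phi> n x) \<le> \<bar>v x\<bar> * M * indicator K x" for n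
    using \<phi>(2,3) by (intro AE_I2) (auto simp: abs_mult indicator_def intro!: mult_left_mono)
  show "AE x in lebesgue_on S. (\<lambda>n. v x * \<phi> n x) \<longlonglongrightarrow> v x * \<psi> x"
    using \<phi>(4) by (intro AE_I2 tendsto_intros)
  show "(\<lambda>x. v x * \<psi> x) \<in> borel_measurable (lebesgue_on S)"
    using integrable_mult_compact_support[OF S v \<psi>] by auto
qed

lemma test_fun_continuous: "test_fun S \<phi> \<Longrightarrow> continuous_on UNIV \<phi>"
  by (simp add: test_fun_iff smooth_fun_continuous)

lemma integral_compact_support_eq_0:
  fixes v \<psi> :: "real^'n::finite \<Rightarrow> real"
  assumes S: "open S" and v: "locally_integrable S v"
    and test: "\<And>\<phi>. test_fun S \<phi> \<Longrightarrow> (LINT x|lebesgue_on S. v x * \<phi> x) = 0"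
    and \<psi>: "continuous_on UNIV \<psi>" "compact_support_in S \<psi>"
  shows "(LINT x|lebesgue_on S. v x * \<psi> x) = 0"
proof -
  obtain \<phi> K M where \<phi>: "compact K" "K \<subseteq> S" "\<And>n. test_fun S (\<phi> n)" "\<And>n x. x \<notin> K \<Longrightarrow> \<phi> n x = 0"
    "\<And>n x. \<bar>\<phi> n x\<bar> \<le> M" "\<And>x. (\<lambda>n. \<phi> n x) \<longlonglongrightarrow> \<psi> x"
    using test_fun_approximation[OF S \<psi>] by metis
  from integral_mult_tendsto[OF S v \<phi>(1,2) test_fun_continuous[OF \<phi>(3)] \<phi>(4-6) \<psi>]
  show ?thesis using test[OF \<phi>(3)] by (simp add: LIMSEQ_const_iff)
qed

text \<open>The sign of \<open>v\<close> is a limit almost everywhere of continuous functions, so that \<open>\<bar>v\<bar>\<close>,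
  multiplied by a cutoff, has integral zero.\<close>

lemma AE_zero_on_compact:
  fixes v :: "real^'n::finite \<Rightarrow> real"
  assumes S: "open S" and v: "locally_integrable S v"
    and test: "\<And>\<phi>. test_fun S \<phi> \<Longrightarrow> (LINT x|lebesgue_on S. v x * \<phi> x) = 0"
    and K: "compact K" "K \<subseteq> S"
  shows "AE x in lebesgue_on S. x \<in> K \<longrightarrow> v x = 0"
proof (cases "K = {}")
  case False
  obtain d where d: "d > 0" "{x. infdist x K \<le> d} \<subseteq> S"
    using compact_in_open_separated[OF False K(1) S K(2)] by blast
  define L where "L = {x. infdist x K \<le> d}"
  have L: "compact L" "L \<subseteq> S"
    unfolding L_def using compact_infdist_le[OF False K(1) d(1)] d(2) by auto
  define \<eta> where "\<eta> x = max 0 (1 - infdist x K / d)" for x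
  have \<eta>: "continuous_on UNIV \<eta>" "\<And>x. x \<in> K \<Longrightarrow> \<eta> x = 1" "\<And>x. 0 \<le> \<eta> x" "\<And>x. x \<notin> L \<Longrightarrow> \<eta> x = 0"
  proof -
    show "continuous_on UNIV \<eta>"
      unfolding \<eta>_def using d(1) by (intro continuous_intros) auto
  qed (use d(1) in \<open>auto simp: \<eta>_def L_def divide_simps max_def\<close>)
  have cs: "compact_support_in S \<eta>"
    unfolding compact_support_in_def using L \<eta>(4) by blast
  \<comment> \<open>Continuous functions \<open>g n\<close> that tend to the sign of \<open>v\<close> on \<open>L\<close>, off the negligible set \<open>N\<close>.\<close>
  have "(\<lambda>x. sgn (v x)) \<in> borel_measurable (lebesgue_on L)"
  proof -
    have "integrable (lebesgue_on L) v" using v L unfolding locally_integrable_def by blast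
    then have [measurable]: "v \<in> borel_measurable (lebesgue_on L)" by auto
    show ?thesis by measurable
  qed
  then have "(\<lambda>x. sgn (v x)) measurable_on L"
    using measurable_on_iff_borel_measurable[OF sets_lebesgue_compact[OF L(1)]] by blast
  then obtain N g where N: "negligible N" and g: "\<And>n. continuous_on UNIV (g n)"
    "\<And>x. x \<notin> N \<Longrightarrow> (\<lambda>n. g n x) \<longlonglongrightarrow> (if x \<in> L then sgn (v x) else (0::real))"
    unfolding measurable_on_def by blast
  define \<psi> where "\<psi> n x = \<eta> x * max (- 1) (min 1 (g n x))" for n :: nat and x
  have \<psi>: "continuous_on UNIV (\<psi> n)" "compact_support_in S (\<psi> n)" for n
    unfolding \<psi>_def using \<eta>(1) g(1) cs
    by (auto intro!: continuous_intros compact_support_in_mult)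
  have int: "integrable (lebesgue_on S) (\<lambda>x. \<bar>v x * \<eta> x\<bar>)"
    using integrable_mult_compact_support[OF S v \<eta>(1) cs] by simp
  have "(\<lambda>n. LINT x|lebesgue_on S. v x * \<psi> n x) \<longlonglongrightarrow> (LINT x|lebesgue_on S. \<bar>v x * \<eta> x\<bar>)"
  proof (rule integral_dominated_convergence[OF _ _ int])
    have "(\<lambda>n. v x * \<psi> n x) \<longlonglongrightarrow> \<bar>v x * \<eta> x\<bar>" if "x \<notin> N" for x
    proof (cases "x \<in> L")
      case True
      have "(\<lambda>n. v x * \<psi> n x) \<longlonglongrightarrow> v x * (\<eta> x * max (- 1) (min 1 (sgn (v x))))"
        unfolding \<psi>_def using g(2)[OF that] True by (intro tendsto_intros) auto
      also have "v x * (\<eta> x * max (- 1) (min 1 (sgn (v x)))) = \<bar>v x * \<eta> x\<bar>"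
        using \<eta>(3)[of x] by (auto simp: sgn_if abs_mult)
      finally show ?thesis .
    qed (use \<eta>(4) in \<open>simp add: \<psi>_def\<close>)
    then show "AE x in lebesgue_on S. (\<lambda>n. v x * \<psi> n x) \<longlonglongrightarrow> \<bar>v x * \<eta> x\<bar>"
      using AE_lebesgue_on_not_negligible[OF sets_lebesgue_open[OF S] N] by (auto elim: eventually_mono)
    show "AE x in lebesgue_on S. norm (v x * \<psi> n x) \<le> \<bar>v x * \<eta> x\<bar>" for n
    proof (intro AE_I2)
      fix x
      have "\<bar>max (- 1) (min 1 (g n x))\<bar> \<le> 1" by auto
      then have "\<bar>v x * \<eta> x\<bar> * \<bar>max (- 1) (min 1 (g n x))\<bar> \<le> \<bar>v x * \<eta> x\<bar> * 1"
        by (intro mult_left_mono) auto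
      then show "norm (v x * \<psi> n x) \<le> \<bar>v x * \<eta> x\<bar>" by (simp add: \<psi>_def abs_mult mult_ac)
    qed
    show "(\<lambda>x. v x * \<psi> n x) \<in> borel_measurable (lebesgue_on S)" for n
      using integrable_mult_compact_support[OF S v \<psi>] by auto
    show "(\<lambda>x. \<bar>v x * \<eta> x\<bar>) \<in> borel_measurable (lebesgue_on S)" using int by auto
  qed
  then have "(LINT x|lebesgue_on S. \<bar>v x * \<eta> x\<bar>) = 0"
    using integral_compact_support_eq_0[OF S v test \<psi>] by (simp add: LIMSEQ_const_iff)
  then have "AE x in lebesgue_on S. \<bar>v x * \<eta> x\<bar> = 0"
    using integral_nonneg_eq_0_iff_AE[OF int] by simp
  then show ?thesis
    by (rule eventually_mono) (use \<eta>(2) in auto)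
qed simp

text \<open>\<open>S\<close> is a countable union of compact boxes.\<close>

lemma fundamental_lemma:
  fixes v :: "real^'n::finite \<Rightarrow> real"
  assumes S: "open S" and v: "locally_integrable S v"
    and test: "\<And>\<phi>. test_fun S \<phi> \<Longrightarrow> (LINT x|lebesgue_on S. v x * \<phi> x) = 0"
  shows "AE x in lebesgue_on S. v x = 0"
proof -
  obtain D where D: "countable D" "D \<subseteq> Pow S" "\<And>X. X \<in> D \<Longrightarrow> \<exists>a b. X = cbox a b" "\<Union>D = S"
    using open_countable_Union_open_cbox[OF S] by metis
  have "AE x in lebesgue_on S. x \<in> X \<longrightarrow> v x = 0" if "X \<in> D" for X
    using AE_zero_on_compact[OF S v test, of X] D(2,3) that compact_cbox by blast
  then have "AE x in lebesgue_on S. \<forall>X\<in>D. x \<in> X \<longrightarrow> v x = 0"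
    by (subst AE_ball_countable[OF D(1)]) blast
  then show ?thesis
    unfolding AE_restrict_space_iff[of S lebesgue, simplified, OF sets_lebesgue_open[OF S]]
    using D(4) by (auto elim: eventually_mono)
qed

lemma has_weak_derivD:
  assumes "has_weak_deriv S \<beta> u v"
  shows "locally_integrable S u" "locally_integrable S v"
    and "test_fun S \<phi> \<Longrightarrow> (LINT x|lebesgue_on S. u x * mi_deriv \<beta> \<phi> x) =
        (-1) ^ mi_order \<beta> * (LINT x|lebesgue_on S. v x * \<phi> x)"
  using assms unfolding has_weak_deriv_def by simp_all

lemma has_weak_divergenceD:
  assumes "has_weak_divergence S F g"
  shows "locally_integrable S (\<lambda>x. F x $ i)" "locally_integrable S g"
    and "test_fun S \<phi> \<Longrightarrow> (LINT x|lebesgue_on S. (\<Sum>i\<in>UNIV. F x $ i * partial_deriv i \<phi> x)) =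
        - (LINT x|lebesgue_on S. g x * \<phi> x)"
  using assms unfolding has_weak_divergence_def by simp_all

lemma has_weak_deriv_unique:
  assumes S: "open S" and "has_weak_deriv S \<beta> u v" "has_weak_deriv S \<beta> u w"
  shows "AE x in lebesgue_on S. v x = w x"
proof -
  have li: "locally_integrable S v" "locally_integrable S w"
    using has_weak_derivD assms(2,3) by blast+
  have "(LINT x|lebesgue_on S. (v x - w x) * \<phi> x) = 0" if "test_fun S \<phi>" for \<phi>
  proof -
    have \<phi>: "continuous_on UNIV \<phi>" "compact_support_in S \<phi>"
      using that smooth_fun_continuous unfolding test_fun_iff by auto
    have "(- 1) ^ mi_order \<beta> * (LINT x|lebesgue_on S. v x * \<phi> x)
        = (- 1) ^ mi_order \<beta> * (LINT x|lebesgue_on S. w x * \<phi> x)"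
      using has_weak_derivD(3)[OF assms(2) that] has_weak_derivD(3)[OF assms(3) that] by simp
    then have "(LINT x|lebesgue_on S. v x * \<phi> x) = (LINT x|lebesgue_on S. w x * \<phi> x)"
      by simp
    then show ?thesis
      using integrable_mult_compact_support[OF S _ \<phi>] li by (simp add: left_diff_distrib)
  qed
  from fundamental_lemma[OF S locally_integrable_diff[OF li] this] show ?thesis by simp
qed

lemma has_weak_divergence_unique:
  assumes S: "open S" and "has_weak_divergence S F v" "has_weak_divergence S F w"
  shows "AE x in lebesgue_on S. v x = w x"
proof -
  have li: "locally_integrable S v" "locally_integrable S w"
    using has_weak_divergenceD assms(2,3) by blast+
  have "(LINT x|lebesgue_on S. (v x - w x) * \<phi> x) = 0" if "test_fun S \<phi>" for \<phi>
  proof -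
    have \<phi>: "continuous_on UNIV \<phi>" "compact_support_in S \<phi>"
      using that smooth_fun_continuous unfolding test_fun_iff by auto
    have "- (LINT x|lebesgue_on S. v x * \<phi> x) = - (LINT x|lebesgue_on S. w x * \<phi> x)"
      using has_weak_divergenceD(3)[OF assms(2) that] has_weak_divergenceD(3)[OF assms(3) that] by simp
    then show ?thesis
      using integrable_mult_compact_support[OF S _ \<phi>] li by (simp add: left_diff_distrib)
  qed
  from fundamental_lemma[OF S locally_integrable_diff[OF li] this] show ?thesis by simp
qed

section \<open>Calculus of weak divergences\<close>

lemma C1_test_funD:
  assumes "C1_test_fun S \<psi>"
  shows "continuous_on UNIV \<psi>" "compact_support_in S \<psi>" "\<psi> differentiable (at x)"
    "continuous_on UNIV (partial_deriv i \<psi>)" "compact_support_in S (partial_deriv i \<psi>)"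
  using assms cont_diff_on_1_imp[of UNIV \<psi>] compact_support_partial_deriv
  unfolding C1_test_fun_def by blast+

lemma integral_divergence_pairing:
  fixes F :: "real^'n::finite \<Rightarrow> real^'n"
  assumes "open S" "\<And>i. locally_integrable S (\<lambda>x. F x $ i)" "C1_test_fun S \<psi>"
  shows "integrable (lebesgue_on S) (\<lambda>x. \<Sum>i\<in>UNIV. F x $ i * partial_deriv i \<psi> x)"
    and "(LINT x|lebesgue_on S. (\<Sum>i\<in>UNIV. F x $ i * partial_deriv i \<psi> x)) =
      (\<Sum>i\<in>UNIV. LINT x|lebesgue_on S. F x $ i * partial_deriv i \<psi> x)"
proof -
  have "integrable (lebesgue_on S) (\<lambda>x. F x $ i * partial_deriv i \<psi> x)" for i
    using assms by (intro integrable_mult_compact_support C1_test_funD)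
  then show "integrable (lebesgue_on S) (\<lambda>x. \<Sum>i\<in>UNIV. F x $ i * partial_deriv i \<psi> x)"
    "(LINT x|lebesgue_on S. (\<Sum>i\<in>UNIV. F x $ i * partial_deriv i \<psi> x)) =
      (\<Sum>i\<in>UNIV. LINT x|lebesgue_on S. F x $ i * partial_deriv i \<psi> x)"
    by (auto intro: Bochner_Integration.integral_sum)
qed

text \<open>By approximation, the defining identity of the weak divergence holds for compactly supported
  test functions that are merely \<open>C\<^sup>1\<close>.\<close>

lemma weak_divergence_C1_test_fun:
  fixes F :: "real^'n::finite \<Rightarrow> real^'n"
  assumes S: "open S" and F: "has_weak_divergence S F g" and \<psi>: "C1_test_fun S \<psi>"
  shows "(LINT x|lebesgue_on S. (\<Sum>i\<in>UNIV. F x $ i * partial_deriv i \<psi> x)) =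
    - (LINT x|lebesgue_on S. g x * \<psi> x)"
proof -
  note W = has_weak_divergenceD[OF F] and D\<psi> = C1_test_funD[OF \<psi>]
  have C1: "cont_diff_on 1 UNIV \<psi>" using \<psi> unfolding C1_test_fun_def by simp
  obtain \<phi> K M where K: "compact K" "K \<subseteq> S" and test: "\<And>n. test_fun S (\<phi> n)"
    and \<phi>: "\<And>n x. x \<notin> K \<Longrightarrow> \<phi> n x = 0" "\<And>n x. \<bar>\<phi> n x\<bar> \<le> M" "\<And>x. (\<lambda>n. \<phi> n x) \<longlonglongrightarrow> \<psi> x"
    and p: "cont_diff_on 1 UNIV \<psi> \<Longrightarrow> \<forall>i. (\<forall>n x. \<bar>partial_deriv i (\<phi> n) x\<bar> \<le> M) \<and>
       (\<forall>x. \<bar>partial_deriv i \<psi> x\<bar> \<le> M) \<and>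
       (\<forall>x. (\<lambda>n. partial_deriv i (\<phi> n) x) \<longlonglongrightarrow> partial_deriv i \<psi> x)"
    by (rule test_fun_approximation[OF S D\<psi>(1,2)]) (rule that; assumption)
  have p\<phi>: "\<bar>partial_deriv i (\<phi> n) x\<bar> \<le> M"
    "(\<lambda>n. partial_deriv i (\<phi> n) x) \<longlonglongrightarrow> partial_deriv i \<psi> x" for i n x
    using p[OF C1] by auto
  note pair = integral_divergence_pairing(2)[OF S W(1)]
  have "(\<lambda>n. LINT x|lebesgue_on S. F x $ i * partial_deriv i (\<phi> n) x) \<longlonglongrightarrow>
      (LINT x|lebesgue_on S. F x $ i * partial_deriv i \<psi> x)" for i
    by (rule integral_mult_tendsto[OF S W(1) K test_fun_continuous[OF test_fun_partial_deriv[OF test]]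
          partial_deriv_zero_off[OF compact_imp_closed[OF K(1)] \<phi>(1)] p\<phi> D\<psi>(4,5)])
  then have "(\<lambda>n. \<Sum>i\<in>UNIV. LINT x|lebesgue_on S. F x $ i * partial_deriv i (\<phi> n) x) \<longlonglongrightarrow>
      (\<Sum>i\<in>UNIV. LINT x|lebesgue_on S. F x $ i * partial_deriv i \<psi> x)"
    by (rule tendsto_sum)
  then have "(\<lambda>n. - (LINT x|lebesgue_on S. g x * \<phi> n x)) \<longlonglongrightarrow>
      (LINT x|lebesgue_on S. (\<Sum>i\<in>UNIV. F x $ i * partial_deriv i \<psi> x))"
    using W(3)[OF test] by (simp add: pair[OF \<psi>] pair[OF test_fun_imp_C1[OF test]])
  moreover have "(\<lambda>n. - (LINT x|lebesgue_on S. g x * \<phi> n x)) \<longlonglongrightarrow> - (LINT x|lebesgue_on S. g x * \<psi> x)"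
    by (intro tendsto_minus integral_mult_tendsto[OF S W(2) K test_fun_continuous[OF test] \<phi> D\<psi>(1,2)])
  ultimately show ?thesis by (rule LIMSEQ_unique)
qed

lemma has_weak_divergence_diff:
  fixes F G :: "real^'n::finite \<Rightarrow> real^'n"
  assumes S: "open S" and F: "has_weak_divergence S F f" and G: "has_weak_divergence S G g"
  shows "has_weak_divergence S (\<lambda>x. F x - G x) (\<lambda>x. f x - g x)"
  unfolding has_weak_divergence_def
proof (intro conjI allI impI)
  note WF = has_weak_divergenceD[OF F] and WG = has_weak_divergenceD[OF G]
  show "locally_integrable S (\<lambda>x. (F x - G x) $ i)" for i
    using locally_integrable_diff[OF WF(1) WG(1)] by simp
  show "locally_integrable S (\<lambda>x. f x - g x)" using locally_integrable_diff[OF WF(2) WG(2)] .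
  fix \<phi> assume \<phi>: "test_fun S \<phi>"
  note C = C1_test_funD[OF test_fun_imp_C1[OF \<phi>]]
  show "(LINT x|lebesgue_on S. (\<Sum>i\<in>UNIV. (F x - G x) $ i * partial_deriv i \<phi> x)) =
      - (LINT x|lebesgue_on S. (f x - g x) * \<phi> x)"
    using WF(3)[OF \<phi>] WG(3)[OF \<phi>] integral_divergence_pairing(1)[OF S WF(1) test_fun_imp_C1[OF \<phi>]]
      integral_divergence_pairing(1)[OF S WG(1) test_fun_imp_C1[OF \<phi>]]
      integrable_mult_compact_support[OF S WF(2) C(1,2)]
      integrable_mult_compact_support[OF S WG(2) C(1,2)]
    by (simp add: left_diff_distrib sum_subtractf)
qed

lemma has_weak_divergence_cong_AE:
  fixes F F' :: "real^'n::finite \<Rightarrow> real^'n"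
  assumes S: "open S" and F: "has_weak_divergence S F f"
    and F': "\<And>i. locally_integrable S (\<lambda>x. F' x $ i)" and eq: "AE x in lebesgue_on S. F x = F' x"
  shows "has_weak_divergence S F' f"
  unfolding has_weak_divergence_def
proof (intro conjI allI impI)
  note WF = has_weak_divergenceD[OF F]
  fix \<phi> assume \<phi>: "test_fun S \<phi>"
  note I = integral_divergence_pairing(1)[OF S _ test_fun_imp_C1[OF \<phi>]]
  have "(LINT x|lebesgue_on S. (\<Sum>i\<in>UNIV. F' x $ i * partial_deriv i \<phi> x)) =
      (LINT x|lebesgue_on S. (\<Sum>i\<in>UNIV. F x $ i * partial_deriv i \<phi> x))"
    using I[OF F'] I[OF WF(1)] eq by (intro integral_cong_AE) (auto elim: eventually_mono)
  then show "(LINT x|lebesgue_on S. (\<Sum>i\<in>UNIV. F' x $ i * partial_deriv i \<phi> x)) =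
      - (LINT x|lebesgue_on S. f x * \<phi> x)" using WF(3)[OF \<phi>] by simp
qed (use F' has_weak_divergenceD(2)[OF F] in auto)

lemma C1_mult_test_fun:
  fixes f \<phi> :: "real^'n::finite \<Rightarrow> real"
  assumes S: "open S" and f: "cont_diff_on 1 S f" and \<phi>: "test_fun S \<phi>"
  obtains \<psi> where "C1_test_fun S \<psi>" "\<And>x. x \<in> S \<Longrightarrow> \<psi> x = f x * \<phi> x"
    "\<And>i x. x \<in> S \<Longrightarrow> partial_deriv i \<psi> x = partial_deriv i f x * \<phi> x + f x * partial_deriv i \<phi> x"
proof -
  obtain K where K: "compact K" "K \<subseteq> S" "\<And>x. x \<notin> K \<Longrightarrow> \<phi> x = 0"
    using \<phi> unfolding test_fun_iff compact_support_in_def by blast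
  have \<phi>1: "cont_diff_on 1 S \<phi>"
    using test_fun_imp_C1[OF \<phi>] continuous_on_subset[of UNIV _ S]
    unfolding C1_test_fun_def cont_diff_on_1_iff by auto
  note Z = zero_extension[OF S cont_diff_on_1_mult[OF f \<phi>1] K(1,2)]
  show ?thesis
  proof (rule that)
    show "C1_test_fun S (\<lambda>x. if x \<in> S then f x * \<phi> x else 0)" using Z(1) K(3) by simp
    show "partial_deriv i (\<lambda>x. if x \<in> S then f x * \<phi> x else 0) x
        = partial_deriv i f x * \<phi> x + f x * partial_deriv i \<phi> x" if "x \<in> S" for i x
      using Z(2)[of x i] K(3) that
        partial_deriv_mult[OF cont_diff_on_1_imp(2)[OF f that] cont_diff_on_1_imp(2)[OF \<phi>1 that]]
      by simp
  qed simp
qed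

lemma integral_C1_test_fun_partial_deriv:
  assumes "open S" "C1_test_fun S \<psi>"
  shows "(LINT x|lebesgue_on S. partial_deriv i \<psi> x) = 0"
proof -
  note C = C1_test_funD[OF assms(2)]
  have "partial_deriv i \<psi> x = 0" if "x \<notin> S" for x
    using C(5)[of i] that unfolding compact_support_in_def by blast
  then have "(LINT x|lebesgue_on S. partial_deriv i \<psi> x) = integral\<^sup>L lebesgue (partial_deriv i \<psi>)"
    using assms(1) by (intro integral_lebesgue_on_zero_off sets_lebesgue_open)
  also have "\<dots> = integral\<^sup>L lborel (partial_deriv i \<psi>)"
    using borel_measurable_continuous_onI[OF C(4)] by (intro integral_completion) simp
  finally show ?thesis using integral_partial_deriv_eq_0[OF assms(2)] by simp
qed

text \<open>For a \<open>C\<^sup>1\<close> vector field the pointwise divergence is the weak divergence.\<close>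

lemma classical_divergence:
  fixes F :: "'n::finite \<Rightarrow> real^'n \<Rightarrow> real"
  assumes S: "open S" and F: "\<And>i. cont_diff_on 1 S (F i)"
  shows "has_weak_divergence S (\<lambda>x. \<chi> i. F i x) (\<lambda>x. \<Sum>i\<in>UNIV. partial_deriv i (F i) x)"
  unfolding has_weak_divergence_def
proof (intro conjI allI impI)
  note D = cont_diff_on_1_imp[OF F]
  have li: "locally_integrable S (F i)" "locally_integrable S (partial_deriv i (F i))" for i
    using D locally_integrable_continuous by blast+
  then show "locally_integrable S (\<lambda>x. (\<chi> i. F i x) $ i)" for i by simp
  show "locally_integrable S (\<lambda>x. \<Sum>i\<in>UNIV. partial_deriv i (F i) x)"
    using li by (intro locally_integrable_sum)
  fix \<phi> assume \<phi>: "test_fun S \<phi>"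
  note C = C1_test_funD[OF test_fun_imp_C1[OF \<phi>]]
  have I: "integrable (lebesgue_on S) (\<lambda>x. F i x * partial_deriv i \<phi> x)"
    "integrable (lebesgue_on S) (\<lambda>x. partial_deriv i (F i) x * \<phi> x)" for i
    using integrable_mult_compact_support[OF S li(1) C(4,5)]
      integrable_mult_compact_support[OF S li(2) C(1,2)] by auto
  have "(LINT x|lebesgue_on S. F i x * partial_deriv i \<phi> x) =
      - (LINT x|lebesgue_on S. partial_deriv i (F i) x * \<phi> x)" for i
  proof -
    obtain \<psi> where \<psi>: "C1_test_fun S \<psi>"
      "\<And>x. x \<in> S \<Longrightarrow> partial_deriv i \<psi> x = partial_deriv i (F i) x * \<phi> x + F i x * partial_deriv i \<phi> x"
      using C1_mult_test_fun[OF S F \<phi>] by metis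
    have "0 = (LINT x|lebesgue_on S. partial_deriv i \<psi> x)"
      using integral_C1_test_fun_partial_deriv[OF S \<psi>(1)] by simp
    also have "\<dots> = (LINT x|lebesgue_on S. partial_deriv i (F i) x * \<phi> x + F i x * partial_deriv i \<phi> x)"
      using \<psi>(2) by (intro Bochner_Integration.integral_cong) auto
    finally show ?thesis using I by simp
  qed
  then show "(LINT x|lebesgue_on S. (\<Sum>i\<in>UNIV. (\<chi> i. F i x) $ i * partial_deriv i \<phi> x)) =
      - (LINT x|lebesgue_on S. (\<Sum>i\<in>UNIV. partial_deriv i (F i) x) * \<phi> x)"
    using I by (simp add: sum_distrib_right sum_negf)
qed

lemma has_weak_deriv_axis_iff:
  "has_weak_deriv S (mi_unit i) u v \<longleftrightarrow> locally_integrable S u \<and> locally_integrable S v \<and>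
     (\<forall>\<phi>. test_fun S \<phi> \<longrightarrow>
        (LINT x|lebesgue_on S. u x * partial_deriv i \<phi> x) = - (LINT x|lebesgue_on S. v x * \<phi> x))"
  unfolding has_weak_deriv_def mi_unit_eq mi_deriv_axis by simp

lemma sum_axis_mult: "(\<Sum>j\<in>UNIV. (c *\<^sub>R axis i (1::real)) $ j * d j) = c * d i"
  for i :: "'n::finite"
  by (simp add: axis_def if_distrib[of "\<lambda>t. t * _"] if_distrib[of "\<lambda>t. _ * t"] cong: if_cong)

lemma has_weak_deriv_imp_divergence:
  fixes i :: "'n::finite"
  assumes "has_weak_deriv S (mi_unit i) u v"
  shows "has_weak_divergence S (\<lambda>x. u x *\<^sub>R axis i 1) v"
proof -
  have "locally_integrable S (\<lambda>x. (u x *\<^sub>R axis i 1) $ j)" for j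
    using assms locally_integrable_mult_continuous[of S u "\<lambda>x. (axis i 1 :: real^'n) $ j"]
    by (simp add: has_weak_deriv_axis_iff)
  then show ?thesis
    using assms unfolding has_weak_divergence_def has_weak_deriv_axis_iff by (simp only: sum_axis_mult simp_thms) blast
qed

lemma has_weak_divergence_imp_deriv:
  fixes i :: "'n::finite"
  assumes "has_weak_divergence S (\<lambda>x. u x *\<^sub>R axis i 1) v"
  shows "has_weak_deriv S (mi_unit i) u v"
proof -
  have "locally_integrable S u"
    using has_weak_divergenceD(1)[OF assms, of i] by simp
  then show ?thesis
    using assms unfolding has_weak_divergence_def has_weak_deriv_axis_iff by (simp only: sum_axis_mult simp_thms) blast
qed

lemma classical_weak_deriv:
  assumes S: "open S" and u: "cont_diff_on 1 S u"
  shows "has_weak_deriv S (mi_unit i) u (partial_deriv i u)"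
proof (rule has_weak_divergence_imp_deriv)
  have F: "cont_diff_on 1 S (if j = i then u else (\<lambda>x. 0))" for j
    using u cont_diff_on_1_const by auto
  have "(\<chi> j. (if j = i then u else (\<lambda>x. 0)) x) = u x *\<^sub>R axis i 1" for x
    by (simp add: vec_eq_iff axis_def)
  moreover have "(\<Sum>j\<in>UNIV. partial_deriv j (if j = i then u else (\<lambda>x. 0)) x) = partial_deriv i u x" for x
    by (simp add: if_distrib[of "\<lambda>f. partial_deriv _ f x"] cong: if_cong)
  ultimately show "has_weak_divergence S (\<lambda>x. u x *\<^sub>R axis i 1) (partial_deriv i u)"
    using classical_divergence[OF S, of "\<lambda>j. if j = i then u else (\<lambda>x. 0)", OF F] by simp
qed

lemma has_weak_deriv_diff:
  assumes S: "open S" and u: "has_weak_deriv S \<beta> u v" and w: "has_weak_deriv S \<beta> w z"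
    and test: "\<And>\<phi>. test_fun S \<phi> \<Longrightarrow> test_fun S (mi_deriv \<beta> \<phi>)"
  shows "has_weak_deriv S \<beta> (\<lambda>x. u x - w x) (\<lambda>x. v x - z x)"
  unfolding has_weak_deriv_def
proof (intro conjI allI impI)
  note U = has_weak_derivD[OF u] and W = has_weak_derivD[OF w]
  fix \<phi> assume \<phi>: "test_fun S \<phi>"
  note C = C1_test_funD[OF test_fun_imp_C1[OF \<phi>]] and C' = C1_test_funD[OF test_fun_imp_C1[OF test[OF \<phi>]]]
  show "(LINT x|lebesgue_on S. (u x - w x) * mi_deriv \<beta> \<phi> x) =
      (- 1) ^ mi_order \<beta> * (LINT x|lebesgue_on S. (v x - z x) * \<phi> x)"
    using U(3)[OF \<phi>] W(3)[OF \<phi>] integrable_mult_compact_support[OF S U(2) C(1,2)]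
      integrable_mult_compact_support[OF S W(2) C(1,2)]
      integrable_mult_compact_support[OF S U(1) C'(1,2)]
      integrable_mult_compact_support[OF S W(1) C'(1,2)]
    by (simp add: left_diff_distrib right_diff_distrib)
qed (intro locally_integrable_diff has_weak_derivD(1)[OF u] has_weak_derivD(1)[OF w]
    has_weak_derivD(2)[OF u] has_weak_derivD(2)[OF w])+

lemma test_fun_mi_deriv_axis: "test_fun S \<phi> \<Longrightarrow> test_fun S (mi_deriv (mi_axis n i) \<phi>)"
  unfolding mi_deriv_axis by (induction n) (auto intro: test_fun_partial_deriv)

text \<open>The pure second weak derivative is the weak derivative of the first one, by testing with
  \<open>\<partial>\<^sub>i \<phi>\<close>.\<close>

lemma has_weak_deriv_second:
  assumes v: "has_weak_deriv S (mi_axis 1 i) u v" and z: "has_weak_deriv S (mi_axis 2 i) u z"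
  shows "has_weak_deriv S (mi_unit i) v z"
  unfolding has_weak_deriv_axis_iff
proof (intro conjI allI impI)
  fix \<phi> assume \<phi>: "test_fun S \<phi>"
  show "(LINT x|lebesgue_on S. v x * partial_deriv i \<phi> x) = - (LINT x|lebesgue_on S. z x * \<phi> x)"
    using has_weak_derivD(3)[OF v test_fun_partial_deriv[OF \<phi>]] has_weak_derivD(3)[OF z \<phi>]
    by (simp add: mi_deriv_axis numeral_2_eq_2)
qed (use has_weak_derivD[OF v] has_weak_derivD[OF z] in auto)

text \<open>The product rule, by testing with \<open>f \<phi>\<close>.\<close>

lemma weak_divergence_product:
  fixes v z :: "'n::finite \<Rightarrow> real^'n \<Rightarrow> real"
  assumes S: "open S" and f: "cont_diff_on 1 S f"
    and v: "\<And>i. has_weak_deriv S (mi_unit i) (v i) (z i)"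
  shows "has_weak_divergence S (\<lambda>x. f x *\<^sub>R (\<chi> i. v i x))
     (\<lambda>x. \<Sum>i\<in>UNIV. partial_deriv i f x * v i x + f x * z i x)"
  unfolding has_weak_divergence_def
proof (intro conjI allI impI)
  note Df = cont_diff_on_1_imp[OF f] and W = has_weak_derivD[OF v]
  have li: "locally_integrable S (\<lambda>x. f x * v i x)" "locally_integrable S (\<lambda>x. partial_deriv i f x * v i x)"
    "locally_integrable S (\<lambda>x. f x * z i x)" for i
    using locally_integrable_mult_continuous[OF W(1) Df(1)]
      locally_integrable_mult_continuous[OF W(1) Df(3)]
      locally_integrable_mult_continuous[OF W(2) Df(1)] by (simp_all add: mult.commute)
  show "locally_integrable S (\<lambda>x. (f x *\<^sub>R (\<chi> i. v i x)) $ i)" for i using li(1) by simp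
  show "locally_integrable S (\<lambda>x. \<Sum>i\<in>UNIV. partial_deriv i f x * v i x + f x * z i x)"
    using li(2,3) by (intro locally_integrable_sum locally_integrable_add)
  fix \<phi> assume \<phi>: "test_fun S \<phi>"
  note C = C1_test_funD[OF test_fun_imp_C1[OF \<phi>]]
  have I: "integrable (lebesgue_on S) (\<lambda>x. f x * v i x * partial_deriv i \<phi> x)"
    "integrable (lebesgue_on S) (\<lambda>x. partial_deriv i f x * v i x * \<phi> x)"
    "integrable (lebesgue_on S) (\<lambda>x. f x * z i x * \<phi> x)" for i
    using integrable_mult_compact_support[OF S li(1) C(4,5)]
      integrable_mult_compact_support[OF S li(2) C(1,2)]
      integrable_mult_compact_support[OF S li(3) C(1,2)] by auto
  obtain \<psi> where \<psi>: "C1_test_fun S \<psi>" "\<And>x. x \<in> S \<Longrightarrow> \<psi> x = f x * \<phi> x"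
    "\<And>i x. x \<in> S \<Longrightarrow> partial_deriv i \<psi> x = partial_deriv i f x * \<phi> x + f x * partial_deriv i \<phi> x"
    using C1_mult_test_fun[OF S f \<phi>] by metis
  have "(LINT x|lebesgue_on S. f x * v i x * partial_deriv i \<phi> x) =
      - (LINT x|lebesgue_on S. (partial_deriv i f x * v i x + f x * z i x) * \<phi> x)" for i
  proof -
    have "(LINT x|lebesgue_on S. v i x * partial_deriv i \<psi> x) = - (LINT x|lebesgue_on S. z i x * \<psi> x)"
      using weak_divergence_C1_test_fun[OF S has_weak_deriv_imp_divergence[OF v] \<psi>(1)]
      by (simp only: sum_axis_mult)
    moreover have "(LINT x|lebesgue_on S. v i x * partial_deriv i \<psi> x) =
        (LINT x|lebesgue_on S. partial_deriv i f x * v i x * \<phi> x + f x * v i x * partial_deriv i \<phi> x)"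
      using \<psi>(3) by (intro Bochner_Integration.integral_cong) (auto simp: algebra_simps)
    moreover have "(LINT x|lebesgue_on S. z i x * \<psi> x) = (LINT x|lebesgue_on S. f x * z i x * \<phi> x)"
      using \<psi>(2) by (intro Bochner_Integration.integral_cong) auto
    ultimately show ?thesis using I by (simp add: distrib_right)
  qed
  then show "(LINT x|lebesgue_on S. (\<Sum>i\<in>UNIV. (f x *\<^sub>R (\<chi> i. v i x)) $ i * partial_deriv i \<phi> x)) =
      - (LINT x|lebesgue_on S. (\<Sum>i\<in>UNIV. partial_deriv i f x * v i x + f x * z i x) * \<phi> x)"
    using I by (simp add: sum_distrib_right sum_negf distrib_right sum.distrib sum_subtractf)
qed

section \<open>The maximum principle\<close>

text \<open>The first and second derivative tests along a coordinate axis.\<close>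

lemma interior_max_partial_derivs:
  fixes u :: "real^'n::finite \<Rightarrow> real"
  assumes S: "open S" and u: "cont_diff_on 2 S u" and x: "x \<in> S"
    and max: "\<And>y. y \<in> S \<Longrightarrow> u y \<le> u x"
  shows "partial_deriv i u x = 0" and "partial_deriv i (partial_deriv i u) x \<le> 0"
proof -
  define e where "e = (axis i 1 :: real^'n)"
  define q p where "q t = u (x + t *\<^sub>R e)" and "p t = partial_deriv i u (x + t *\<^sub>R e)" for t
  have C1: "cont_diff_on 1 S u" "cont_diff_on 1 S (partial_deriv i u)"
    using cont_diff_on_2_imp[OF u] by auto
  obtain d where d: "d > 0" "ball x d \<subseteq> S" using S x openE by blast
  have inS: "x + t *\<^sub>R e \<in> S" if "\<bar>t\<bar> < d" for t
    using that d(2) by (intro subsetD[OF d(2)]) (simp add: dist_norm e_def)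
  have q: "(q has_real_derivative p t) (at t)" if "\<bar>t\<bar> < d" for t
    unfolding q_def[abs_def] p_def e_def
    using has_real_derivative_along_axis cont_diff_on_1_imp(2)[OF C1(1) inS[OF that]] e_def by metis
  have p: "(p has_real_derivative partial_deriv i (partial_deriv i u) x) (at 0)"
    using has_real_derivative_along_axis[of "partial_deriv i u" x 0 i] cont_diff_on_1_imp(2)[OF C1(2) x]
    by (simp add: p_def[abs_def] e_def)
  have q_max: "q t \<le> q 0" if "\<bar>t\<bar> < d" for t
    using max[OF inS[OF that]] by (simp add: q_def)
  have p0: "p 0 = 0"
  proof (rule DERIV_local_max[of q _ 0 d])
    show "(q has_real_derivative p 0) (at 0)" using q[of 0] d(1) by simp
  qed (use d(1) q_max in auto)
  then show "partial_deriv i u x = 0" by (simp add: p_def)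
  show "partial_deriv i (partial_deriv i u) x \<le> 0"
  proof (rule ccontr)
    assume "\<not> partial_deriv i (partial_deriv i u) x \<le> 0"
    then obtain s where s: "s > 0" "\<And>t. 0 < t \<Longrightarrow> t < s \<Longrightarrow> p 0 < p t"
      using DERIV_pos_inc_right[OF p] by auto
    define t where "t = min s d / 2"
    have t: "0 < t" "t < s" "t < d" using s(1) d(1) by (auto simp: t_def)
    obtain z where z: "0 < z" "z < t" "q t - q 0 = (t - 0) * p z"
      using MVT2[OF t(1), of q p] q t by auto
    have "p z > 0" using s(2)[of z] z t p0 by auto
    then have "q t > q 0" using z(3) t(1) by (simp add: algebra_simps)
    with q_max[of t] t show False by simp
  qed
qed

text \<open>At an interior maximum of \<open>u\<close> the first-order terms vanish and the second-order terms are
  nonpositive, which contradicts \<open>\<nabla> \<cdot> (f \<nabla>u) > 0\<close>.\<close>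

lemma maximum_principle:
  fixes u f :: "real^'n::finite \<Rightarrow> real"
  assumes S: "open S" "bounded S" and u: "cont_diff_on 2 S u"
    and cont: "continuous_on (closure S) u" and bd: "\<And>x. x \<in> frontier S \<Longrightarrow> u x = 0"
    and f: "\<And>x. x \<in> S \<Longrightarrow> f x \<ge> 0"
    and pos: "\<And>x. x \<in> S \<Longrightarrow>
      0 < (\<Sum>i\<in>UNIV. partial_deriv i f x * partial_deriv i u x + f x * partial_deriv i (partial_deriv i u) x)"
    and x: "x \<in> S"
  shows "u x < 0"
proof (rule ccontr)
  assume "\<not> u x < 0"
  have "compact (closure S)" "closure S \<noteq> {}" using S(2) x compact_closure by auto
  from continuous_attains_sup[OF this cont]
  obtain m where m: "m \<in> closure S" "\<And>y. y \<in> closure S \<Longrightarrow> u y \<le> u m" by blast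
  have "\<exists>m\<in>S. \<forall>y\<in>S. u y \<le> u m"
  proof (cases "m \<in> S")
    case True
    then show ?thesis using m(2) closure_subset by blast
  next
    case False
    then have "m \<in> frontier S" using m(1) S(1) by (simp add: frontier_def interior_open)
    then have "u y \<le> 0" if "y \<in> S" for y using bd m(2) that closure_subset by fastforce
    then show ?thesis using \<open>\<not> u x < 0\<close> x by force
  qed
  then obtain z where z: "z \<in> S" "\<And>y. y \<in> S \<Longrightarrow> u y \<le> u z" by blast
  note Z = interior_max_partial_derivs[OF S(1) u z]
  have "(\<Sum>i\<in>UNIV. partial_deriv i f z * partial_deriv i u z + f z * partial_deriv i (partial_deriv i u) z) \<le> 0"
    using Z f[OF z(1)] by (intro sum_nonpos) (simp add: mult_nonneg_nonpos)
  with pos[OF z(1)] show False by simp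
qed

section \<open>The weighted energy estimate\<close>

lemma integrable_continuous_support:
  fixes g :: "real^'n::finite \<Rightarrow> real"
  assumes "open S" "continuous_on S g" "compact K" "K \<subseteq> S" "\<And>x. x \<in> S \<Longrightarrow> x \<notin> K \<Longrightarrow> g x = 0"
  shows "integrable (lebesgue_on S) g"
  using assms locally_integrable_continuous[OF assms(2)] unfolding locally_integrable_def
  by (intro integrable_lebesgue_on_support[of S K] sets_lebesgue_open sets_lebesgue_compact) auto

text \<open>The compact set is the sublevel set \<open>u \<le> - \<epsilon>\<close> in the closure of \<open>S\<close>; it avoids the boundary,
  where \<open>u = 0\<close>.\<close>

lemma sublevel_set_compact:
  fixes u :: "real^'n::finite \<Rightarrow> real"
  assumes S: "open S" "bounded S"
    and cont: "continuous_on (closure S) u" and bd: "\<And>x. x \<in> frontier S \<Longrightarrow> u x = 0"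
    and \<epsilon>: "\<epsilon> > 0" "\<And>t. t \<ge> - \<epsilon> \<Longrightarrow> W t = (0::real)"
  shows "\<exists>K. compact K \<and> K \<subseteq> S \<and> (\<forall>x\<in>S. x \<notin> K \<longrightarrow> W (u x) = 0)"
proof -
  define K where "K = {x \<in> closure S. u x \<in> {..- \<epsilon>}}"
  have "closed K" unfolding K_def using cont
    by (intro continuous_closed_preimage[unfolded vimage_def Int_def, simplified]) auto
  moreover have "bounded K" unfolding K_def using bounded_closure[OF S(2)] by (rule bounded_subset) auto
  ultimately have K: "compact K" by (simp add: compact_eq_bounded_closed)
  have KS: "K \<subseteq> S"
  proof
    fix x assume x: "x \<in> K"
    then have "x \<notin> frontier S" using bd \<epsilon>(1) by (force simp: K_def)
    with x S(1) show "x \<in> S" by (simp add: K_def frontier_def interior_open)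
  qed
  have off: "W (u x) = 0" if "x \<in> S" "x \<notin> K" for x
    using that closure_subset[of S] by (intro \<epsilon>(2)) (auto simp: K_def)
  with K KS show ?thesis by blast
qed

text \<open>If \<open>W\<close> vanishes on \<open>[- \<epsilon>, \<infinity>)\<close>, then \<open>h\<^sup>2 W(u) \<nabla>u\<close> has compact support in \<open>S\<close>, because \<open>u\<close> is
  continuous up to the boundary and zero there. The integrand below is its divergence, so it
  integrates to zero.\<close>

lemma weighted_divergence_integral:
  fixes u h :: "real^'n::finite \<Rightarrow> real"
  assumes S: "open S" "bounded S" and u: "cont_diff_on 2 S u" and h: "cont_diff_on 1 S h"
    and cont: "continuous_on (closure S) u" and bd: "\<And>x. x \<in> frontier S \<Longrightarrow> u x = 0"
    and W: "\<And>t. (W has_real_derivative W' t) (at t)" "continuous_on UNIV W'"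
    and \<epsilon>: "\<epsilon> > 0" "\<And>t. t \<ge> - \<epsilon> \<Longrightarrow> W t = 0"
  defines "G \<equiv> \<lambda>x. \<Sum>i\<in>UNIV. partial_deriv i (\<lambda>x. h x * partial_deriv i u x) x"
    and "\<Delta> \<equiv> \<lambda>x. \<Sum>i\<in>UNIV. partial_deriv i (partial_deriv i u) x"
    and "N \<equiv> \<lambda>x. \<Sum>i\<in>UNIV. (partial_deriv i u x)\<^sup>2"
  shows "(LINT x|lebesgue_on S. 2 * h x * W (u x) * G x - (h x)\<^sup>2 * (W (u x) * \<Delta> x - W' (u x) * N x)) = 0"
    and "integrable (lebesgue_on S)
      (\<lambda>x. 2 * h x * W (u x) * G x - (h x)\<^sup>2 * (W (u x) * \<Delta> x - W' (u x) * N x))"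
proof -
  obtain K where K: "compact K" and KS: "K \<subseteq> S" and off: "\<And>x. x \<in> S \<Longrightarrow> x \<notin> K \<Longrightarrow> W (u x) = 0"
  proof -
    have "\<exists>K. compact K \<and> K \<subseteq> S \<and> (\<forall>x\<in>S. x \<notin> K \<longrightarrow> W (u x) = 0)"
      by (rule sublevel_set_compact[OF S cont bd \<epsilon>])
    then show ?thesis using that by blast
  qed
  note u1 = cont_diff_on_2_imp[OF u]
  have Wu: "cont_diff_on 1 S (\<lambda>x. W (u x))" by (rule cont_diff_on_1_compose[OF u1(1) W])
  define F where "F i = (\<lambda>x. h x * W (u x) * (h x * partial_deriv i u x))" for i
  have hW: "cont_diff_on 1 S (\<lambda>x. h x * W (u x))" by (rule cont_diff_on_1_mult[OF h Wu])
  have hu: "cont_diff_on 1 S (\<lambda>x. h x * partial_deriv i u x)" for i by (rule cont_diff_on_1_mult[OF h u1(2)])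
  have F: "cont_diff_on 1 S (F i)" for i unfolding F_def by (rule cont_diff_on_1_mult[OF hW hu])
  have F0: "F i x = 0" if "x \<in> S" "x \<notin> K" for i x using off[OF that] by (simp add: F_def)
  have pF: "(\<Sum>i\<in>UNIV. partial_deriv i (F i) x)
      = 2 * h x * W (u x) * G x - (h x)\<^sup>2 * (W (u x) * \<Delta> x - W' (u x) * N x)" if x: "x \<in> S" for x
  proof -
    note dh = cont_diff_on_1_imp(2)[OF h x] and du = cont_diff_on_1_imp(2)[OF u1(1) x]
      and dpu = cont_diff_on_1_imp(2)[OF u1(2) x] and dWu = cont_diff_on_1_imp(2)[OF Wu x]
      and dhW = cont_diff_on_1_imp(2)[OF hW x] and dhu = cont_diff_on_1_imp(2)[OF hu x]
    have G: "G x = (\<Sum>i\<in>UNIV. partial_deriv i h x * partial_deriv i u x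
        + h x * partial_deriv i (partial_deriv i u) x)"
      unfolding G_def using partial_deriv_mult[OF dh dpu] by simp
    have "partial_deriv i (F i) x = 2 * h x * W (u x) * (partial_deriv i h x * partial_deriv i u x
        + h x * partial_deriv i (partial_deriv i u) x)
        - (h x)\<^sup>2 * (W (u x) * partial_deriv i (partial_deriv i u) x - W' (u x) * (partial_deriv i u x)\<^sup>2)" for i
      unfolding F_def partial_deriv_mult[OF dhW dhu] partial_deriv_mult[OF dh dpu]
        partial_deriv_mult[OF dh dWu] partial_deriv_compose[OF du W(1)]
      by (simp add: algebra_simps power2_eq_square)
    then show ?thesis
      unfolding G \<Delta>_def N_def by (simp add: sum_subtractf sum_distrib_left right_diff_distrib)
  qed
  have cont_pF: "continuous_on S (\<lambda>x. \<Sum>i\<in>UNIV. partial_deriv i (F i) x)"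
    using cont_diff_on_1_imp(3)[OF F] by (intro continuous_on_sum)
  let ?\<Psi> = "\<lambda>i x. if x \<in> S then F i x else 0"
  note Z = zero_extension[OF S(1) F K KS F0]
  have int: "integrable (lebesgue_on S) (\<lambda>x. partial_deriv i (F i) x)" for i
  proof -
    have "partial_deriv i (F i) x = 0" if "x \<in> S" "x \<notin> K" for x
    proof -
      have "?\<Psi> i y = 0" if "y \<notin> K" for y using F0 that by auto
      then show ?thesis
        using partial_deriv_zero_off[OF compact_imp_closed[OF K], of "?\<Psi> i" x i] Z(2)[OF _ _ \<open>x \<in> S\<close>, of i i] that
        by simp
    qed
    then show ?thesis
      using integrable_continuous_support[OF S(1) cont_diff_on_1_imp(3)[OF F] K KS] by blast
  qed
  have "(LINT x|lebesgue_on S. partial_deriv i (F i) x) = 0" for i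
  proof -
    have "(LINT x|lebesgue_on S. partial_deriv i (F i) x) = (LINT x|lebesgue_on S. partial_deriv i (?\<Psi> i) x)"
      using Z(2) by (intro Bochner_Integration.integral_cong) auto
    then show ?thesis using integral_C1_test_fun_partial_deriv[OF S(1) Z(1)] by simp
  qed
  then have zero: "(LINT x|lebesgue_on S. (\<Sum>i\<in>UNIV. partial_deriv i (F i) x)) = 0"
    using int by simp
  define R where "R x = 2 * h x * W (u x) * G x - (h x)\<^sup>2 * (W (u x) * \<Delta> x - W' (u x) * N x)" for x
  have "(LINT x|lebesgue_on S. R x) = (LINT x|lebesgue_on S. (\<Sum>i\<in>UNIV. partial_deriv i (F i) x))"
    using pF by (intro Bochner_Integration.integral_cong) (simp_all add: R_def)
  moreover have "integrable (lebesgue_on S) R \<longleftrightarrow>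
      integrable (lebesgue_on S) (\<lambda>x. \<Sum>i\<in>UNIV. partial_deriv i (F i) x)"
    using pF by (intro Bochner_Integration.integrable_cong) (simp_all add: R_def)
  ultimately have "(LINT x|lebesgue_on S. R x) = 0" "integrable (lebesgue_on S) R"
    using zero int by simp_all
  then show "(LINT x|lebesgue_on S. 2 * h x * W (u x) * G x - (h x)\<^sup>2 * (W (u x) * \<Delta> x - W' (u x) * N x)) = 0"
    "integrable (lebesgue_on S)
      (\<lambda>x. 2 * h x * W (u x) * G x - (h x)\<^sup>2 * (W (u x) * \<Delta> x - W' (u x) * N x))"
    unfolding R_def[abs_def] by blast+
qed

text \<open>The lower bound on \<open>\<Delta>u + \<mu> \<bar>\<nabla>u\<bar>\<^sup>2\<close> and \<open>W' \<le> - \<mu> W\<close> make the term in \<open>h\<^sup>2\<close> at least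
  \<open>c h\<^sup>2 W(u)\<close>. The cross term is absorbed by Young's inequality.\<close>

lemma weighted_energy_estimate:
  fixes u h :: "real^'n::finite \<Rightarrow> real"
  assumes S: "open S" "bounded S" and u: "cont_diff_on 2 S u" and h: "cont_diff_on 1 S h"
    and cont: "continuous_on (closure S) u" and bd: "\<And>x. x \<in> frontier S \<Longrightarrow> u x = 0"
    and W: "\<And>t. (W has_real_derivative W' t) (at t)" "continuous_on UNIV W'"
    and \<epsilon>: "\<epsilon> > 0" "\<And>t. t \<ge> - \<epsilon> \<Longrightarrow> W t = 0"
    and W0: "\<And>t. W t \<ge> 0" "\<And>t. W' t \<le> - (\<mu> * W t)" and c: "c > 0"
    and low: "\<And>x. x \<in> S \<Longrightarrow> c \<le> (\<Sum>i\<in>UNIV. partial_deriv i (partial_deriv i u) x)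
        + \<mu> * (\<Sum>i\<in>UNIV. (partial_deriv i u x)\<^sup>2)"
  defines "G \<equiv> \<lambda>x. \<Sum>i\<in>UNIV. partial_deriv i (\<lambda>x. h x * partial_deriv i u x) x"
  shows "(LINT x|lebesgue_on S. (h x)\<^sup>2 * W (u x)) \<le> 4 / c\<^sup>2 * (LINT x|lebesgue_on S. W (u x) * (G x)\<^sup>2)"
    and "integrable (lebesgue_on S) (\<lambda>x. (h x)\<^sup>2 * W (u x))"
    and "integrable (lebesgue_on S) (\<lambda>x. W (u x) * (G x)\<^sup>2)"
proof -
  define \<Delta> N where "\<Delta> x = (\<Sum>i\<in>UNIV. partial_deriv i (partial_deriv i u) x)"
    and "N x = (\<Sum>i\<in>UNIV. (partial_deriv i u x)\<^sup>2)" for x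
  define R where "R x = 2 * h x * W (u x) * G x - (h x)\<^sup>2 * (W (u x) * \<Delta> x - W' (u x) * N x)" for x
  obtain K where K: "compact K" "K \<subseteq> S" "\<And>x. x \<in> S \<Longrightarrow> x \<notin> K \<Longrightarrow> W (u x) = 0"
  proof -
    have "\<exists>K. compact K \<and> K \<subseteq> S \<and> (\<forall>x\<in>S. x \<notin> K \<longrightarrow> W (u x) = 0)"
      by (rule sublevel_set_compact[OF S cont bd \<epsilon>])
    then show ?thesis using that by blast
  qed
  have R: "(LINT x|lebesgue_on S. R x) = 0" "integrable (lebesgue_on S) R"
    unfolding R_def[abs_def] G_def \<Delta>_def N_def
    by (rule weighted_divergence_integral[OF S u h cont bd W \<epsilon>]; assumption)+
  note u1 = cont_diff_on_2_imp[OF u]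
  have cW: "continuous_on S (\<lambda>x. W (u x))"
    using cont_diff_on_1_imp(1)[OF cont_diff_on_1_compose[OF u1(1) W]] .
  have cG: "continuous_on S G"
    unfolding G_def using cont_diff_on_1_imp(3)[OF cont_diff_on_1_mult[OF h u1(2)]]
    by (intro continuous_on_sum)
  have ch: "continuous_on S h" using cont_diff_on_1_imp(1)[OF h] .
  show I1: "integrable (lebesgue_on S) (\<lambda>x. (h x)\<^sup>2 * W (u x))"
    using cW ch K by (intro integrable_continuous_support[OF S(1) _ K(1,2)] continuous_intros) auto
  show I2: "integrable (lebesgue_on S) (\<lambda>x. W (u x) * (G x)\<^sup>2)"
    using cW cG K by (intro integrable_continuous_support[OF S(1) _ K(1,2)] continuous_intros) auto
  have "R x \<le> (2 / c) * (W (u x) * (G x)\<^sup>2) - (c / 2) * ((h x)\<^sup>2 * W (u x))" if x: "x \<in> S" for x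
  proof -
    have "N x \<ge> 0" unfolding N_def by (simp add: sum_nonneg)
    then have "W' (u x) * N x \<le> - (\<mu> * W (u x)) * N x" using W0(2) by (intro mult_right_mono)
    moreover have "W (u x) * c \<le> W (u x) * (\<Delta> x + \<mu> * N x)"
      using low[OF x] W0(1) unfolding \<Delta>_def N_def by (intro mult_left_mono)
    ultimately have "W (u x) * c \<le> W (u x) * \<Delta> x - W' (u x) * N x" by (simp add: algebra_simps)
    then have "(h x)\<^sup>2 * (W (u x) * c) \<le> (h x)\<^sup>2 * (W (u x) * \<Delta> x - W' (u x) * N x)"
      by (intro mult_left_mono) auto
    then have "R x \<le> W (u x) * (2 * h x * G x - c * (h x)\<^sup>2)" unfolding R_def by (simp add: algebra_simps)
    also have "2 * h x * G x \<le> (2 / c) * (G x)\<^sup>2 + (c / 2) * (h x)\<^sup>2"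
    proof -
      have "0 \<le> (c * h x - 2 * G x)\<^sup>2 / (2 * c)" using c by simp
      also have "\<dots> = (2 / c) * (G x)\<^sup>2 + (c / 2) * (h x)\<^sup>2 - 2 * h x * G x"
        using c by (simp add: field_simps power2_eq_square)
      finally show ?thesis by simp
    qed
    then have "W (u x) * (2 * h x * G x - c * (h x)\<^sup>2)
        \<le> W (u x) * ((2 / c) * (G x)\<^sup>2 + (c / 2) * (h x)\<^sup>2 - c * (h x)\<^sup>2)"
      using W0(1) by (intro mult_left_mono) auto
    finally show ?thesis by (simp add: algebra_simps)
  qed
  then have "(LINT x|lebesgue_on S. R x)
      \<le> (LINT x|lebesgue_on S. (2 / c) * (W (u x) * (G x)\<^sup>2) - (c / 2) * ((h x)\<^sup>2 * W (u x)))"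
    using R(2) I1 I2 by (intro integral_mono) auto
  then have "(c / 2) * (LINT x|lebesgue_on S. (h x)\<^sup>2 * W (u x))
      \<le> (2 / c) * (LINT x|lebesgue_on S. W (u x) * (G x)\<^sup>2)"
    using R(1) I1 I2 by simp
  then show "(LINT x|lebesgue_on S. (h x)\<^sup>2 * W (u x)) \<le> 4 / c\<^sup>2 * (LINT x|lebesgue_on S. W (u x) * (G x)\<^sup>2)"
    using c by (simp add: field_simps power2_eq_square)
qed

lemma DERIV_max_0_squared: "((\<lambda>y. (max 0 y)\<^sup>2) has_real_derivative 2 * max 0 y) (at (y :: real))"
proof (cases y "0 :: real" rule: linorder_cases)
  case less
  have "((\<lambda>y. 0) has_real_derivative 0) (at y)" by simp
  then have "((\<lambda>y. (max 0 y)\<^sup>2) has_real_derivative 0) (at y)"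
    by (rule has_field_derivative_transform_within_open[where S = "{..<0}"]) (use less in auto)
  then show ?thesis using less by simp
next
  case equal
  have "((\<lambda>h :: real. (max 0 h)\<^sup>2 / h) \<longlongrightarrow> 0) (at 0)"
  proof (rule Lim_null_comparison)
    show "\<forall>\<^sub>F h in at (0 :: real). norm ((max 0 h)\<^sup>2 / h) \<le> \<bar>h\<bar>"
      by (intro always_eventually) (auto simp: max_def power2_eq_square)
    show "((\<lambda>h :: real. \<bar>h\<bar>) \<longlongrightarrow> 0) (at 0)"
      by (rule tendsto_rabs_zero) (rule tendsto_ident_at)
  qed
  then show ?thesis using equal by (simp add: DERIV_def)
next
  case greater
  have "((\<lambda>y. y\<^sup>2) has_real_derivative 2 * y) (at y)"
    by (auto intro!: derivative_eq_intros)
  then have "((\<lambda>y. (max 0 y)\<^sup>2) has_real_derivative 2 * y) (at y)"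
    by (rule has_field_derivative_transform_within_open[where S = "{0<..}"]) (use greater in auto)
  then show ?thesis using greater by simp
qed

text \<open>The positive part of \<open>- (n + 1) t - 1\<close>. It enters the weight only through its square, which is
  \<open>C\<^sup>1\<close>.\<close>

definition ramp :: "nat \<Rightarrow> real \<Rightarrow> real" where
  "ramp n t = max 0 (- real (Suc n) * t - 1)"

text \<open>The weight \<open>exp (- \<mu> t)\<close> times a cutoff that vanishes for \<open>t \<ge> - 1 / (n + 1)\<close> and tends to
  \<open>1\<close> for \<open>t < 0\<close>. The cutoff is nonincreasing, and so its derivative has the favourable sign.\<close>

definition weight :: "real \<Rightarrow> nat \<Rightarrow> real \<Rightarrow> real" where
  "weight \<mu> n t = exp (- \<mu> * t) * (1 - 1 / (1 + (ramp n t)\<^sup>2))"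

text \<open>The derivative of \<open>weight \<mu> n\<close>.\<close>

definition weight_deriv :: "real \<Rightarrow> nat \<Rightarrow> real \<Rightarrow> real" where
  "weight_deriv \<mu> n t = - \<mu> * weight \<mu> n t -
     exp (- \<mu> * t) * (2 * real (Suc n) * ramp n t / (1 + (ramp n t)\<^sup>2)\<^sup>2)"

lemma one_plus_square_pos: "1 + (a :: real)\<^sup>2 > 0"
  by (simp add: add_pos_nonneg)

lemma weight_has_derivative: "(weight \<mu> n has_real_derivative weight_deriv \<mu> n t) (at t)"
proof -
  have "((\<lambda>t. - real (Suc n) * t - 1) has_real_derivative - real (Suc n)) (at t)"
    by (auto intro!: derivative_eq_intros)
  from DERIV_chain2[OF DERIV_max_0_squared this]
  have d: "((\<lambda>t. (ramp n t)\<^sup>2) has_real_derivative 2 * ramp n t * - real (Suc n)) (at t)"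
    by (simp add: ramp_def)
  define s where "s = (\<lambda>t. (ramp n t)\<^sup>2)"
  note [derivative_intros] = d[folded s_def]
  have pos: "1 + s t \<noteq> 0" using one_plus_square_pos[of "ramp n t"] by (simp add: s_def)
  have "((\<lambda>t. exp (- \<mu> * t)) has_real_derivative exp (- \<mu> * t) * - \<mu>) (at t)"
    by (auto intro!: derivative_eq_intros)
  moreover have "((\<lambda>t. 1 - 1 / (1 + s t)) has_real_derivative
      2 * ramp n t * - real (Suc n) / (1 + s t)\<^sup>2) (at t)"
    using pos by (auto intro!: derivative_eq_intros simp: power2_eq_square simp del: of_nat_Suc)
  ultimately have "((\<lambda>t. exp (- \<mu> * t) * (1 - 1 / (1 + s t))) has_real_derivative
      exp (- \<mu> * t) * - \<mu> * (1 - 1 / (1 + s t)) +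
      2 * ramp n t * - real (Suc n) / (1 + s t)\<^sup>2 * exp (- \<mu> * t)) (at t)"
    by (rule DERIV_mult)
  also have "exp (- \<mu> * t) * - \<mu> * (1 - 1 / (1 + s t)) +
      2 * ramp n t * - real (Suc n) / (1 + s t)\<^sup>2 * exp (- \<mu> * t) =
      - \<mu> * (exp (- \<mu> * t) * (1 - 1 / (1 + s t))) -
      exp (- \<mu> * t) * (2 * real (Suc n) * ramp n t / (1 + s t)\<^sup>2)"
    by (simp add: mult_ac del: of_nat_Suc)
  finally show ?thesis
    unfolding weight_def[abs_def] weight_deriv_def s_def .
qed

lemma continuous_weight_deriv: "continuous_on UNIV (weight_deriv \<mu> n)"
proof -
  have "1 + (ramp n t)\<^sup>2 \<noteq> 0" for t using one_plus_square_pos[of "ramp n t"] by simp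
  then show ?thesis
    unfolding weight_deriv_def[abs_def] weight_def ramp_def by (intro continuous_intros) auto
qed

lemma weight_deriv_le: "weight_deriv \<mu> n t \<le> - (\<mu> * weight \<mu> n t)"
  by (simp add: weight_deriv_def ramp_def)

lemma weight_eq_0:
  assumes "t \<ge> - inverse (real (Suc n))"
  shows "weight \<mu> n t = 0"
proof -
  have "real (Suc n) * - inverse (real (Suc n)) \<le> real (Suc n) * t"
    using assms by (intro mult_left_mono) auto
  then have "ramp n t = 0" by (simp add: ramp_def del: of_nat_Suc)
  then show ?thesis by (simp add: weight_def)
qed

lemma weight_bounds: "0 \<le> weight \<mu> n t" "weight \<mu> n t \<le> exp (- \<mu> * t)"
proof -
  have "0 \<le> 1 - 1 / (1 + (ramp n t)\<^sup>2)" "1 - 1 / (1 + (ramp n t)\<^sup>2) \<le> 1"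
    using one_plus_square_pos[of "ramp n t"] by (auto simp: divide_simps)
  then show "0 \<le> weight \<mu> n t" "weight \<mu> n t \<le> exp (- \<mu> * t)"
    unfolding weight_def by (auto simp: mult_left_le)
qed

lemma weight_tendsto:
  assumes "t < 0"
  shows "(\<lambda>n. weight \<mu> n t) \<longlonglongrightarrow> exp (- \<mu> * t)"
proof -
  have "filterlim (\<lambda>n. (- t) * real (Suc n)) at_top sequentially"
    using assms
    by (intro filterlim_tendsto_pos_mult_at_top[OF tendsto_const _
          filterlim_compose[OF filterlim_real_sequentially filterlim_Suc]]) auto
  then have "filterlim (\<lambda>n. - 1 + (- t) * real (Suc n)) at_top sequentially"
    by (rule filterlim_tendsto_add_at_top[OF tendsto_const])
  then have "filterlim (\<lambda>n. ramp n t) at_top sequentially"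
    by (rule filterlim_at_top_mono) (auto simp: ramp_def max_def algebra_simps)
  then have "filterlim (\<lambda>n. 1 + (ramp n t)\<^sup>2) at_top sequentially"
    by (intro filterlim_tendsto_add_at_top[OF tendsto_const] filterlim_pow_at_top) auto
  then have "(\<lambda>n. 1 / (1 + (ramp n t)\<^sup>2)) \<longlonglongrightarrow> 0"
    using tendsto_inverse_0_at_top by (simp add: divide_inverse)
  then have "(\<lambda>n. exp (- \<mu> * t) * (1 - 1 / (1 + (ramp n t)\<^sup>2))) \<longlonglongrightarrow> exp (- \<mu> * t) * (1 - 0)"
    by (intro tendsto_intros)
  then show ?thesis by (simp add: weight_def)
qed

text \<open>The limit \<open>n \<rightarrow> \<infinity>\<close> of the weighted estimate. Since \<open>- B \<le> u < 0\<close>, the weights converge to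
  \<open>exp (- \<mu> u)\<close>, which lies between \<open>1\<close> and \<open>exp (\<mu> B)\<close>.\<close>

lemma energy_estimate:
  fixes u h :: "real^'n::finite \<Rightarrow> real"
  assumes S: "open S" "bounded S" and u: "cont_diff_on 2 S u" and h: "cont_diff_on 1 S h"
    and cont: "continuous_on (closure S) u" and bd: "\<And>x. x \<in> frontier S \<Longrightarrow> u x = 0"
    and u_bounds: "\<And>x. x \<in> S \<Longrightarrow> - B \<le> u x" "\<And>x. x \<in> S \<Longrightarrow> u x < 0"
    and h_bound: "\<And>x. x \<in> S \<Longrightarrow> \<bar>h x\<bar> \<le> H"
    and \<mu>: "\<mu> \<ge> 0" and c: "c > 0"
    and low: "\<And>x. x \<in> S \<Longrightarrow> c \<le> (\<Sum>i\<in>UNIV. partial_deriv i (partial_deriv i u) x)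
        + \<mu> * (\<Sum>i\<in>UNIV. (partial_deriv i u x)\<^sup>2)"
  defines "G \<equiv> \<lambda>x. \<Sum>i\<in>UNIV. partial_deriv i (\<lambda>x. h x * partial_deriv i u x) x"
  assumes G: "integrable (lebesgue_on S) (\<lambda>x. (G x)\<^sup>2)"
  shows "(LINT x|lebesgue_on S. (h x)\<^sup>2) \<le> 4 / c\<^sup>2 * exp (\<mu> * B) * (LINT x|lebesgue_on S. (G x)\<^sup>2)"
proof -
  let ?L = "lebesgue_on S"
  have finite: "emeasure lebesgue S < \<infinity>"
    using emeasure_bounded_finite[OF S(2)] S(1) by simp
  have const: "integrable ?L (\<lambda>x. a)" for a :: real
    using finite S(1) by (simp add: integrable_restrict_space sets_lebesgue_open)
  have [measurable]: "h \<in> borel_measurable ?L" "u \<in> borel_measurable ?L"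
    using cont_diff_on_1_imp(1)[OF h] cont_diff_on_1_imp(1)[OF cont_diff_on_2_imp(1)[OF u]] S(1)
    by (auto intro!: continuous_imp_measurable_on_sets_lebesgue sets_lebesgue_open)
  have exp_le: "exp (- \<mu> * u x) \<le> exp (\<mu> * B)" if "x \<in> S" for x
    using mult_left_mono[OF u_bounds(1)[OF that] \<mu>] by simp
  have w_le: "weight \<mu> n (u x) \<le> exp (\<mu> * B)" if "x \<in> S" for n x
    using weight_bounds(2)[of \<mu> n "u x"] exp_le[OF that] by linarith
  have h_le: "(h x)\<^sup>2 \<le> H\<^sup>2" if "x \<in> S" for x
    using h_bound[OF that] by (metis abs_ge_zero power2_abs power_mono)
  have est: "(LINT x|?L. (h x)\<^sup>2 * weight \<mu> n (u x)) \<le> 4 / c\<^sup>2 * exp (\<mu> * B) * (LINT x|?L. (G x)\<^sup>2)" for n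
  proof -
    have n: "inverse (real (Suc n)) > 0" by simp
    note E = weighted_energy_estimate[OF S u h cont bd weight_has_derivative continuous_weight_deriv n
        weight_eq_0[where n = n and \<mu> = \<mu>] weight_bounds(1) weight_deriv_le c low]
    have "(LINT x|?L. weight \<mu> n (u x) * (G x)\<^sup>2) \<le> (LINT x|?L. exp (\<mu> * B) * (G x)\<^sup>2)"
      using w_le E(3) G unfolding G_def by (intro integral_mono) (auto intro!: mult_right_mono)
    then have "4 / c\<^sup>2 * (LINT x|?L. weight \<mu> n (u x) * (G x)\<^sup>2) \<le> 4 / c\<^sup>2 * (exp (\<mu> * B) * (LINT x|?L. (G x)\<^sup>2))"
      using c by (intro mult_left_mono) auto
    with E(1) show ?thesis unfolding G_def by simp
  qed
  have "(\<lambda>n. LINT x|?L. (h x)\<^sup>2 * weight \<mu> n (u x)) \<longlonglongrightarrow> (LINT x|?L. (h x)\<^sup>2 * exp (- \<mu> * u x))"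
  proof (rule integral_dominated_convergence)
    show "integrable ?L (\<lambda>x. H\<^sup>2 * exp (\<mu> * B))" by (rule const)
    show "AE x in ?L. norm ((h x)\<^sup>2 * weight \<mu> n (u x)) \<le> H\<^sup>2 * exp (\<mu> * B)" for n
      using h_le w_le weight_bounds(1) by (intro AE_I2) (auto intro!: mult_mono)
    show "AE x in ?L. (\<lambda>n. (h x)\<^sup>2 * weight \<mu> n (u x)) \<longlonglongrightarrow> (h x)\<^sup>2 * exp (- \<mu> * u x)"
      using u_bounds(2) by (intro AE_I2 tendsto_mult tendsto_const weight_tendsto) auto
    show "(\<lambda>x. (h x)\<^sup>2 * weight \<mu> n (u x)) \<in> borel_measurable ?L" for n
      unfolding weight_def ramp_def by measurable
  qed measurable
  then have "(LINT x|?L. (h x)\<^sup>2 * exp (- \<mu> * u x)) \<le> 4 / c\<^sup>2 * exp (\<mu> * B) * (LINT x|?L. (G x)\<^sup>2)"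
    using est by (intro LIMSEQ_le_const2) auto
  moreover have "(LINT x|?L. (h x)\<^sup>2) \<le> (LINT x|?L. (h x)\<^sup>2 * exp (- \<mu> * u x))"
  proof (rule integral_mono)
    show "integrable ?L (\<lambda>x. (h x)\<^sup>2)"
      using h_le by (intro Bochner_Integration.integrable_bound[OF const[of "H\<^sup>2"]] AE_I2) auto
    show "integrable ?L (\<lambda>x. (h x)\<^sup>2 * exp (- \<mu> * u x))"
      using h_le exp_le
      by (intro Bochner_Integration.integrable_bound[OF const[of "H\<^sup>2 * exp (\<mu> * B)"]] AE_I2)
        (auto intro!: mult_mono simp: abs_mult)
    fix x assume "x \<in> space ?L"
    then have "1 \<le> exp (- \<mu> * u x)" using u_bounds(2)[of x] \<mu> by (simp add: mult_nonneg_nonpos)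
    then show "(h x)\<^sup>2 \<le> (h x)\<^sup>2 * exp (- \<mu> * u x)"
      using mult_left_mono[of 1 "exp (- \<mu> * u x)" "(h x)\<^sup>2"] by simp
  qed
  ultimately show ?thesis by linarith
qed

text \<open>The pointwise algebra behind the lower bound on \<open>\<Delta>u + \<mu> \<bar>\<nabla>u\<bar>\<^sup>2\<close>. Here \<open>a\<close>, \<open>p\<close> and \<open>D\<close> stand for
  the values of \<open>\<nabla>f\<close>, \<open>\<nabla>u\<close> and the pure second derivatives of \<open>u\<close> at a point.\<close>

lemma laplacian_lower_bound:
  fixes a p :: "'n::finite \<Rightarrow> real"
  assumes fmin: "0 < fmin" "fmin \<le> f" "f \<le> B" and g: "0 < gmin"
    and eq: "gmin \<le> (\<Sum>i\<in>UNIV. a i * p i + f * D i)"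
    and a: "\<And>i. \<bar>a i\<bar> \<le> B"
  shows "gmin / (2 * B) \<le> (\<Sum>i\<in>UNIV. D i) + real CARD('n) * B\<^sup>2 / (2 * gmin) / fmin * (\<Sum>i\<in>UNIV. (p i)\<^sup>2)"
proof -
  define d where "d = real CARD('n)"
  define k where "k = d * B\<^sup>2 / (2 * gmin)"
  define P where "P = (\<Sum>i\<in>UNIV. (p i)\<^sup>2)"
  define L where "L = (\<Sum>i\<in>UNIV. D i)"
  have d: "d > 0" by (simp add: d_def)
  have B: "B > 0" using fmin by linarith
  have k: "k \<ge> 0" using d g by (simp add: k_def)
  have P: "P \<ge> 0" by (simp add: P_def sum_nonneg)
  have "a i * p i \<le> gmin / (2 * d) + k * (p i)\<^sup>2" for i
  proof -
    have "a i * p i \<le> \<bar>a i\<bar> * \<bar>p i\<bar>" by (metis abs_ge_self abs_mult)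
    also have "\<dots> \<le> B * \<bar>p i\<bar>" using a by (intro mult_right_mono) auto
    also have "\<dots> \<le> gmin / (2 * d) + k * (p i)\<^sup>2"
    proof -
      \<comment> \<open>Young's inequality, weighted so that the sum over all \<open>d\<close> axes costs half of \<open>gmin\<close>.\<close>
      have "0 \<le> (gmin - d * B * \<bar>p i\<bar>)\<^sup>2 / (2 * d * gmin)" using d g by simp
      also have "\<dots> = gmin / (2 * d) + k * \<bar>p i\<bar>\<^sup>2 - B * \<bar>p i\<bar>"
        using d g unfolding k_def by (simp add: field_simps power2_eq_square)
      finally show ?thesis by simp
    qed
    finally show ?thesis .
  qed
  then have "(\<Sum>i\<in>UNIV. a i * p i) \<le> (\<Sum>i\<in>(UNIV :: 'n set). gmin / (2 * d) + k * (p i)\<^sup>2)"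
    by (intro sum_mono)
  also have "\<dots> = gmin / 2 + k * P"
    using d by (simp add: sum.distrib sum_distrib_left P_def flip: d_def)
  finally have "gmin / 2 \<le> k * P + f * L"
    using eq by (simp add: sum.distrib sum_distrib_left L_def)
  then have "gmin / 2 / f \<le> (k * P + f * L) / f"
    using fmin by (intro divide_right_mono) auto
  also have "\<dots> = k * P / f + L" using fmin by (simp add: field_simps)
  also have "k * P / f \<le> k * P / fmin" using fmin k P by (intro divide_left_mono) auto
  finally have "gmin / 2 / f \<le> L + k / fmin * P" by simp
  moreover have "gmin / 2 / B \<le> gmin / 2 / f" using fmin g B by (intro divide_left_mono) auto
  ultimately show ?thesis by (simp add: L_def k_def d_def P_def)
qed

section \<open>Square-integrable weak derivatives\<close>

lemma borel_measurable_lebesgue_on_AE: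
  fixes f g :: "real^'n::finite \<Rightarrow> real"
  assumes S: "S \<in> sets lebesgue" and f: "f \<in> borel_measurable (lebesgue_on S)"
    and eq: "AE x in lebesgue_on S. f x = g x"
  shows "g \<in> borel_measurable (lebesgue_on S)"
proof -
  have "AE x in lebesgue. x \<in> S \<longrightarrow> f x = g x"
    using eq S by (simp add: AE_restrict_space_iff)
  then obtain N where N: "N \<in> null_sets lebesgue" "{x. \<not> (x \<in> S \<longrightarrow> f x = g x)} \<subseteq> N"
    unfolding eventually_ae_filter by auto
  have "f measurable_on S" using f measurable_on_iff_borel_measurable[OF S] by blast
  then have "g measurable_on S"
    by (rule measurable_on_spike[of _ _ N]) (use N in \<open>auto simp: negligible_iff_null_sets\<close>)
  then show ?thesis using measurable_on_iff_borel_measurable[OF S] by blast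
qed

lemma L2_space_cong_AE:
  fixes f g :: "real^'n::finite \<Rightarrow> real"
  assumes S: "open S" and f: "f \<in> L2_space S" and eq: "AE x in lebesgue_on S. f x = g x"
  shows "g \<in> L2_space S"
proof -
  have [measurable]: "f \<in> borel_measurable (lebesgue_on S)" "g \<in> borel_measurable (lebesgue_on S)"
    using f borel_measurable_lebesgue_on_AE[OF sets_lebesgue_open[OF S] _ eq] unfolding L2_space_def by auto
  have "integrable (lebesgue_on S) (\<lambda>x. (f x)\<^sup>2) \<longleftrightarrow> integrable (lebesgue_on S) (\<lambda>x. (g x)\<^sup>2)"
    using eq by (intro integrable_cong_AE) (auto elim: eventually_mono)
  then show ?thesis using f unfolding L2_space_def by auto
qed

lemma L2_space_diff:
  assumes "f \<in> L2_space S" "g \<in> L2_space S"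
  shows "(\<lambda>x. f x - g x) \<in> L2_space S"
proof -
  have [measurable]: "f \<in> borel_measurable (lebesgue_on S)" "g \<in> borel_measurable (lebesgue_on S)"
    and I: "integrable (lebesgue_on S) (\<lambda>x. (f x)\<^sup>2)" "integrable (lebesgue_on S) (\<lambda>x. (g x)\<^sup>2)"
    using assms unfolding L2_space_def by auto
  have "integrable (lebesgue_on S) (\<lambda>x. (f x - g x)\<^sup>2)"
  proof (rule Bochner_Integration.integrable_bound)
    show "integrable (lebesgue_on S) (\<lambda>x. 2 * (f x)\<^sup>2 + 2 * (g x)\<^sup>2)" using I by simp
    have "(f x - g x)\<^sup>2 \<le> 2 * (f x)\<^sup>2 + 2 * (g x)\<^sup>2" for x
      using zero_le_power2[of "f x + g x"] by (simp add: power2_eq_square algebra_simps)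
    then show "AE x in lebesgue_on S. norm ((f x - g x)\<^sup>2) \<le> norm (2 * (f x)\<^sup>2 + 2 * (g x)\<^sup>2)"
      by (intro AE_I2) simp
  qed measurable
  then show ?thesis unfolding L2_space_def by simp
qed

lemma L2_norm_squared: "(L2_norm S f)\<^sup>2 = (LINT x|lebesgue_on S. (f x)\<^sup>2)"
  unfolding L2_norm_def by simp

lemma Hk_spaceD:
  "u \<in> Hk_space k S \<Longrightarrow> mi_order \<beta> \<le> k \<Longrightarrow> \<exists>v\<in>L2_space S. has_weak_deriv S \<beta> u v"
  by (simp add: Hk_space_def)

lemma Hk_space_weak_deriv:
  assumes "u \<in> Hk_space k S" "mi_order \<beta> \<le> k"
  shows "has_weak_deriv S \<beta> u (weak_deriv S \<beta> u)"
  unfolding weak_deriv_def using Hk_spaceD[OF assms] by (intro someI_ex[where P = "has_weak_deriv S \<beta> u"]) blast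

text \<open>The representative selected by \<open>weak_deriv\<close> agrees almost everywhere with a square-integrable
  one, and is therefore itself measurable and square-integrable.\<close>

lemma Hk_space_diff_weak_deriv:
  fixes u w :: "real^'n::finite \<Rightarrow> real"
  assumes S: "open S" and u: "u \<in> Hk_space k S" and w: "w \<in> Hk_space k S" and n: "n \<le> k"
  shows "has_weak_deriv S (mi_axis n i) (\<lambda>x. u x - w x) (weak_deriv S (mi_axis n i) (\<lambda>x. u x - w x))"
    and "weak_deriv S (mi_axis n i) (\<lambda>x. u x - w x) \<in> L2_space S"
proof -
  obtain a b where a: "a \<in> L2_space S" "has_weak_deriv S (mi_axis n i) u a"
    and b: "b \<in> L2_space S" "has_weak_deriv S (mi_axis n i) w b"
    using Hk_spaceD[OF u, of "mi_axis n i"] Hk_spaceD[OF w, of "mi_axis n i"] n by auto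
  note d = has_weak_deriv_diff[OF S a(2) b(2) test_fun_mi_deriv_axis]
  show W: "has_weak_deriv S (mi_axis n i) (\<lambda>x. u x - w x) (weak_deriv S (mi_axis n i) (\<lambda>x. u x - w x))"
    unfolding weak_deriv_def by (rule someI[where P = "has_weak_deriv S (mi_axis n i) (\<lambda>x. u x - w x)"]) (rule d)
  show "weak_deriv S (mi_axis n i) (\<lambda>x. u x - w x) \<in> L2_space S"
    by (rule L2_space_cong_AE[OF S L2_space_diff[OF a(1) b(1)] has_weak_deriv_unique[OF S d W]])
qed

lemma continuous_AE_eq_imp_eq:
  fixes a b :: "real^'n::finite \<Rightarrow> real"
  assumes S: "open S" and a: "continuous_on S a" and b: "continuous_on S b"
    and eq: "AE x in lebesgue_on S. a x = b x" and x: "x \<in> S"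
  shows "a x = b x"
proof -
  have "open (S \<inter> (\<lambda>x. a x - b x) -` (- {0}))"
    using S a b by (intro continuous_open_preimage continuous_intros) auto
  then have "closed (- (S \<inter> (\<lambda>x. a x - b x) -` (- {0})))" by (rule closed_Compl)
  moreover have "AE x\<in>S in lebesgue. x \<in> - (S \<inter> (\<lambda>x. a x - b x) -` (- {0}))"
    using eq sets_lebesgue_open[OF S] by (auto simp: AE_restrict_space_iff elim: eventually_mono)
  ultimately have "x \<in> - (S \<inter> (\<lambda>x. a x - b x) -` (- {0}))"
    using mem_closed_if_AE_lebesgue_open[OF S] x by blast
  then show ?thesis using x by simp
qed

section \<open>The stability estimate\<close>

text \<open>For a \<open>C\<^sup>2\<close> solution and a continuous right-hand side the equation holds at every point.\<close>

lemma weak_equation_classical: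
  assumes S: "open S" and u: "u \<in> Hk_space 2 S" "cont_diff_on 2 S u" and f: "cont_diff_on 1 S f"
    and eq: "divergence_eq S f u g" and g: "continuous_on S g" and x: "x \<in> S"
  shows "(\<Sum>i\<in>UNIV. partial_deriv i f x * partial_deriv i u x + f x * partial_deriv i (partial_deriv i u) x) = g x"
proof -
  note u1 = cont_diff_on_2_imp[OF u(2)] and Df = cont_diff_on_1_imp[OF f]
  have F: "cont_diff_on 1 S (\<lambda>x. f x * partial_deriv i u x)" for i
    by (rule cont_diff_on_1_mult[OF f u1(2)])
  have grad: "AE x in lebesgue_on S. weak_deriv S (mi_unit i) u x = partial_deriv i u x" for i
    using Hk_space_weak_deriv[OF u(1), of "mi_unit i"] classical_weak_deriv[OF S u1(1), of i]
    by (intro has_weak_deriv_unique[OF S]) (auto simp: mi_unit_eq)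
  then have "AE x in lebesgue_on S. \<forall>i\<in>UNIV. weak_deriv S (mi_unit i) u x = partial_deriv i u x"
    by (intro AE_finite_allI) auto
  then have ae: "AE x in lebesgue_on S. f x *\<^sub>R weak_gradient S u x = (\<chi> i. f x * partial_deriv i u x)"
    by (rule eventually_mono) (auto simp: weak_gradient_def vec_eq_iff)
  have li: "locally_integrable S (\<lambda>x. (\<chi> i. f x * partial_deriv i u x) $ j)" for j
    using locally_integrable_continuous[OF cont_diff_on_1_imp(1)[OF F]] by simp
  have "has_weak_divergence S (\<lambda>x. \<chi> i. f x * partial_deriv i u x) g"
    by (rule has_weak_divergence_cong_AE[OF S eq[unfolded divergence_eq_def] li ae])
  from has_weak_divergence_unique[OF S classical_divergence[OF S F] this]
  have "(\<Sum>i\<in>UNIV. partial_deriv i (\<lambda>x. f x * partial_deriv i u x) x) = g x"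
    using cont_diff_on_1_imp(3)[OF F] g x by (intro continuous_AE_eq_imp_eq[OF S]) (auto intro: continuous_on_sum)
  then show ?thesis
    using partial_deriv_mult[OF Df(2)[OF x] cont_diff_on_1_imp(2)[OF u1(2) x]] by simp
qed

text \<open>Subtracting the two equations, \<open>\<nabla> \<cdot> ((f\<^sub>1 - f\<^sub>2) \<nabla>u\<^sub>1) = g\<^sub>1 - g\<^sub>2 - \<nabla> \<cdot> (f\<^sub>2 \<nabla>(u\<^sub>1 - u\<^sub>2))\<close>.\<close>

lemma difference_equation:
  fixes u\<^sub>1 u\<^sub>2 :: "real^'n::finite \<Rightarrow> real"
  assumes S: "open S" and u\<^sub>1: "u\<^sub>1 \<in> Hk_space 2 S" "cont_diff_on 2 S u\<^sub>1" and u\<^sub>2: "u\<^sub>2 \<in> Hk_space 2 S"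
    and f: "cont_diff_on 1 S f\<^sub>1" "cont_diff_on 1 S f\<^sub>2"
    and eq: "divergence_eq S f\<^sub>1 u\<^sub>1 g\<^sub>1" "divergence_eq S f\<^sub>2 u\<^sub>2 g\<^sub>2"
  shows "AE x in lebesgue_on S. (\<Sum>i\<in>UNIV. partial_deriv i (\<lambda>x. (f\<^sub>1 x - f\<^sub>2 x) * partial_deriv i u\<^sub>1 x) x) =
    g\<^sub>1 x - g\<^sub>2 x - (\<Sum>i\<in>UNIV. partial_deriv i f\<^sub>2 x * weak_deriv S (mi_axis 1 i) (\<lambda>x. u\<^sub>1 x - u\<^sub>2 x) x
      + f\<^sub>2 x * weak_deriv S (mi_axis 2 i) (\<lambda>x. u\<^sub>1 x - u\<^sub>2 x) x)"
proof -
  define V Z where "V i = weak_deriv S (mi_axis 1 i) (\<lambda>x. u\<^sub>1 x - u\<^sub>2 x)"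
    and "Z i = weak_deriv S (mi_axis 2 i) (\<lambda>x. u\<^sub>1 x - u\<^sub>2 x)" for i
  note u1 = cont_diff_on_2_imp[OF u\<^sub>1(2)]
  have V: "has_weak_deriv S (mi_axis 1 i) (\<lambda>x. u\<^sub>1 x - u\<^sub>2 x) (V i)"
    and Z: "has_weak_deriv S (mi_axis 2 i) (\<lambda>x. u\<^sub>1 x - u\<^sub>2 x) (Z i)" for i
    unfolding V_def Z_def by (intro Hk_space_diff_weak_deriv[OF S u\<^sub>1(1) u\<^sub>2]; simp)+
  have E: "has_weak_divergence S
      (\<lambda>x. f\<^sub>1 x *\<^sub>R weak_gradient S u\<^sub>1 x - f\<^sub>2 x *\<^sub>R weak_gradient S u\<^sub>2 x - f\<^sub>2 x *\<^sub>R (\<chi> i. V i x))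
      (\<lambda>x. g\<^sub>1 x - g\<^sub>2 x - (\<Sum>i\<in>UNIV. partial_deriv i f\<^sub>2 x * V i x + f\<^sub>2 x * Z i x))"
    by (intro has_weak_divergence_diff[OF S] weak_divergence_product[OF S f(2)]
        has_weak_deriv_second[OF V Z] eq[unfolded divergence_eq_def])
  have wd1: "has_weak_deriv S (mi_axis 1 i) u\<^sub>1 (weak_deriv S (mi_axis 1 i) u\<^sub>1)"
    and wd2: "has_weak_deriv S (mi_axis 1 i) u\<^sub>2 (weak_deriv S (mi_axis 1 i) u\<^sub>2)" for i
    using Hk_space_weak_deriv[OF u\<^sub>1(1)] Hk_space_weak_deriv[OF u\<^sub>2] by auto
  have grad: "AE x in lebesgue_on S. weak_deriv S (mi_axis 1 i) u\<^sub>1 x = partial_deriv i u\<^sub>1 x" for i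
    using has_weak_deriv_unique[OF S wd1 classical_weak_deriv[OF S u1(1), unfolded mi_unit_eq]] .
  have diff: "AE x in lebesgue_on S. weak_deriv S (mi_axis 1 i) u\<^sub>1 x - weak_deriv S (mi_axis 1 i) u\<^sub>2 x = V i x" for i
    by (rule has_weak_deriv_unique[OF S has_weak_deriv_diff[OF S wd1 wd2 test_fun_mi_deriv_axis] V])
  have "AE x in lebesgue_on S. \<forall>i\<in>UNIV. weak_deriv S (mi_axis 1 i) u\<^sub>1 x = partial_deriv i u\<^sub>1 x \<and>
      weak_deriv S (mi_axis 1 i) u\<^sub>1 x - weak_deriv S (mi_axis 1 i) u\<^sub>2 x = V i x"
    using grad diff by (intro AE_finite_allI eventually_conj) auto
  then have "AE x in lebesgue_on S.
      f\<^sub>1 x *\<^sub>R weak_gradient S u\<^sub>1 x - f\<^sub>2 x *\<^sub>R weak_gradient S u\<^sub>2 x - f\<^sub>2 x *\<^sub>R (\<chi> i. V i x) =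
      (\<chi> i. (f\<^sub>1 x - f\<^sub>2 x) * partial_deriv i u\<^sub>1 x)"
  proof (rule eventually_mono)
    fix x
    assume *: "\<forall>i\<in>UNIV. weak_deriv S (mi_axis 1 i) u\<^sub>1 x = partial_deriv i u\<^sub>1 x \<and>
      weak_deriv S (mi_axis 1 i) u\<^sub>1 x - weak_deriv S (mi_axis 1 i) u\<^sub>2 x = V i x"
    have "f\<^sub>1 x * weak_deriv S (mi_axis 1 i) u\<^sub>1 x - f\<^sub>2 x * weak_deriv S (mi_axis 1 i) u\<^sub>2 x - f\<^sub>2 x * V i x
        = (f\<^sub>1 x - f\<^sub>2 x) * partial_deriv i u\<^sub>1 x" for i
    proof -
      have "V i x = partial_deriv i u\<^sub>1 x - weak_deriv S (mi_axis 1 i) u\<^sub>2 x"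
        "weak_deriv S (mi_axis 1 i) u\<^sub>1 x = partial_deriv i u\<^sub>1 x" using *[rule_format, of i] by auto
      then show ?thesis by (simp only:) (simp add: algebra_simps)
    qed
    then show "f\<^sub>1 x *\<^sub>R weak_gradient S u\<^sub>1 x - f\<^sub>2 x *\<^sub>R weak_gradient S u\<^sub>2 x - f\<^sub>2 x *\<^sub>R (\<chi> i. V i x) =
        (\<chi> i. (f\<^sub>1 x - f\<^sub>2 x) * partial_deriv i u\<^sub>1 x)"
      by (simp add: vec_eq_iff weak_gradient_def mi_unit_eq)
  qed
  moreover have F: "cont_diff_on 1 S (\<lambda>x. (f\<^sub>1 x - f\<^sub>2 x) * partial_deriv i u\<^sub>1 x)" for i
    by (rule cont_diff_on_1_mult[OF cont_diff_on_1_diff[OF f] u1(2)])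
  moreover have "locally_integrable S (\<lambda>x. (\<chi> i. (f\<^sub>1 x - f\<^sub>2 x) * partial_deriv i u\<^sub>1 x) $ j)" for j
    using locally_integrable_continuous[OF cont_diff_on_1_imp(1)[OF F]] by simp
  ultimately have "has_weak_divergence S (\<lambda>x. \<chi> i. (f\<^sub>1 x - f\<^sub>2 x) * partial_deriv i u\<^sub>1 x)
      (\<lambda>x. g\<^sub>1 x - g\<^sub>2 x - (\<Sum>i\<in>UNIV. partial_deriv i f\<^sub>2 x * V i x + f\<^sub>2 x * Z i x))"
    by (intro has_weak_divergence_cong_AE[OF S E])
  from has_weak_divergence_unique[OF S classical_divergence[OF S F] this]
  show ?thesis unfolding V_def Z_def .
qed

lemma source_L2_bound:
  fixes V Z :: "'n::finite \<Rightarrow> real^'n \<Rightarrow> real"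
  assumes S: "open S" and g: "g \<in> L2_space S"
    and V: "\<And>i. V i \<in> L2_space S" "\<And>i. (L2_norm S (V i))\<^sup>2 \<le> A\<^sup>2"
    and Z: "\<And>i. Z i \<in> L2_space S" "\<And>i. (L2_norm S (Z i))\<^sup>2 \<le> A\<^sup>2" and A: "A \<ge> 0"
    and a: "\<And>i x. x \<in> S \<Longrightarrow> \<bar>a i x\<bar> \<le> F" and f: "\<And>x. x \<in> S \<Longrightarrow> \<bar>f x\<bar> \<le> F" and F: "F \<ge> 0"
    and G: "continuous_on S G"
    and eq: "AE x in lebesgue_on S. G x = g x - (\<Sum>i\<in>UNIV. a i x * V i x + f x * Z i x)"
  shows "integrable (lebesgue_on S) (\<lambda>x. (G x)\<^sup>2)"
    and "(LINT x|lebesgue_on S. (G x)\<^sup>2) \<le> 8 * (real CARD('n))\<^sup>2 * (F * A + L2_norm S g)\<^sup>2"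
proof -
  define d where "d = real CARD('n)"
  have d: "d \<ge> 1" unfolding d_def by (simp add: Suc_le_eq)
  define R where "R x = 2 * (g x)\<^sup>2 + 4 * d * F\<^sup>2 * (\<Sum>i\<in>UNIV. (V i x)\<^sup>2 + (Z i x)\<^sup>2)" for x
  have sq: "(s - t)\<^sup>2 \<le> 2 * s\<^sup>2 + 2 * t\<^sup>2" "(s + t)\<^sup>2 \<le> 2 * s\<^sup>2 + 2 * t\<^sup>2" for s t :: real
    using zero_le_power2[of "s + t"] zero_le_power2[of "s - t"] by (auto simp: power2_eq_square algebra_simps)
  have bound: "(g x - (\<Sum>i\<in>UNIV. a i x * V i x + f x * Z i x))\<^sup>2 \<le> R x" if x: "x \<in> S" for x
  proof -
    have "(a i x * V i x + f x * Z i x)\<^sup>2 \<le> 2 * F\<^sup>2 * ((V i x)\<^sup>2 + (Z i x)\<^sup>2)" for i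
    proof -
      have "(a i x)\<^sup>2 \<le> F\<^sup>2" "(f x)\<^sup>2 \<le> F\<^sup>2"
        using a[OF x, of i] f[OF x] F by (simp_all add: abs_le_square_iff flip: abs_le_square_iff)
      then have "(a i x)\<^sup>2 * (V i x)\<^sup>2 \<le> F\<^sup>2 * (V i x)\<^sup>2" "(f x)\<^sup>2 * (Z i x)\<^sup>2 \<le> F\<^sup>2 * (Z i x)\<^sup>2"
        by (auto intro: mult_right_mono)
      then show ?thesis using sq(2)[of "a i x * V i x" "f x * Z i x"]
        by (simp add: power_mult_distrib algebra_simps)
    qed
    then have "(\<Sum>i\<in>UNIV. (a i x * V i x + f x * Z i x)\<^sup>2) \<le> (\<Sum>i\<in>UNIV. 2 * F\<^sup>2 * ((V i x)\<^sup>2 + (Z i x)\<^sup>2))"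
      by (intro sum_mono)
    also have "\<dots> = 2 * F\<^sup>2 * (\<Sum>i\<in>UNIV. (V i x)\<^sup>2 + (Z i x)\<^sup>2)"
      by (rule sum_distrib_left[symmetric])
    finally have "d * (\<Sum>i\<in>UNIV. (a i x * V i x + f x * Z i x)\<^sup>2) \<le> d * (2 * F\<^sup>2 * (\<Sum>i\<in>UNIV. (V i x)\<^sup>2 + (Z i x)\<^sup>2))"
      using d by (intro mult_left_mono) auto
    moreover have "(\<Sum>i\<in>UNIV. a i x * V i x + f x * Z i x)\<^sup>2 \<le> d * (\<Sum>i\<in>UNIV. (a i x * V i x + f x * Z i x)\<^sup>2)"
      using sum_squared_le_sum_of_squares[of "\<lambda>i. a i x * V i x + f x * Z i x" "UNIV :: 'n set"]
      by (simp add: d_def mult.commute)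
    ultimately have "(\<Sum>i\<in>UNIV. a i x * V i x + f x * Z i x)\<^sup>2
        \<le> 2 * d * F\<^sup>2 * (\<Sum>i\<in>UNIV. (V i x)\<^sup>2 + (Z i x)\<^sup>2)"
      by (simp only: mult_ac)
    then show ?thesis
      using sq(1)[of "g x" "\<Sum>i\<in>UNIV. a i x * V i x + f x * Z i x"] unfolding R_def by linarith
  qed
  have I: "integrable (lebesgue_on S) (\<lambda>x. (g x)\<^sup>2)" "integrable (lebesgue_on S) (\<lambda>x. (V i x)\<^sup>2)"
    "integrable (lebesgue_on S) (\<lambda>x. (Z i x)\<^sup>2)" for i
    using g V(1) Z(1) unfolding L2_space_def by auto
  have IR: "integrable (lebesgue_on S) R" unfolding R_def[abs_def] using I by simp
  have [measurable]: "G \<in> borel_measurable (lebesgue_on S)"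
    using G S by (intro continuous_imp_measurable_on_sets_lebesgue sets_lebesgue_open)
  have le: "AE x in lebesgue_on S. (G x)\<^sup>2 \<le> R x"
    using eq AE_space by eventually_elim (use bound in auto)
  show IG: "integrable (lebesgue_on S) (\<lambda>x. (G x)\<^sup>2)"
    by (rule Bochner_Integration.integrable_bound[OF IR]) (use le in \<open>auto elim: eventually_mono\<close>)
  have "(LINT x|lebesgue_on S. (G x)\<^sup>2) \<le> (LINT x|lebesgue_on S. R x)"
    by (rule integral_mono_AE[OF IG IR le])
  also have "\<dots> = 2 * (L2_norm S g)\<^sup>2 + 4 * d * F\<^sup>2 * (\<Sum>i\<in>UNIV. (L2_norm S (V i))\<^sup>2 + (L2_norm S (Z i))\<^sup>2)"
    unfolding R_def L2_norm_squared using I by simp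
  also have "(\<Sum>i\<in>UNIV. (L2_norm S (V i))\<^sup>2 + (L2_norm S (Z i))\<^sup>2) \<le> (\<Sum>i\<in>(UNIV :: 'n set). A\<^sup>2 + A\<^sup>2)"
    using V(2) Z(2) by (intro sum_mono add_mono)
  then have "2 * (L2_norm S g)\<^sup>2 + 4 * d * F\<^sup>2 * (\<Sum>i\<in>UNIV. (L2_norm S (V i))\<^sup>2 + (L2_norm S (Z i))\<^sup>2)
      \<le> 2 * (L2_norm S g)\<^sup>2 + 4 * d * F\<^sup>2 * (d * (2 * A\<^sup>2))"
    using d by (intro add_left_mono mult_left_mono) (auto simp: d_def)
  also have "\<dots> \<le> 8 * d\<^sup>2 * ((F * A)\<^sup>2 + (L2_norm S g)\<^sup>2)"
  proof -
    have "1 \<le> d\<^sup>2" using d by simp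
    then have "2 * (L2_norm S g)\<^sup>2 \<le> 8 * d\<^sup>2 * (L2_norm S g)\<^sup>2" by (intro mult_right_mono) auto
    then show ?thesis by (simp add: power2_eq_square algebra_simps)
  qed
  also have "\<dots> \<le> 8 * d\<^sup>2 * (F * A + L2_norm S g)\<^sup>2"
  proof (intro mult_left_mono)
    have "0 \<le> F * A * L2_norm S g" using F A by (simp add: L2_norm_def)
    then show "(F * A)\<^sup>2 + (L2_norm S g)\<^sup>2 \<le> (F * A + L2_norm S g)\<^sup>2"
      unfolding power2_sum by linarith
  qed simp
  finally show "(LINT x|lebesgue_on S. (G x)\<^sup>2) \<le> 8 * (real CARD('n))\<^sup>2 * (F * A + L2_norm S g)\<^sup>2"
    by (simp add: d_def)
qed

lemma Ck_space_bounds: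
  assumes "u \<in> Ck_space k S" "x \<in> S"
  shows "\<bar>u x\<bar> \<le> Ck_norm k S u" and "1 \<le> k \<Longrightarrow> \<bar>partial_deriv i u x\<bar> \<le> Ck_norm k S u"
  using Ck_norm_axis_bound[OF assms(1) _ assms(2), of 0] Ck_norm_axis_bound[OF assms(1) _ assms(2), of 1 i]
  by simp_all

theorem lemma2p2:
  fixes \<O> :: "(real^'n::finite) set" and fmin gmin B :: real
  assumes "smooth_bounded_domain \<O>"
    and "fmin > 0" and "gmin > 0" and "B > 0"
  shows "\<exists>C>0. \<forall>u\<^sub>1 u\<^sub>2 f\<^sub>1 f\<^sub>2 g\<^sub>1 g\<^sub>2 :: real^'n \<Rightarrow> real.
    u\<^sub>1 \<in> Hk_space 2 \<O> \<and> f\<^sub>1 \<in> Ck_space 1 \<O> \<and> g\<^sub>1 \<in> L2_space \<O> \<and> divergence_eq \<O> f\<^sub>1 u\<^sub>1 g\<^sub>1 \<and>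
    u\<^sub>2 \<in> Hk_space 2 \<O> \<and> f\<^sub>2 \<in> Ck_space 1 \<O> \<and> g\<^sub>2 \<in> L2_space \<O> \<and> divergence_eq \<O> f\<^sub>2 u\<^sub>2 g\<^sub>2 \<and>
    u\<^sub>1 \<in> Ck_space 2 \<O> \<and> continuous_on (closure \<O>) u\<^sub>1 \<and> continuous_on \<O> g\<^sub>1 \<and>
    (INF x\<in>\<O>. ereal (f\<^sub>1 x)) \<ge> ereal fmin \<and>
    (INF x\<in>\<O>. ereal (g\<^sub>1 x)) \<ge> ereal gmin \<and>
    (\<forall>x\<in>frontier \<O>. u\<^sub>1 x = 0) \<and>
    max (Ck_norm 1 \<O> f\<^sub>1) (Ck_norm 2 \<O> u\<^sub>1) \<le> B
    \<longrightarrow> L2_norm \<O> (\<lambda>x. f\<^sub>1 x - f\<^sub>2 x)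
        \<le> C * (Ck_norm 1 \<O> f\<^sub>2 * Hk_norm 2 \<O> (\<lambda>x. u\<^sub>1 x - u\<^sub>2 x) + L2_norm \<O> (\<lambda>x. g\<^sub>1 x - g\<^sub>2 x))"
proof -
  \<comment> \<open>The constants of \<open>laplacian_lower_bound\<close>; \<open>C\<close> combines \<open>energy_estimate\<close> and \<open>source_L2_bound\<close>.\<close>
  define \<mu> where "\<mu> = real CARD('n) * B\<^sup>2 / (2 * gmin) / fmin"
  define c where "c = gmin / (2 * B)"
  define C where "C = sqrt (4 / c\<^sup>2 * exp (\<mu> * B) * (8 * (real CARD('n))\<^sup>2))"
  have \<mu>: "\<mu> \<ge> 0" and c: "c > 0" using assms(2-4) by (simp_all add: \<mu>_def c_def)
  have "C > 0" using c by (simp add: C_def)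
  have S: "open \<O>" "bounded \<O>" "\<O> \<noteq> {}"
    using assms(1) by (auto simp: smooth_bounded_domain_def)
  show ?thesis
  proof (intro exI[of _ C] conjI allI impI; (elim conjE)?)
    fix u\<^sub>1 u\<^sub>2 f\<^sub>1 f\<^sub>2 g\<^sub>1 g\<^sub>2 :: "real^'n \<Rightarrow> real"
    assume u\<^sub>1: "u\<^sub>1 \<in> Hk_space 2 \<O>" and f\<^sub>1: "f\<^sub>1 \<in> Ck_space 1 \<O>" and g\<^sub>1: "g\<^sub>1 \<in> L2_space \<O>"
      and eq\<^sub>1: "divergence_eq \<O> f\<^sub>1 u\<^sub>1 g\<^sub>1"
      and u\<^sub>2: "u\<^sub>2 \<in> Hk_space 2 \<O>" and f\<^sub>2: "f\<^sub>2 \<in> Ck_space 1 \<O>" and g\<^sub>2: "g\<^sub>2 \<in> L2_space \<O>"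
      and eq\<^sub>2: "divergence_eq \<O> f\<^sub>2 u\<^sub>2 g\<^sub>2"
      and u\<^sub>1': "u\<^sub>1 \<in> Ck_space 2 \<O>" "continuous_on (closure \<O>) u\<^sub>1" and g\<^sub>1': "continuous_on \<O> g\<^sub>1"
      and inf: "(INF x\<in>\<O>. ereal (f\<^sub>1 x)) \<ge> ereal fmin" "(INF x\<in>\<O>. ereal (g\<^sub>1 x)) \<ge> ereal gmin"
      and bd: "\<forall>x\<in>frontier \<O>. u\<^sub>1 x = 0"
      and B: "max (Ck_norm 1 \<O> f\<^sub>1) (Ck_norm 2 \<O> u\<^sub>1) \<le> B"
    define h where "h x = f\<^sub>1 x - f\<^sub>2 x" for x
    define G where "G x = (\<Sum>i\<in>UNIV. partial_deriv i (\<lambda>x. h x * partial_deriv i u\<^sub>1 x) x)" for x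
    have C1: "cont_diff_on 2 \<O> u\<^sub>1" "cont_diff_on 1 \<O> f\<^sub>1" "cont_diff_on 1 \<O> f\<^sub>2"
      using u\<^sub>1' f\<^sub>1 f\<^sub>2 unfolding Ck_space_def by auto
    have h: "cont_diff_on 1 \<O> h" unfolding h_def[abs_def] by (rule cont_diff_on_1_diff[OF C1(2,3)])
    have fmin: "fmin \<le> f\<^sub>1 x" and gmin: "gmin \<le> g\<^sub>1 x" if "x \<in> \<O>" for x
      using inf that by (auto simp: le_INF_iff)
    have f_le: "\<bar>f\<^sub>1 x\<bar> \<le> B" "\<bar>partial_deriv i f\<^sub>1 x\<bar> \<le> B" and u_le: "\<bar>u\<^sub>1 x\<bar> \<le> B" if "x \<in> \<O>" for x i
      using Ck_space_bounds(1)[OF f\<^sub>1 that] Ck_space_bounds(2)[OF f\<^sub>1 that, of i] Ck_space_bounds(1)[OF u\<^sub>1'(1) that] B by auto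
    note f\<^sub>2_le = Ck_space_bounds[OF f\<^sub>2]
    have classical: "(\<Sum>i\<in>UNIV. partial_deriv i f\<^sub>1 x * partial_deriv i u\<^sub>1 x
        + f\<^sub>1 x * partial_deriv i (partial_deriv i u\<^sub>1) x) = g\<^sub>1 x" if "x \<in> \<O>" for x
      by (rule weak_equation_classical[OF S(1) u\<^sub>1 C1(1,2) eq\<^sub>1 g\<^sub>1' that])
    have neg: "u\<^sub>1 x < 0" if "x \<in> \<O>" for x
    proof (rule maximum_principle[OF S(1,2) C1(1) u\<^sub>1'(2) _ _ _ that])
      show "0 \<le> f\<^sub>1 y" if "y \<in> \<O>" for y using fmin[OF that] assms(2) by simp
      show "0 < (\<Sum>i\<in>UNIV. partial_deriv i f\<^sub>1 y * partial_deriv i u\<^sub>1 y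
          + f\<^sub>1 y * partial_deriv i (partial_deriv i u\<^sub>1) y)" if "y \<in> \<O>" for y
        using classical[OF that] gmin[OF that] assms(3) by simp
    qed (use bd in auto)
    have low: "c \<le> (\<Sum>i\<in>UNIV. partial_deriv i (partial_deriv i u\<^sub>1) x) + \<mu> * (\<Sum>i\<in>UNIV. (partial_deriv i u\<^sub>1 x)\<^sup>2)"
      if "x \<in> \<O>" for x
      unfolding c_def \<mu>_def
    proof (rule laplacian_lower_bound[OF assms(2) fmin[OF that] _ assms(3)])
      show "f\<^sub>1 x \<le> B" using f_le(1)[OF that] by simp
      show "gmin \<le> (\<Sum>i\<in>UNIV. partial_deriv i f\<^sub>1 x * partial_deriv i u\<^sub>1 x
          + f\<^sub>1 x * partial_deriv i (partial_deriv i u\<^sub>1) x)"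
        using classical[OF that] gmin[OF that] by simp
    qed (use f_le(2)[OF that] in auto)
    obtain x\<^sub>0 where x\<^sub>0: "x\<^sub>0 \<in> \<O>" using S(3) by blast
    define F A where "F = Ck_norm 1 \<O> f\<^sub>2" and "A = Hk_norm 2 \<O> (\<lambda>x. u\<^sub>1 x - u\<^sub>2 x)"
    have F: "F \<ge> 0" using f\<^sub>2_le(1)[OF x\<^sub>0] by (simp add: F_def)
    have A: "A \<ge> 0" by (simp add: A_def Hk_norm_def sum_nonneg)
    have contG: "continuous_on \<O> G"
      unfolding G_def using cont_diff_on_1_imp(3)[OF cont_diff_on_1_mult[OF h cont_diff_on_2_imp(2)[OF C1(1)]]]
      by (intro continuous_on_sum)
    define V Z where "V i = weak_deriv \<O> (mi_axis 1 i) (\<lambda>x. u\<^sub>1 x - u\<^sub>2 x)"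
      and "Z i = weak_deriv \<O> (mi_axis 2 i) (\<lambda>x. u\<^sub>1 x - u\<^sub>2 x)" for i
    have VZ: "V i \<in> L2_space \<O>" "Z i \<in> L2_space \<O>" for i
      unfolding V_def Z_def by (rule Hk_space_diff_weak_deriv(2)[OF S(1) u\<^sub>1 u\<^sub>2]; simp)+
    have VZ_le: "(L2_norm \<O> (V i))\<^sup>2 \<le> A\<^sup>2" "(L2_norm \<O> (Z i))\<^sup>2 \<le> A\<^sup>2" for i
      unfolding V_def Z_def A_def by (rule L2_norm_weak_deriv_le; simp)+
    have eq: "AE x in lebesgue_on \<O>. G x = g\<^sub>1 x - g\<^sub>2 x
        - (\<Sum>i\<in>UNIV. partial_deriv i f\<^sub>2 x * V i x + f\<^sub>2 x * Z i x)"
      unfolding G_def h_def V_def Z_def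
      by (rule difference_equation[OF S(1) u\<^sub>1 C1(1) u\<^sub>2 C1(2,3) eq\<^sub>1 eq\<^sub>2])
    have pf\<^sub>2_le: "\<bar>partial_deriv i f\<^sub>2 x\<bar> \<le> F" and f\<^sub>2_le': "\<bar>f\<^sub>2 x\<bar> \<le> F" if "x \<in> \<O>" for i x
      using f\<^sub>2_le(1)[OF that] f\<^sub>2_le(2)[OF that] by (simp_all add: F_def)
    note G = source_L2_bound[OF S(1) L2_space_diff[OF g\<^sub>1 g\<^sub>2] VZ(1) VZ_le(1) VZ(2) VZ_le(2) A
        pf\<^sub>2_le f\<^sub>2_le' F contG eq]
    have "(LINT x|lebesgue_on \<O>. (h x)\<^sup>2) \<le> 4 / c\<^sup>2 * exp (\<mu> * B) * (LINT x|lebesgue_on \<O>. (G x)\<^sup>2)"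
      unfolding G_def
    proof (rule energy_estimate[OF S(1,2) C1(1) h u\<^sub>1'(2) _ _ neg _ \<mu> c low])
      show "\<bar>h x\<bar> \<le> B + F" if "x \<in> \<O>" for x
        using f_le(1)[OF that] f\<^sub>2_le(1)[OF that] by (simp add: h_def F_def)
      show "- B \<le> u\<^sub>1 x" if "x \<in> \<O>" for x using u_le[OF that] by linarith
      show "integrable (lebesgue_on \<O>) (\<lambda>x. (\<Sum>i\<in>UNIV. partial_deriv i (\<lambda>x. h x * partial_deriv i u\<^sub>1 x) x)\<^sup>2)"
        using G(1) unfolding G_def .
    qed (use bd in auto)
    also have "\<dots> \<le> 4 / c\<^sup>2 * exp (\<mu> * B) * (8 * (real CARD('n))\<^sup>2 * (F * A + L2_norm \<O> (\<lambda>x. g\<^sub>1 x - g\<^sub>2 x))\<^sup>2)"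
      using G(2) by (intro mult_left_mono) auto
    also have "\<dots> = (C * (F * A + L2_norm \<O> (\<lambda>x. g\<^sub>1 x - g\<^sub>2 x)))\<^sup>2"
      unfolding C_def by (simp add: power_mult_distrib)
    finally have "L2_norm \<O> h \<le> sqrt ((C * (F * A + L2_norm \<O> (\<lambda>x. g\<^sub>1 x - g\<^sub>2 x)))\<^sup>2)"
      unfolding L2_norm_def by (rule real_sqrt_le_mono)
    also have "\<dots> = C * (F * A + L2_norm \<O> (\<lambda>x. g\<^sub>1 x - g\<^sub>2 x))"
      using \<open>C > 0\<close> F A by (simp add: L2_norm_def)
    finally show "L2_norm \<O> (\<lambda>x. f\<^sub>1 x - f\<^sub>2 x)
        \<le> C * (Ck_norm 1 \<O> f\<^sub>2 * Hk_norm 2 \<O> (\<lambda>x. u\<^sub>1 x - u\<^sub>2 x) + L2_norm \<O> (\<lambda>x. g\<^sub>1 x - g\<^sub>2 x))"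
      unfolding h_def[abs_def] F_def A_def .
  qed (fact \<open>C > 0\<close>)
qed

end
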